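(* In the syntax $\mathbf{0}_{\mathsf{TT}_0}$ of $\mathsf{TT}_0$, for every context $\Gamma$ there is a substitution $\upuparrows_\Gamma : \mathsf{Sub}\,\Gamma\,(0\Gamma)$ whose image under zeroing is the identity substitution on $0\Gamma$, i.e. $0(\upuparrows_\Gamma)=\mathsf{id}$ (up to $0(0\Gamma)=0\Gamma$), and such that for every type $A : \mathsf{Ty}_\ell\,\Gamma$ we have $(0A)[\upuparrows_\Gamma] = A$, and for every term $a : \mathsf{Tm}_i\,\Gamma\,A$ (any mode $i\in\{0,\omega\}$) we have $(0a)[\upuparrows_\Gamma] = \downarrow_\star a$. Consequently, zeroing induces isomorphisms, natural in $\Gamma$, \[ \mathsf{Ty}_\ell\,(0\Gamma) \cong \mathsf{Ty}_\ell\,\Gamma, \qquad \mathsf{Tm}_0\,(0\Gamma)\,(0A) \cong \mathsf{Tm}_0\,\Gamma\,A. \]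
   Context: $\mathsf{TT}_0$ (type theory with erasure) has as syntax $\mathbf{0}_{\mathsf{TT}_0}$ the initial model of the following generalised algebraic theory. There is a category of contexts $\mathsf{Con}$ with substitutions $\mathsf{Sub}\,\Gamma\,\Delta$, identity $\mathsf{id}$, composition $\circ$ and a terminal empty context $\bullet$. There are presheaves (with substitution action $-[\sigma]$ respecting $\mathsf{id}$ and $\circ$): types $\mathsf{Ty}_\ell\,\Gamma$ for levels $\ell\in\mathbb N$; terms $\mathsf{Tm}_i\,\Gamma\,A$ for each mode $i\in\{0,\omega\}$ ($0$ = erased, $\omega$ = runtime) and $A:\mathsf{Ty}_\ell\,\Gamma$; and a proposition-valued presheaf $\#\in\Gamma$ (the erasure marker; any two elements are equal). There are context extensions $\Gamma\rhd_i A$ and $\Gamma\rhd\#$ with natural isomorphisms $\mathsf{Sub}\,\Gamma\,(\Delta\rhd_i A)\cong (\sigma:\mathsf{Sub}\,\Gamma\,\Delta)\times \mathsf{Tm}_i\,\Gamma\,A[\sigma]$ and $\mathsf{Sub}\,\Gamma\,(\Delta\rhd\#)\cong\mathsf{Sub}\,\Gamma\,\Delta\times(\#\in\Gamma)$, giving weakenings $\mathsf p_i:\mathsf{Sub}\,(\Gamma\rhd_iA)\,\Gamma$, $\mathsf p_\#:\mathsf{Sub}\,(\Gamma\rhd\#)\,\Gamma$ and variables $\mathsf q_i:\mathsf{Tm}_i\,(\Gamma\rhd_iA)\,A[\mathsf p_i]$, $\mathsf q_\#:\#\in(\Gamma\rhd\#)$. There is a natural isomorphism of erasure coercions $(\downarrow,\uparrow):\mathsf{Tm}_\omega\,(\Gamma\rhd\#)\,A\cong\mathsf{Tm}_0\,\Gamma\,A$.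 Type formers: $\Pi_i,\Sigma_i : (A:\mathsf{Ty}_\ell\,\Gamma)\to\mathsf{Ty}_\ell(\Gamma\rhd_iA)\to\mathsf{Ty}_\ell\,\Gamma$ with isomorphisms $(\mathsf{lam},\mathsf{app}):\mathsf{Tm}_\omega\,(\Gamma\rhd_iA)\,B\cong\mathsf{Tm}_\omega\,\Gamma\,(\Pi_i\,A\,B)$ and $(\mathsf{pair},\mathsf{proj}):(x:\mathsf{Tm}_i\,\Gamma\,A)\times\mathsf{Tm}_\omega\,\Gamma\,B[\mathsf{id},x]\cong\mathsf{Tm}_\omega\,\Gamma\,(\Sigma_i\,A\,B)$, and universes $\mathsf U_\ell:\mathsf{Ty}_{\ell+1}\,\Gamma$ with $(\mathsf{El},\mathsf{code}):\mathsf{Tm}_0\,\Gamma\,\mathsf U_\ell\cong\mathsf{Ty}_\ell\,\Gamma$, all stable under substitution. The map $\downarrow_\star:\mathsf{Tm}_i\,\Gamma\,A\to\mathsf{Tm}_0\,\Gamma\,A$ is the identity for $i=0$ and $t\mapsto\downarrow(t[\mathsf p_\#])$ for $i=\omega$. Using the coercions, every runtime term former has a derivable erased counterpart (e.g. $\mathsf{lam}_0,\mathsf{app}_0$ on $\mathsf{Tm}_0$) satisfying the same equations. Zeroing: the structure-preserving endomorphism $0$ of $\mathsf{TT}_0$ that interprets types as types, both $\mathsf{Tm}_0\,A$ and $\mathsf{Tm}_\omega\,A$ as $\mathsf{Tm}_0\,A$, the marker $\#$ as the unit type, each $\Pi_i,\Sigma_i,\mathsf U_\ell$ as itself, runtime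 term formers by their erased counterparts, and the coercions trivially. On syntax it yields maps $0:\mathsf{Con}\to\mathsf{Con}$ with $0\bullet=\bullet$, $0(\Gamma\rhd_iA)=0\Gamma\rhd_0 0A$, $0(\Gamma\rhd\#)=0\Gamma$, and $0:\mathsf{Ty}_\ell\,\Gamma\to\mathsf{Ty}_\ell\,(0\Gamma)$, $0:\mathsf{Tm}_i\,\Gamma\,A\to\mathsf{Tm}_0\,(0\Gamma)\,(0A)$, compatible with substitution. *)

theory Defs
  imports Main
begin

text \<open>Modes: Ze = 0 (erased), Om = omega (runtime).\<close>
datatype mode = Ze | Om

text \<open>A (set-based) algebra for the signature of TT0. The sorts are carved out
 of four carrier types by dependent predicates; operations are total functions
 taking the implicit arguments needed.  The erasure marker is proposition valued
 (a boolean per context), so its only elements are proofs; the pairing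
 substitution for Gamma |> # therefore only takes the substitution.\<close>
record ('c,'s,'t,'m) tt0 =
  CON :: "'c set"
  SUB :: "'c \<Rightarrow> 'c \<Rightarrow> 's set"
  sid :: "'c \<Rightarrow> 's"
  scomp :: "'s \<Rightarrow> 's \<Rightarrow> 's"
  emp :: "'c"
  epsS :: "'c \<Rightarrow> 's"
  TY :: "nat \<Rightarrow> 'c \<Rightarrow> 't set"
  tsub :: "'t \<Rightarrow> 's \<Rightarrow> 't"
  TM :: "mode \<Rightarrow> 'c \<Rightarrow> 't \<Rightarrow> 'm set"
  msub :: "'m \<Rightarrow> 's \<Rightarrow> 'm"
  MK :: "'c \<Rightarrow> bool"
  extC :: "mode \<Rightarrow> 'c \<Rightarrow> 't \<Rightarrow> 'c"
  pp :: "mode \<Rightarrow> 'c \<Rightarrow> 't \<Rightarrow> 's"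
  qq :: "mode \<Rightarrow> 'c \<Rightarrow> 't \<Rightarrow> 'm"
  spair :: "mode \<Rightarrow> 's \<Rightarrow> 'm \<Rightarrow> 's"
  extM :: "'c \<Rightarrow> 'c"
  pM :: "'c \<Rightarrow> 's"
  spairM :: "'s \<Rightarrow> 's"
  dn :: "'m \<Rightarrow> 'm"
  upc :: "'m \<Rightarrow> 'm"
  PI :: "mode \<Rightarrow> 'c \<Rightarrow> 't \<Rightarrow> 't \<Rightarrow> 't"
  SG :: "mode \<Rightarrow> 'c \<Rightarrow> 't \<Rightarrow> 't \<Rightarrow> 't"
  lam :: "mode \<Rightarrow> 'c \<Rightarrow> 't \<Rightarrow> 't \<Rightarrow> 'm \<Rightarrow> 'm"
  app :: "mode \<Rightarrow> 'c \<Rightarrow> 't \<Rightarrow> 't \<Rightarrow> 'm \<Rightarrow> 'm"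
  tpair :: "mode \<Rightarrow> 'c \<Rightarrow> 't \<Rightarrow> 't \<Rightarrow> 'm \<Rightarrow> 'm \<Rightarrow> 'm"
  proj :: "mode \<Rightarrow> 'c \<Rightarrow> 't \<Rightarrow> 't \<Rightarrow> 'm \<Rightarrow> 'm \<times> 'm"
  UU :: "nat \<Rightarrow> 'c \<Rightarrow> 't"
  EL :: "'m \<Rightarrow> 't"
  codeU :: "'t \<Rightarrow> 'm"

text \<open>Weakening of a substitution sigma : Sub Gamma Delta along A : Ty Delta,
 giving Sub (Gamma |>_i A[sigma]) (Delta |>_i A).\<close>
definition liftS :: "('c,'s,'t,'m,'z) tt0_scheme \<Rightarrow> mode \<Rightarrow> 'c \<Rightarrow> 't \<Rightarrow> 's \<Rightarrow> 's" where
  "liftS M i \<Gamma> A \<sigma> = spair M i (scomp M \<sigma> (pp M i \<Gamma> (tsub M A \<sigma>))) (qq M i \<Gamma> (tsub M A \<sigma>))"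

definition is_model :: "('c,'s,'t,'m,'z) tt0_scheme \<Rightarrow> bool" where
  "is_model M \<longleftrightarrow>
   (\<forall>\<Gamma>\<in>CON M. sid M \<Gamma> \<in> SUB M \<Gamma> \<Gamma>) \<and>
   (\<forall>\<Gamma>\<in>CON M. \<forall>\<Delta>\<in>CON M. \<forall>\<Theta>\<in>CON M. \<forall>\<sigma>\<in>SUB M \<Delta> \<Theta>. \<forall>\<delta>\<in>SUB M \<Gamma> \<Delta>.
      scomp M \<sigma> \<delta> \<in> SUB M \<Gamma> \<Theta>) \<and>
   (\<forall>\<Gamma>\<in>CON M. \<forall>\<Delta>\<in>CON M. \<forall>\<sigma>\<in>SUB M \<Gamma> \<Delta>.
      scomp M (sid M \<Delta>) \<sigma> = \<sigma> \<and> scomp M \<sigma> (sid M \<Gamma>) = \<sigma>) \<and>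
   (\<forall>\<Gamma>\<in>CON M. \<forall>\<Delta>\<in>CON M. \<forall>\<Theta>\<in>CON M. \<forall>\<Xi>\<in>CON M.
      \<forall>\<sigma>\<in>SUB M \<Theta> \<Xi>. \<forall>\<delta>\<in>SUB M \<Delta> \<Theta>. \<forall>\<nu>\<in>SUB M \<Gamma> \<Delta>.
      scomp M (scomp M \<sigma> \<delta>) \<nu> = scomp M \<sigma> (scomp M \<delta> \<nu>)) \<and>
   emp M \<in> CON M \<and>
   (\<forall>\<Gamma>\<in>CON M. epsS M \<Gamma> \<in> SUB M \<Gamma> (emp M) \<and> (\<forall>\<sigma>\<in>SUB M \<Gamma> (emp M). \<sigma> = epsS M \<Gamma>)) \<and>
   (\<forall>l. \<forall>\<Gamma>\<in>CON M. \<forall>\<Delta>\<in>CON M. \<forall>\<sigma>\<in>SUB M \<Gamma> \<Delta>. \<forall>A\<in>TY M l \<Delta>. tsub M A \<sigma> \<in> TY M l \<Gamma>) \<and>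
   (\<forall>l. \<forall>\<Gamma>\<in>CON M. \<forall>A\<in>TY M l \<Gamma>. tsub M A (sid M \<Gamma>) = A) \<and>
   (\<forall>l. \<forall>\<Gamma>\<in>CON M. \<forall>\<Delta>\<in>CON M. \<forall>\<Theta>\<in>CON M. \<forall>\<sigma>\<in>SUB M \<Delta> \<Theta>. \<forall>\<delta>\<in>SUB M \<Gamma> \<Delta>.
      \<forall>A\<in>TY M l \<Theta>. tsub M A (scomp M \<sigma> \<delta>) = tsub M (tsub M A \<sigma>) \<delta>) \<and>
   (\<forall>i l. \<forall>\<Gamma>\<in>CON M. \<forall>\<Delta>\<in>CON M. \<forall>\<sigma>\<in>SUB M \<Gamma> \<Delta>. \<forall>A\<in>TY M l \<Delta>. \<forall>a\<in>TM M i \<Delta> A.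
      msub M a \<sigma> \<in> TM M i \<Gamma> (tsub M A \<sigma>)) \<and>
   (\<forall>i l. \<forall>\<Gamma>\<in>CON M. \<forall>A\<in>TY M l \<Gamma>. \<forall>a\<in>TM M i \<Gamma> A. msub M a (sid M \<Gamma>) = a) \<and>
   (\<forall>i l. \<forall>\<Gamma>\<in>CON M. \<forall>\<Delta>\<in>CON M. \<forall>\<Theta>\<in>CON M. \<forall>\<sigma>\<in>SUB M \<Delta> \<Theta>. \<forall>\<delta>\<in>SUB M \<Gamma> \<Delta>.
      \<forall>A\<in>TY M l \<Theta>. \<forall>a\<in>TM M i \<Theta> A. msub M a (scomp M \<sigma> \<delta>) = msub M (msub M a \<sigma>) \<delta>) \<and>
   (\<forall>\<Gamma>\<in>CON M. \<forall>\<Delta>\<in>CON M. \<forall>\<sigma>\<in>SUB M \<Gamma> \<Delta>. MK M \<Delta> \<longrightarrow> MK M \<Gamma>) \<and>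
   (\<forall>i l. \<forall>\<Gamma>\<in>CON M. \<forall>A\<in>TY M l \<Gamma>.
      extC M i \<Gamma> A \<in> CON M \<and> pp M i \<Gamma> A \<in> SUB M (extC M i \<Gamma> A) \<Gamma> \<and>
      qq M i \<Gamma> A \<in> TM M i (extC M i \<Gamma> A) (tsub M A (pp M i \<Gamma> A))) \<and>
   (\<forall>i l. \<forall>\<Gamma>\<in>CON M. \<forall>\<Delta>\<in>CON M. \<forall>A\<in>TY M l \<Delta>. \<forall>\<sigma>\<in>SUB M \<Gamma> \<Delta>. \<forall>t\<in>TM M i \<Gamma> (tsub M A \<sigma>).
      spair M i \<sigma> t \<in> SUB M \<Gamma> (extC M i \<Delta> A) \<and>
      scomp M (pp M i \<Delta> A) (spair M i \<sigma> t) = \<sigma> \<and>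
      msub M (qq M i \<Delta> A) (spair M i \<sigma> t) = t) \<and>
   (\<forall>i l. \<forall>\<Gamma>\<in>CON M. \<forall>\<Delta>\<in>CON M. \<forall>A\<in>TY M l \<Delta>. \<forall>\<tau>\<in>SUB M \<Gamma> (extC M i \<Delta> A).
      spair M i (scomp M (pp M i \<Delta> A) \<tau>) (msub M (qq M i \<Delta> A) \<tau>) = \<tau>) \<and>
   (\<forall>\<Gamma>\<in>CON M. extM M \<Gamma> \<in> CON M \<and> pM M \<Gamma> \<in> SUB M (extM M \<Gamma>) \<Gamma> \<and> MK M (extM M \<Gamma>)) \<and>
   (\<forall>\<Gamma>\<in>CON M. \<forall>\<Delta>\<in>CON M. \<forall>\<sigma>\<in>SUB M \<Gamma> \<Delta>. MK M \<Gamma> \<longrightarrow>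
      spairM M \<sigma> \<in> SUB M \<Gamma> (extM M \<Delta>) \<and> scomp M (pM M \<Delta>) (spairM M \<sigma>) = \<sigma>) \<and>
   (\<forall>\<Gamma>\<in>CON M. \<forall>\<Delta>\<in>CON M. \<forall>\<tau>\<in>SUB M \<Gamma> (extM M \<Delta>).
      spairM M (scomp M (pM M \<Delta>) \<tau>) = \<tau>) \<and>
   (\<forall>l. \<forall>\<Gamma>\<in>CON M. \<forall>A\<in>TY M l \<Gamma>.
      (\<forall>a\<in>TM M Om (extM M \<Gamma>) (tsub M A (pM M \<Gamma>)). dn M a \<in> TM M Ze \<Gamma> A \<and> upc M (dn M a) = a) \<and>
      (\<forall>a\<in>TM M Ze \<Gamma> A. upc M a \<in> TM M Om (extM M \<Gamma>) (tsub M A (pM M \<Gamma>)) \<and> dn M (upc M a) = a)) \<and>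
   (\<forall>l. \<forall>\<Gamma>\<in>CON M. \<forall>\<Delta>\<in>CON M. \<forall>\<sigma>\<in>SUB M \<Gamma> \<Delta>. \<forall>A\<in>TY M l \<Delta>.
      \<forall>a\<in>TM M Om (extM M \<Delta>) (tsub M A (pM M \<Delta>)).
      msub M (dn M a) \<sigma> = dn M (msub M a (spairM M (scomp M \<sigma> (pM M \<Gamma>))))) \<and>
   (\<forall>i l. \<forall>\<Gamma>\<in>CON M. \<forall>A\<in>TY M l \<Gamma>. \<forall>B\<in>TY M l (extC M i \<Gamma> A).
      PI M i \<Gamma> A B \<in> TY M l \<Gamma> \<and> SG M i \<Gamma> A B \<in> TY M l \<Gamma> \<and>
      (\<forall>t\<in>TM M Om (extC M i \<Gamma> A) B.
         lam M i \<Gamma> A B t \<in> TM M Om \<Gamma> (PI M i \<Gamma> A B) \<and> app M i \<Gamma> A B (lam M i \<Gamma> A B t) = t) \<and>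
      (\<forall>t\<in>TM M Om \<Gamma> (PI M i \<Gamma> A B).
         app M i \<Gamma> A B t \<in> TM M Om (extC M i \<Gamma> A) B \<and> lam M i \<Gamma> A B (app M i \<Gamma> A B t) = t) \<and>
      (\<forall>x\<in>TM M i \<Gamma> A. \<forall>b\<in>TM M Om \<Gamma> (tsub M B (spair M i (sid M \<Gamma>) x)).
         tpair M i \<Gamma> A B x b \<in> TM M Om \<Gamma> (SG M i \<Gamma> A B) \<and> proj M i \<Gamma> A B (tpair M i \<Gamma> A B x b) = (x, b)) \<and>
      (\<forall>t\<in>TM M Om \<Gamma> (SG M i \<Gamma> A B).
         fst (proj M i \<Gamma> A B t) \<in> TM M i \<Gamma> A \<and>
         snd (proj M i \<Gamma> A B t) \<in> TM M Om \<Gamma> (tsub M B (spair M i (sid M \<Gamma>) (fst (proj M i \<Gamma> A B t)))) \<and>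
         tpair M i \<Gamma> A B (fst (proj M i \<Gamma> A B t)) (snd (proj M i \<Gamma> A B t)) = t)) \<and>
   (\<forall>i l. \<forall>\<Gamma>\<in>CON M. \<forall>\<Delta>\<in>CON M. \<forall>\<sigma>\<in>SUB M \<Gamma> \<Delta>. \<forall>A\<in>TY M l \<Delta>. \<forall>B\<in>TY M l (extC M i \<Delta> A).
      tsub M (PI M i \<Delta> A B) \<sigma> = PI M i \<Gamma> (tsub M A \<sigma>) (tsub M B (liftS M i \<Gamma> A \<sigma>)) \<and>
      tsub M (SG M i \<Delta> A B) \<sigma> = SG M i \<Gamma> (tsub M A \<sigma>) (tsub M B (liftS M i \<Gamma> A \<sigma>)) \<and>
      (\<forall>t\<in>TM M Om (extC M i \<Delta> A) B.
         msub M (lam M i \<Delta> A B t) \<sigma> =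
         lam M i \<Gamma> (tsub M A \<sigma>) (tsub M B (liftS M i \<Gamma> A \<sigma>)) (msub M t (liftS M i \<Gamma> A \<sigma>))) \<and>
      (\<forall>x\<in>TM M i \<Delta> A. \<forall>b\<in>TM M Om \<Delta> (tsub M B (spair M i (sid M \<Delta>) x)).
         msub M (tpair M i \<Delta> A B x b) \<sigma> =
         tpair M i \<Gamma> (tsub M A \<sigma>) (tsub M B (liftS M i \<Gamma> A \<sigma>)) (msub M x \<sigma>) (msub M b \<sigma>))) \<and>
   (\<forall>l. \<forall>\<Gamma>\<in>CON M.
      UU M l \<Gamma> \<in> TY M (Suc l) \<Gamma> \<and>
      (\<forall>a\<in>TM M Ze \<Gamma> (UU M l \<Gamma>). EL M a \<in> TY M l \<Gamma> \<and> codeU M (EL M a) = a) \<and>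
      (\<forall>A\<in>TY M l \<Gamma>. codeU M A \<in> TM M Ze \<Gamma> (UU M l \<Gamma>) \<and> EL M (codeU M A) = A)) \<and>
   (\<forall>l. \<forall>\<Gamma>\<in>CON M. \<forall>\<Delta>\<in>CON M. \<forall>\<sigma>\<in>SUB M \<Gamma> \<Delta>.
      tsub M (UU M l \<Delta>) \<sigma> = UU M l \<Gamma> \<and>
      (\<forall>a\<in>TM M Ze \<Delta> (UU M l \<Delta>). tsub M (EL M a) \<sigma> = EL M (msub M a \<sigma>)))"

record ('c,'s,'t,'m) hom =
  hC :: "'c \<Rightarrow> 'c"
  hS :: "'s \<Rightarrow> 's"
  hT :: "'t \<Rightarrow> 't"
  hM :: "'m \<Rightarrow> 'm"

definition is_morph :: "('c,'s,'t,'m,'z) tt0_scheme \<Rightarrow> ('c,'s,'t,'m,'z) tt0_scheme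
    \<Rightarrow> ('c,'s,'t,'m) hom \<Rightarrow> bool" where
  "is_morph M N F \<longleftrightarrow>
   (\<forall>\<Gamma>\<in>CON M. hC F \<Gamma> \<in> CON N) \<and>
   (\<forall>\<Gamma>\<in>CON M. \<forall>\<Delta>\<in>CON M. \<forall>\<sigma>\<in>SUB M \<Gamma> \<Delta>. hS F \<sigma> \<in> SUB N (hC F \<Gamma>) (hC F \<Delta>)) \<and>
   (\<forall>l. \<forall>\<Gamma>\<in>CON M. \<forall>A\<in>TY M l \<Gamma>. hT F A \<in> TY N l (hC F \<Gamma>)) \<and>
   (\<forall>i l. \<forall>\<Gamma>\<in>CON M. \<forall>A\<in>TY M l \<Gamma>. \<forall>a\<in>TM M i \<Gamma> A. hM F a \<in> TM N i (hC F \<Gamma>) (hT F A)) \<and>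
   (\<forall>\<Gamma>\<in>CON M. MK M \<Gamma> \<longrightarrow> MK N (hC F \<Gamma>)) \<and>
   (\<forall>\<Gamma>\<in>CON M. hS F (sid M \<Gamma>) = sid N (hC F \<Gamma>)) \<and>
   (\<forall>\<Gamma>\<in>CON M. \<forall>\<Delta>\<in>CON M. \<forall>\<Theta>\<in>CON M. \<forall>\<sigma>\<in>SUB M \<Delta> \<Theta>. \<forall>\<delta>\<in>SUB M \<Gamma> \<Delta>.
      hS F (scomp M \<sigma> \<delta>) = scomp N (hS F \<sigma>) (hS F \<delta>)) \<and>
   hC F (emp M) = emp N \<and>
   (\<forall>\<Gamma>\<in>CON M. hS F (epsS M \<Gamma>) = epsS N (hC F \<Gamma>)) \<and>
   (\<forall>l. \<forall>\<Gamma>\<in>CON M. \<forall>\<Delta>\<in>CON M. \<forall>\<sigma>\<in>SUB M \<Gamma> \<Delta>. \<forall>A\<in>TY M l \<Delta>.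
      hT F (tsub M A \<sigma>) = tsub N (hT F A) (hS F \<sigma>)) \<and>
   (\<forall>i l. \<forall>\<Gamma>\<in>CON M. \<forall>\<Delta>\<in>CON M. \<forall>\<sigma>\<in>SUB M \<Gamma> \<Delta>. \<forall>A\<in>TY M l \<Delta>. \<forall>a\<in>TM M i \<Delta> A.
      hM F (msub M a \<sigma>) = msub N (hM F a) (hS F \<sigma>)) \<and>
   (\<forall>i l. \<forall>\<Gamma>\<in>CON M. \<forall>A\<in>TY M l \<Gamma>.
      hC F (extC M i \<Gamma> A) = extC N i (hC F \<Gamma>) (hT F A) \<and>
      hS F (pp M i \<Gamma> A) = pp N i (hC F \<Gamma>) (hT F A) \<and>
      hM F (qq M i \<Gamma> A) = qq N i (hC F \<Gamma>) (hT F A)) \<and>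
   (\<forall>i l. \<forall>\<Gamma>\<in>CON M. \<forall>\<Delta>\<in>CON M. \<forall>A\<in>TY M l \<Delta>. \<forall>\<sigma>\<in>SUB M \<Gamma> \<Delta>. \<forall>t\<in>TM M i \<Gamma> (tsub M A \<sigma>).
      hS F (spair M i \<sigma> t) = spair N i (hS F \<sigma>) (hM F t)) \<and>
   (\<forall>\<Gamma>\<in>CON M. hC F (extM M \<Gamma>) = extM N (hC F \<Gamma>) \<and> hS F (pM M \<Gamma>) = pM N (hC F \<Gamma>)) \<and>
   (\<forall>\<Gamma>\<in>CON M. \<forall>\<Delta>\<in>CON M. \<forall>\<sigma>\<in>SUB M \<Gamma> \<Delta>. MK M \<Gamma> \<longrightarrow>
      hS F (spairM M \<sigma>) = spairM N (hS F \<sigma>)) \<and>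
   (\<forall>l. \<forall>\<Gamma>\<in>CON M. \<forall>A\<in>TY M l \<Gamma>.
      (\<forall>a\<in>TM M Om (extM M \<Gamma>) (tsub M A (pM M \<Gamma>)). hM F (dn M a) = dn N (hM F a)) \<and>
      (\<forall>a\<in>TM M Ze \<Gamma> A. hM F (upc M a) = upc N (hM F a))) \<and>
   (\<forall>i l. \<forall>\<Gamma>\<in>CON M. \<forall>A\<in>TY M l \<Gamma>. \<forall>B\<in>TY M l (extC M i \<Gamma> A).
      hT F (PI M i \<Gamma> A B) = PI N i (hC F \<Gamma>) (hT F A) (hT F B) \<and>
      hT F (SG M i \<Gamma> A B) = SG N i (hC F \<Gamma>) (hT F A) (hT F B) \<and>
      (\<forall>t\<in>TM M Om (extC M i \<Gamma> A) B.
         hM F (lam M i \<Gamma> A B t) = lam N i (hC F \<Gamma>) (hT F A) (hT F B) (hM F t)) \<and>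
      (\<forall>t\<in>TM M Om \<Gamma> (PI M i \<Gamma> A B).
         hM F (app M i \<Gamma> A B t) = app N i (hC F \<Gamma>) (hT F A) (hT F B) (hM F t)) \<and>
      (\<forall>x\<in>TM M i \<Gamma> A. \<forall>b\<in>TM M Om \<Gamma> (tsub M B (spair M i (sid M \<Gamma>) x)).
         hM F (tpair M i \<Gamma> A B x b) = tpair N i (hC F \<Gamma>) (hT F A) (hT F B) (hM F x) (hM F b)) \<and>
      (\<forall>t\<in>TM M Om \<Gamma> (SG M i \<Gamma> A B).
         map_prod (hM F) (hM F) (proj M i \<Gamma> A B t) = proj N i (hC F \<Gamma>) (hT F A) (hT F B) (hM F t))) \<and>
   (\<forall>l. \<forall>\<Gamma>\<in>CON M.
      hT F (UU M l \<Gamma>) = UU N l (hC F \<Gamma>) \<and>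
      (\<forall>a\<in>TM M Ze \<Gamma> (UU M l \<Gamma>). hT F (EL M a) = EL N (hM F a)) \<and>
      (\<forall>A\<in>TY M l \<Gamma>. hM F (codeU M A) = codeU N (hT F A)))"

definition morph_eq :: "('c,'s,'t,'m,'z) tt0_scheme \<Rightarrow> ('c,'s,'t,'m) hom \<Rightarrow> ('c,'s,'t,'m) hom \<Rightarrow> bool" where
  "morph_eq M F G \<longleftrightarrow>
   (\<forall>\<Gamma>\<in>CON M. hC F \<Gamma> = hC G \<Gamma>) \<and>
   (\<forall>\<Gamma>\<in>CON M. \<forall>\<Delta>\<in>CON M. \<forall>\<sigma>\<in>SUB M \<Gamma> \<Delta>. hS F \<sigma> = hS G \<sigma>) \<and>
   (\<forall>l. \<forall>\<Gamma>\<in>CON M. \<forall>A\<in>TY M l \<Gamma>. hT F A = hT G A) \<and>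
   (\<forall>i l. \<forall>\<Gamma>\<in>CON M. \<forall>A\<in>TY M l \<Gamma>. \<forall>a\<in>TM M i \<Gamma> A. hM F a = hM G a)"

text \<open>Initiality (the syntax 0_TT0). Since HOL cannot quantify over all types
 inside a formula, initiality is taken relative to all models whose carriers
 live in the same four types (this class contains all submodels of M and the
 zeroed model of M).\<close>
definition is_initial :: "('c,'s,'t,'m) tt0 \<Rightarrow> bool" where
  "is_initial M \<longleftrightarrow> is_model M \<and>
     (\<forall>N :: ('c,'s,'t,'m) tt0. is_model N \<longrightarrow>
        (\<exists>F. is_morph M N F) \<and> (\<forall>F G. is_morph M N F \<longrightarrow> is_morph M N G \<longrightarrow> morph_eq M F G))"

definition downstar :: "('c,'s,'t,'m,'z) tt0_scheme \<Rightarrow> mode \<Rightarrow> 'c \<Rightarrow> 'm \<Rightarrow> 'm" where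
  "downstar M i \<Gamma> a = (case i of Ze \<Rightarrow> a | Om \<Rightarrow> dn M (msub M a (pM M \<Gamma>)))"

text \<open>(p_i, down_star q_i) : Sub (Gamma |>_i A) (Gamma |>_0 A).\<close>
definition wS :: "('c,'s,'t,'m,'z) tt0_scheme \<Rightarrow> mode \<Rightarrow> 'c \<Rightarrow> 't \<Rightarrow> 's" where
  "wS M i \<Gamma> A = spair M Ze (pp M i \<Gamma> A) (downstar M i (extC M i \<Gamma> A) (qq M i \<Gamma> A))"

text \<open>An erased term x : Tm_0 Gamma A viewed at mode i in Gamma |> #.\<close>
definition liftT :: "('c,'s,'t,'m,'z) tt0_scheme \<Rightarrow> mode \<Rightarrow> 'c \<Rightarrow> 'm \<Rightarrow> 'm" where
  "liftT M i \<Gamma> x = (case i of Om \<Rightarrow> upc M x | Ze \<Rightarrow> msub M x (pM M \<Gamma>))"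

text \<open>(p_# o p_i, q_i) : Sub ((Gamma |> #) |>_i A[p_#]) (Gamma |>_i A).\<close>
definition s3 :: "('c,'s,'t,'m,'z) tt0_scheme \<Rightarrow> mode \<Rightarrow> 'c \<Rightarrow> 't \<Rightarrow> 's" where
  "s3 M i \<Gamma> A = spair M i (scomp M (pM M \<Gamma>) (pp M i (extM M \<Gamma>) (tsub M A (pM M \<Gamma>))))
                            (qq M i (extM M \<Gamma>) (tsub M A (pM M \<Gamma>)))"

text \<open>Swap : Sub ((Gamma |> #) |>_i A[p_#]) ((Gamma |>_i A) |> #).\<close>
definition swapS :: "('c,'s,'t,'m,'z) tt0_scheme \<Rightarrow> mode \<Rightarrow> 'c \<Rightarrow> 't \<Rightarrow> 's" where
  "swapS M i \<Gamma> A = spairM M (s3 M i \<Gamma> A)"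

text \<open>Erased lambda: Tm_0 (Gamma |>_i A) B -> Tm_0 Gamma (Pi_i A B).\<close>
definition lam0 :: "('c,'s,'t,'m,'z) tt0_scheme \<Rightarrow> mode \<Rightarrow> 'c \<Rightarrow> 't \<Rightarrow> 't \<Rightarrow> 'm \<Rightarrow> 'm" where
  "lam0 M i \<Gamma> A B t =
     dn M (lam M i (extM M \<Gamma>) (tsub M A (pM M \<Gamma>))
               (tsub M (tsub M B (pM M (extC M i \<Gamma> A))) (swapS M i \<Gamma> A))
               (msub M (upc M t) (swapS M i \<Gamma> A)))"

text \<open>Erased pairing: x : Tm_0 Gamma A, b : Tm_0 Gamma B[id,x] -> Tm_0 Gamma (Sigma_i A B).\<close>
definition pair0 :: "('c,'s,'t,'m,'z) tt0_scheme \<Rightarrow> mode \<Rightarrow> 'c \<Rightarrow> 't \<Rightarrow> 't \<Rightarrow> 'm \<Rightarrow> 'm \<Rightarrow> 'm" where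
  "pair0 M i \<Gamma> A B x b =
     dn M (tpair M i (extM M \<Gamma>) (tsub M A (pM M \<Gamma>)) (tsub M B (s3 M i \<Gamma> A))
                (liftT M i \<Gamma> x) (upc M b))"

text \<open>The zeroed model 0(M): same contexts, substitutions and types; both term
 sorts are Tm_0; # is the unit (always inhabited); Gamma |>_i A is Gamma |>_0 A;
 Gamma |> # is Gamma; coercions are identities; Pi_i A B and Sigma_i A B (with B
 over Gamma |>_0 A) are Pi_i A B[p_i, down_star q_i] etc.; runtime term formers are
 interpreted by their erased counterparts (app and proj as the inverses of the
 erased lam and pair).\<close>
definition zero_model :: "('c,'s,'t,'m) tt0 \<Rightarrow> ('c,'s,'t,'m) tt0" where
  "zero_model M = M\<lparr>
     TM := (\<lambda>i. TM M Ze),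
     MK := (\<lambda>_. True),
     extC := (\<lambda>i. extC M Ze),
     pp := (\<lambda>i. pp M Ze),
     qq := (\<lambda>i. qq M Ze),
     spair := (\<lambda>i. spair M Ze),
     extM := (\<lambda>\<Gamma>. \<Gamma>),
     pM := sid M,
     spairM := (\<lambda>\<sigma>. \<sigma>),
     dn := (\<lambda>a. a),
     upc := (\<lambda>a. a),
     PI := (\<lambda>i \<Gamma> A B. PI M i \<Gamma> A (tsub M B (wS M i \<Gamma> A))),
     SG := (\<lambda>i \<Gamma> A B. SG M i \<Gamma> A (tsub M B (wS M i \<Gamma> A))),
     lam := (\<lambda>i \<Gamma> A B t. lam0 M i \<Gamma> A (tsub M B (wS M i \<Gamma> A)) (msub M t (wS M i \<Gamma> A))),
     app := (\<lambda>i \<Gamma> A B t. THE u. u \<in> TM M Ze (extC M Ze \<Gamma> A) B \<and>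
                 lam0 M i \<Gamma> A (tsub M B (wS M i \<Gamma> A)) (msub M u (wS M i \<Gamma> A)) = t),
     tpair := (\<lambda>i \<Gamma> A B x b. pair0 M i \<Gamma> A (tsub M B (wS M i \<Gamma> A)) x b),
     proj := (\<lambda>i \<Gamma> A B t. THE xb. fst xb \<in> TM M Ze \<Gamma> A \<and>
                 snd xb \<in> TM M Ze \<Gamma> (tsub M B (spair M Ze (sid M \<Gamma>) (fst xb))) \<and>
                 pair0 M i \<Gamma> A (tsub M B (wS M i \<Gamma> A)) (fst xb) (snd xb) = t)
   \<rparr>"

end

(*
  The substitution up G : Sub G (0 G) is built by recursion on contexts, sending a variable to its
  erased version.  That (0 A)[up G] = A and (0 a)[up G] = downstar a hold throughout the syntax is
  shown by checking that the contexts, substitutions, types and terms with these properties form a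
  submodel; by initiality a submodel is everything.  The closure under app and proj follows from the
  injectivity of the erased lam and pair.  Everything that concerns erased terms rests on one
  observation: Tm_0 G A is Tm_omega (G |> #) A, so a substitution that becomes invertible over # acts
  bijectively on erased terms; this applies to (p_i, down_star q_i), and makes the zeroed model a model.

  Recursion on contexts needs unique decomposition of contexts.  Initiality is relative to models
  over the same carrier types, so the data cannot be coded into larger carriers.  Instead, replacing
  the contexts of M by a set of labels with a decoding map gives a model again, with arbitrary
  labels for newly formed contexts; one spare label suffices to tell apart two decompositions.
  A spare label exists (after an injective renaming) if the type of contexts is infinite, and a
  finite type of contexts admits an initial model only if it has one element, in which case all
  hom-sets are singletons.
*)

theory Submission
  imports Defs
begin

section \<open>Judgements and algebras\<close>

text \<open>A direct use of initiality would glue each context with a substitution out of it, but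
  such pairs do not fit into the carrier type of contexts. So \<open>up\<close> is fixed first, as a
  function of bare contexts, and its properties are verified afterwards. Its defining equations can
  then mention only the raw formations; that their right-hand sides are well typed is part of what
  has to be shown, simultaneously with the equations for types. The modes are the other obstacle.
  Zeroing identifies Tm_0 and Tm_\<omega>, while \<Pi>_i and \<Sigma>_i keep their mode: in the
  zeroed model a codomain over \<Gamma> |>_0 A has to be moved to \<Gamma> |>_i A, and the inverse
  operations app and proj have to move terms back. Likewise an erased first component of a pair
  cannot be substituted for a runtime variable of the codomain. Both difficulties disappear over
  \<Gamma> |> #, where an erased term can be viewed at either mode; this is why so many equations
  below are compared after weakening by p_#.\<close>

definition sub :: "('c,'s,'t,'m,'z) tt0_scheme \<Rightarrow> 'c \<Rightarrow> 'c \<Rightarrow> 's \<Rightarrow> bool" where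
  "sub M \<Gamma> \<Delta> \<sigma> \<longleftrightarrow> \<Gamma> \<in> CON M \<and> \<Delta> \<in> CON M \<and> \<sigma> \<in> SUB M \<Gamma> \<Delta>"

definition ty :: "('c,'s,'t,'m,'z) tt0_scheme \<Rightarrow> nat \<Rightarrow> 'c \<Rightarrow> 't \<Rightarrow> bool" where
  "ty M l \<Gamma> A \<longleftrightarrow> \<Gamma> \<in> CON M \<and> A \<in> TY M l \<Gamma>"

definition tm :: "('c,'s,'t,'m,'z) tt0_scheme \<Rightarrow> mode \<Rightarrow> nat \<Rightarrow> 'c \<Rightarrow> 't \<Rightarrow> 'm \<Rightarrow> bool" where
  "tm M i l \<Gamma> A a \<longleftrightarrow> \<Gamma> \<in> CON M \<and> A \<in> TY M l \<Gamma> \<and> a \<in> TM M i \<Gamma> A"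

lemmas judgement_defs = sub_def ty_def tm_def

notation scomp (infixl "\<cdot>\<index>" 75)
notation tsub (infixl "\<lhd>\<index>" 70)
notation msub (infixl "\<unlhd>\<index>" 70)

text \<open>Premises are judgements, which carry the existence of their contexts and types, so that
  derivations compose like typing rules. As in \<open>is_model\<close>, naturality is assumed for
  one direction of each isomorphism; the other direction is derived where it is used, as in
  \<open>code_sub\<close> and \<open>upc_sub\<close>.\<close>

locale tt0_model =
  fixes M :: "('c,'s,'t,'m) tt0" (structure)
  assumes sid_sub: "\<Gamma> \<in> CON M \<Longrightarrow> sub M \<Gamma> \<Gamma> (sid M \<Gamma>)"
    and comp_sub: "sub M \<Delta> \<Theta> \<sigma> \<Longrightarrow> sub M \<Gamma> \<Delta> \<delta> \<Longrightarrow> sub M \<Gamma> \<Theta> (\<sigma> \<cdot> \<delta>)"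
    and sid_comp: "sub M \<Gamma> \<Delta> \<sigma> \<Longrightarrow> sid M \<Delta> \<cdot> \<sigma> = \<sigma>"
    and comp_sid: "sub M \<Gamma> \<Delta> \<sigma> \<Longrightarrow> \<sigma> \<cdot> sid M \<Gamma> = \<sigma>"
    and comp_assoc: "sub M \<Theta> \<Xi> \<sigma> \<Longrightarrow> sub M \<Delta> \<Theta> \<delta> \<Longrightarrow> sub M \<Gamma> \<Delta> \<nu> \<Longrightarrow> \<sigma> \<cdot> \<delta> \<cdot> \<nu> = \<sigma> \<cdot> (\<delta> \<cdot> \<nu>)"
    and emp_con: "emp M \<in> CON M"
    and eps_sub: "\<Gamma> \<in> CON M \<Longrightarrow> sub M \<Gamma> (emp M) (epsS M \<Gamma>)"
    and eps_unique: "sub M \<Gamma> (emp M) \<sigma> \<Longrightarrow> \<sigma> = epsS M \<Gamma>"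
    and ty_sub: "sub M \<Gamma> \<Delta> \<sigma> \<Longrightarrow> ty M l \<Delta> A \<Longrightarrow> ty M l \<Gamma> (A \<lhd> \<sigma>)"
    and ty_sid: "ty M l \<Gamma> A \<Longrightarrow> A \<lhd> sid M \<Gamma> = A"
    and ty_comp: "sub M \<Delta> \<Theta> \<sigma> \<Longrightarrow> sub M \<Gamma> \<Delta> \<delta> \<Longrightarrow> ty M l \<Theta> A \<Longrightarrow> A \<lhd> (\<sigma> \<cdot> \<delta>) = A \<lhd> \<sigma> \<lhd> \<delta>"
    and tm_sub: "sub M \<Gamma> \<Delta> \<sigma> \<Longrightarrow> tm M i l \<Delta> A a \<Longrightarrow> tm M i l \<Gamma> (A \<lhd> \<sigma>) (a \<unlhd> \<sigma>)"
    and tm_sid: "tm M i l \<Gamma> A a \<Longrightarrow> a \<unlhd> sid M \<Gamma> = a"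
    and tm_comp: "sub M \<Delta> \<Theta> \<sigma> \<Longrightarrow> sub M \<Gamma> \<Delta> \<delta> \<Longrightarrow> tm M i l \<Theta> A a \<Longrightarrow> a \<unlhd> (\<sigma> \<cdot> \<delta>) = a \<unlhd> \<sigma> \<unlhd> \<delta>"
    and mk_sub: "sub M \<Gamma> \<Delta> \<sigma> \<Longrightarrow> MK M \<Delta> \<Longrightarrow> MK M \<Gamma>"
    and pp_sub: "ty M l \<Gamma> A \<Longrightarrow> sub M (extC M i \<Gamma> A) \<Gamma> (pp M i \<Gamma> A)"
    and qq_tm: "ty M l \<Gamma> A \<Longrightarrow> tm M i l (extC M i \<Gamma> A) (A \<lhd> pp M i \<Gamma> A) (qq M i \<Gamma> A)"
    and spair_sub: "ty M l \<Delta> A \<Longrightarrow> sub M \<Gamma> \<Delta> \<sigma> \<Longrightarrow> tm M i l \<Gamma> (A \<lhd> \<sigma>) t \<Longrightarrow> sub M \<Gamma> (extC M i \<Delta> A) (spair M i \<sigma> t)"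
    and pp_spair: "ty M l \<Delta> A \<Longrightarrow> sub M \<Gamma> \<Delta> \<sigma> \<Longrightarrow> tm M i l \<Gamma> (A \<lhd> \<sigma>) t \<Longrightarrow> pp M i \<Delta> A \<cdot> spair M i \<sigma> t = \<sigma>"
    and qq_spair: "ty M l \<Delta> A \<Longrightarrow> sub M \<Gamma> \<Delta> \<sigma> \<Longrightarrow> tm M i l \<Gamma> (A \<lhd> \<sigma>) t \<Longrightarrow> qq M i \<Delta> A \<unlhd> spair M i \<sigma> t = t"
    and spair_eta: "ty M l \<Delta> A \<Longrightarrow> sub M \<Gamma> (extC M i \<Delta> A) \<tau> \<Longrightarrow> spair M i (pp M i \<Delta> A \<cdot> \<tau>) (qq M i \<Delta> A \<unlhd> \<tau>) = \<tau>"
    and pM_sub: "\<Gamma> \<in> CON M \<Longrightarrow> sub M (extM M \<Gamma>) \<Gamma> (pM M \<Gamma>)"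
    and extM_mk: "\<Gamma> \<in> CON M \<Longrightarrow> MK M (extM M \<Gamma>)"
    and spairM_sub: "sub M \<Gamma> \<Delta> \<sigma> \<Longrightarrow> MK M \<Gamma> \<Longrightarrow> sub M \<Gamma> (extM M \<Delta>) (spairM M \<sigma>)"
    and pM_spairM: "sub M \<Gamma> \<Delta> \<sigma> \<Longrightarrow> MK M \<Gamma> \<Longrightarrow> pM M \<Delta> \<cdot> spairM M \<sigma> = \<sigma>"
    and spairM_eta: "\<Delta> \<in> CON M \<Longrightarrow> sub M \<Gamma> (extM M \<Delta>) \<tau> \<Longrightarrow> spairM M (pM M \<Delta> \<cdot> \<tau>) = \<tau>"
    and dn_tm: "ty M l \<Gamma> A \<Longrightarrow> tm M Om l (extM M \<Gamma>) (A \<lhd> pM M \<Gamma>) a \<Longrightarrow> tm M Ze l \<Gamma> A (dn M a)"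
    and upc_dn: "ty M l \<Gamma> A \<Longrightarrow> tm M Om l (extM M \<Gamma>) (A \<lhd> pM M \<Gamma>) a \<Longrightarrow> upc M (dn M a) = a"
    and upc_tm: "tm M Ze l \<Gamma> A a \<Longrightarrow> tm M Om l (extM M \<Gamma>) (A \<lhd> pM M \<Gamma>) (upc M a)"
    and dn_upc: "tm M Ze l \<Gamma> A a \<Longrightarrow> dn M (upc M a) = a"
    and dn_sub: "sub M \<Gamma> \<Delta> \<sigma> \<Longrightarrow> ty M l \<Delta> A \<Longrightarrow> tm M Om l (extM M \<Delta>) (A \<lhd> pM M \<Delta>) a \<Longrightarrow>
      dn M a \<unlhd> \<sigma> = dn M (a \<unlhd> spairM M (\<sigma> \<cdot> pM M \<Gamma>))"
    and PI_ty: "ty M l \<Gamma> A \<Longrightarrow> ty M l (extC M i \<Gamma> A) B \<Longrightarrow> ty M l \<Gamma> (PI M i \<Gamma> A B)"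
    and SG_ty: "ty M l \<Gamma> A \<Longrightarrow> ty M l (extC M i \<Gamma> A) B \<Longrightarrow> ty M l \<Gamma> (SG M i \<Gamma> A B)"
    and lam_tm: "ty M l \<Gamma> A \<Longrightarrow> tm M Om l (extC M i \<Gamma> A) B t \<Longrightarrow> tm M Om l \<Gamma> (PI M i \<Gamma> A B) (lam M i \<Gamma> A B t)"
    and app_lam: "ty M l \<Gamma> A \<Longrightarrow> tm M Om l (extC M i \<Gamma> A) B t \<Longrightarrow> app M i \<Gamma> A B (lam M i \<Gamma> A B t) = t"
    and app_tm: "ty M l \<Gamma> A \<Longrightarrow> ty M l (extC M i \<Gamma> A) B \<Longrightarrow> tm M Om l \<Gamma> (PI M i \<Gamma> A B) t \<Longrightarrow>
      tm M Om l (extC M i \<Gamma> A) B (app M i \<Gamma> A B t)"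
    and lam_app: "ty M l \<Gamma> A \<Longrightarrow> ty M l (extC M i \<Gamma> A) B \<Longrightarrow> tm M Om l \<Gamma> (PI M i \<Gamma> A B) t \<Longrightarrow>
      lam M i \<Gamma> A B (app M i \<Gamma> A B t) = t"
    and tpair_tm: "ty M l (extC M i \<Gamma> A) B \<Longrightarrow> tm M i l \<Gamma> A x \<Longrightarrow>
      tm M Om l \<Gamma> (B \<lhd> spair M i (sid M \<Gamma>) x) b \<Longrightarrow> tm M Om l \<Gamma> (SG M i \<Gamma> A B) (tpair M i \<Gamma> A B x b)"
    and proj_tpair: "ty M l (extC M i \<Gamma> A) B \<Longrightarrow> tm M i l \<Gamma> A x \<Longrightarrow>
      tm M Om l \<Gamma> (B \<lhd> spair M i (sid M \<Gamma>) x) b \<Longrightarrow> proj M i \<Gamma> A B (tpair M i \<Gamma> A B x b) = (x, b)"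
    and fst_proj_tm: "ty M l \<Gamma> A \<Longrightarrow> ty M l (extC M i \<Gamma> A) B \<Longrightarrow> tm M Om l \<Gamma> (SG M i \<Gamma> A B) t \<Longrightarrow>
      tm M i l \<Gamma> A (fst (proj M i \<Gamma> A B t))"
    and tpair_proj: "ty M l \<Gamma> A \<Longrightarrow> ty M l (extC M i \<Gamma> A) B \<Longrightarrow> tm M Om l \<Gamma> (SG M i \<Gamma> A B) t \<Longrightarrow>
      tpair M i \<Gamma> A B (fst (proj M i \<Gamma> A B t)) (snd (proj M i \<Gamma> A B t)) = t"
    and PI_sub: "sub M \<Gamma> \<Delta> \<sigma> \<Longrightarrow> ty M l \<Delta> A \<Longrightarrow> ty M l (extC M i \<Delta> A) B \<Longrightarrow>
      PI M i \<Delta> A B \<lhd> \<sigma> = PI M i \<Gamma> (A \<lhd> \<sigma>) (B \<lhd> liftS M i \<Gamma> A \<sigma>)"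
    and SG_sub: "sub M \<Gamma> \<Delta> \<sigma> \<Longrightarrow> ty M l \<Delta> A \<Longrightarrow> ty M l (extC M i \<Delta> A) B \<Longrightarrow>
      SG M i \<Delta> A B \<lhd> \<sigma> = SG M i \<Gamma> (A \<lhd> \<sigma>) (B \<lhd> liftS M i \<Gamma> A \<sigma>)"
    and lam_sub: "sub M \<Gamma> \<Delta> \<sigma> \<Longrightarrow> ty M l \<Delta> A \<Longrightarrow> tm M Om l (extC M i \<Delta> A) B t \<Longrightarrow>
      lam M i \<Delta> A B t \<unlhd> \<sigma> =
      lam M i \<Gamma> (A \<lhd> \<sigma>) (B \<lhd> liftS M i \<Gamma> A \<sigma>) (t \<unlhd> liftS M i \<Gamma> A \<sigma>)"
    and tpair_sub: "sub M \<Gamma> \<Delta> \<sigma> \<Longrightarrow> ty M l (extC M i \<Delta> A) B \<Longrightarrow> tm M i l \<Delta> A x \<Longrightarrow>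
      tm M Om l \<Delta> (B \<lhd> spair M i (sid M \<Delta>) x) b \<Longrightarrow>
      tpair M i \<Delta> A B x b \<unlhd> \<sigma> =
      tpair M i \<Gamma> (A \<lhd> \<sigma>) (B \<lhd> liftS M i \<Gamma> A \<sigma>) (x \<unlhd> \<sigma>) (b \<unlhd> \<sigma>)"
    and UU_ty: "\<Gamma> \<in> CON M \<Longrightarrow> ty M (Suc l) \<Gamma> (UU M l \<Gamma>)"
    and EL_ty: "tm M Ze (Suc l) \<Gamma> (UU M l \<Gamma>) a \<Longrightarrow> ty M l \<Gamma> (EL M a)"
    and code_EL: "tm M Ze (Suc l) \<Gamma> (UU M l \<Gamma>) a \<Longrightarrow> codeU M (EL M a) = a"
    and code_tm: "ty M l \<Gamma> A \<Longrightarrow> tm M Ze (Suc l) \<Gamma> (UU M l \<Gamma>) (codeU M A)"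
    and EL_code: "ty M l \<Gamma> A \<Longrightarrow> EL M (codeU M A) = A"
    and UU_sub: "sub M \<Gamma> \<Delta> \<sigma> \<Longrightarrow> UU M l \<Delta> \<lhd> \<sigma> = UU M l \<Gamma>"
    and EL_sub: "sub M \<Gamma> \<Delta> \<sigma> \<Longrightarrow> tm M Ze (Suc l) \<Delta> (UU M l \<Delta>) a \<Longrightarrow> EL M a \<lhd> \<sigma> = EL M (a \<unlhd> \<sigma>)"
    and snd_proj_tm: "ty M l \<Gamma> A \<Longrightarrow> ty M l (extC M i \<Gamma> A) B \<Longrightarrow> tm M Om l \<Gamma> (SG M i \<Gamma> A B) t \<Longrightarrow>
      tm M Om l \<Gamma> (B \<lhd> spair M i (sid M \<Gamma>) (fst (proj M i \<Gamma> A B t))) (snd (proj M i \<Gamma> A B t))"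

begin

section \<open>Derived laws of the substitution calculus\<close>

abbreviation "con \<Gamma> \<equiv> \<Gamma> \<in> CON M"

lemma sub_con: "sub M \<Gamma> \<Delta> \<sigma> \<Longrightarrow> con \<Gamma>" "sub M \<Gamma> \<Delta> \<sigma> \<Longrightarrow> con \<Delta>"
  and ty_con: "ty M l \<Gamma> A \<Longrightarrow> con \<Gamma>"
  and tm_ty: "tm M i l \<Gamma> A a \<Longrightarrow> ty M l \<Gamma> A"
  by (auto simp: judgement_defs)

lemma tm_con: "tm M i l \<Gamma> A a \<Longrightarrow> con \<Gamma>"
  by (auto simp: judgement_defs)

lemma ext_con: "ty M l \<Gamma> A \<Longrightarrow> con (extC M i \<Gamma> A)"
  using pp_sub sub_con(1) by blast

lemma extM_con: "con \<Gamma> \<Longrightarrow> con (extM M \<Gamma>)"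
  using pM_sub sub_con(1) by blast

text \<open>\<open>EL\<close> sends both sides to \<open>A \<lhd> \<sigma>\<close>, and
  \<open>codeU\<close> undoes \<open>EL\<close>.\<close>

lemma code_sub:
  assumes "sub M \<Gamma> \<Delta> \<sigma>" "ty M l \<Delta> A"
  shows "codeU M A \<unlhd> \<sigma> = codeU M (A \<lhd> \<sigma>)"
proof -
  have t: "tm M Ze (Suc l) \<Gamma> (UU M l \<Gamma>) (codeU M A \<unlhd> \<sigma>)"
    using tm_sub[OF assms(1) code_tm[OF assms(2)]] UU_sub[OF assms(1)] by simp
  have "EL M (codeU M A \<unlhd> \<sigma>) = A \<lhd> \<sigma>"
    using EL_sub[OF assms(1) code_tm[OF assms(2)]] EL_code[OF assms(2)] by simp
  then show ?thesis using code_EL[OF t] by simp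
qed

text \<open>By \<open>spair_eta\<close> a substitution into an extended context is determined by its
  two components, and these agree.\<close>

lemma spair_comp:
  assumes "ty M l \<Delta> A" "sub M \<Gamma> \<Delta> \<sigma>" "tm M i l \<Gamma> (A \<lhd> \<sigma>) t" "sub M \<Xi> \<Gamma> \<delta>"
  shows "spair M i \<sigma> t \<cdot> \<delta> = spair M i (\<sigma> \<cdot> \<delta>) (t \<unlhd> \<delta>)"
proof -
  note s = spair_sub[OF assms(1-3)]
  have "spair M i (pp M i \<Delta> A \<cdot> (spair M i \<sigma> t \<cdot> \<delta>)) (qq M i \<Delta> A \<unlhd> (spair M i \<sigma> t \<cdot> \<delta>)) = spair M i \<sigma> t \<cdot> \<delta>"
    by (rule spair_eta[OF assms(1) comp_sub[OF s assms(4)]])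
  moreover have "pp M i \<Delta> A \<cdot> (spair M i \<sigma> t \<cdot> \<delta>) = \<sigma> \<cdot> \<delta>"
    using comp_assoc[OF pp_sub[OF assms(1)] s assms(4)] pp_spair[OF assms(1-3)] by simp
  moreover have "qq M i \<Delta> A \<unlhd> (spair M i \<sigma> t \<cdot> \<delta>) = t \<unlhd> \<delta>"
    using tm_comp[OF s assms(4) qq_tm[OF assms(1)]] qq_spair[OF assms(1-3)] by simp
  ultimately show ?thesis by simp
qed

lemma spairM_comp:
  assumes "sub M \<Gamma> \<Delta> \<sigma>" "MK M \<Gamma>" "sub M \<Xi> \<Gamma> \<delta>"
  shows "spairM M \<sigma> \<cdot> \<delta> = spairM M (\<sigma> \<cdot> \<delta>)"
proof -
  note s = spairM_sub[OF assms(1,2)]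
  have D: "con \<Delta>" using assms(1) sub_con by blast
  have "pM M \<Delta> \<cdot> (spairM M \<sigma> \<cdot> \<delta>) = \<sigma> \<cdot> \<delta>"
    using comp_assoc[OF pM_sub[OF D] s assms(3)] pM_spairM[OF assms(1,2)] by simp
  then show ?thesis using spairM_eta[OF D comp_sub[OF s assms(3)]] by simp
qed

text \<open>p_# is monic because the marker is proposition valued: a substitution into \<Delta> |> #
  carries no data beyond its first component.\<close>

lemma extM_sub_eqI:
  assumes "con \<Delta>" "sub M \<Gamma> (extM M \<Delta>) \<sigma>" "sub M \<Gamma> (extM M \<Delta>) \<tau>" "pM M \<Delta> \<cdot> \<sigma> = pM M \<Delta> \<cdot> \<tau>"
  shows "\<sigma> = \<tau>"
  using spairM_eta[OF assms(1,2)] spairM_eta[OF assms(1,3)] assms(4) by metis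

lemma spairM_pM:
  assumes "con \<Gamma>"
  shows "spairM M (pM M \<Gamma>) = sid M (extM M \<Gamma>)"
  using spairM_eta[OF assms sid_sub[OF extM_con[OF assms]]] comp_sid[OF pM_sub[OF assms]] by simp

lemma spair_pp_qq:
  assumes "ty M l \<Gamma> A"
  shows "spair M i (pp M i \<Gamma> A) (qq M i \<Gamma> A) = sid M (extC M i \<Gamma> A)"
  using spair_eta[OF assms sid_sub[OF ext_con[OF assms]]] comp_sid[OF pp_sub[OF assms]]
    tm_sid[OF qq_tm[OF assms]] by simp

lemma
  assumes "sub M \<Gamma> \<Delta> \<sigma>" "ty M l \<Delta> A"
  shows lift_sub: "sub M (extC M i \<Gamma> (A \<lhd> \<sigma>)) (extC M i \<Delta> A) (liftS M i \<Gamma> A \<sigma>)"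
    and pp_lift: "pp M i \<Delta> A \<cdot> liftS M i \<Gamma> A \<sigma> = \<sigma> \<cdot> pp M i \<Gamma> (A \<lhd> \<sigma>)"
    and qq_lift: "qq M i \<Delta> A \<unlhd> liftS M i \<Gamma> A \<sigma> = qq M i \<Gamma> (A \<lhd> \<sigma>)"
proof -
  note t = ty_sub[OF assms]
  note s = comp_sub[OF assms(1) pp_sub[OF t]]
  have q: "tm M i l (extC M i \<Gamma> (A \<lhd> \<sigma>)) (A \<lhd> (\<sigma> \<cdot> pp M i \<Gamma> (A \<lhd> \<sigma>))) (qq M i \<Gamma> (A \<lhd> \<sigma>))"
    using qq_tm[OF t] ty_comp[OF assms(1) pp_sub[OF t] assms(2)] by simp
  show "sub M (extC M i \<Gamma> (A \<lhd> \<sigma>)) (extC M i \<Delta> A) (liftS M i \<Gamma> A \<sigma>)"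
    "pp M i \<Delta> A \<cdot> liftS M i \<Gamma> A \<sigma> = \<sigma> \<cdot> pp M i \<Gamma> (A \<lhd> \<sigma>)"
    "qq M i \<Delta> A \<unlhd> liftS M i \<Gamma> A \<sigma> = qq M i \<Gamma> (A \<lhd> \<sigma>)"
    unfolding liftS_def
    by (rule spair_sub[OF assms(2) s q] pp_spair[OF assms(2) s q] qq_spair[OF assms(2) s q])+
qed

lemma sid_spair_sub:
  assumes "tm M i l \<Gamma> A x"
  shows "sub M \<Gamma> (extC M i \<Gamma> A) (spair M i (sid M \<Gamma>) x)"
  using spair_sub[OF tm_ty[OF assms] sid_sub[OF tm_con[OF assms]]] ty_sid[OF tm_ty[OF assms]] assms by simp

lemma lift_spair:
  assumes "sub M \<Gamma> \<Delta> \<sigma>" "ty M l \<Delta> A" "sub M \<Xi> \<Gamma> \<delta>" "tm M i l \<Xi> (A \<lhd> \<sigma> \<lhd> \<delta>) t"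
  shows "liftS M i \<Gamma> A \<sigma> \<cdot> spair M i \<delta> t = spair M i (\<sigma> \<cdot> \<delta>) t"
proof -
  note t = ty_sub[OF assms(1,2)]
  note s = comp_sub[OF assms(1) pp_sub[OF t]]
  have q: "tm M i l (extC M i \<Gamma> (A \<lhd> \<sigma>)) (A \<lhd> (\<sigma> \<cdot> pp M i \<Gamma> (A \<lhd> \<sigma>))) (qq M i \<Gamma> (A \<lhd> \<sigma>))"
    using qq_tm[OF t] ty_comp[OF assms(1) pp_sub[OF t] assms(2)] by simp
  note p = spair_sub[OF t assms(3,4)]
  show ?thesis unfolding liftS_def spair_comp[OF assms(2) s q p]
    using qq_spair[OF t assms(3,4)] pp_spair[OF t assms(3,4)]
      comp_assoc[OF assms(1) pp_sub[OF t] p] by simp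
qed

end

section \<open>Equivalence of the rule presentation with the set-based one\<close>

lemma is_model_Sigma:
  assumes "is_model M" "ty M l \<Gamma> A" "ty M l (extC M i \<Gamma> A) B"
  shows "(\<forall>x\<in>TM M i \<Gamma> A. \<forall>b\<in>TM M Om \<Gamma> (tsub M B (spair M i (sid M \<Gamma>) x)).
         tpair M i \<Gamma> A B x b \<in> TM M Om \<Gamma> (SG M i \<Gamma> A B) \<and> proj M i \<Gamma> A B (tpair M i \<Gamma> A B x b) = (x, b)) \<and>
      (\<forall>t\<in>TM M Om \<Gamma> (SG M i \<Gamma> A B).
         fst (proj M i \<Gamma> A B t) \<in> TM M i \<Gamma> A \<and>
         snd (proj M i \<Gamma> A B t) \<in> TM M Om \<Gamma> (tsub M B (spair M i (sid M \<Gamma>) (fst (proj M i \<Gamma> A B t)))) \<and>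
         tpair M i \<Gamma> A B (fst (proj M i \<Gamma> A B t)) (snd (proj M i \<Gamma> A B t)) = t)"
proof -
  have "\<Gamma> \<in> CON M" "A \<in> TY M l \<Gamma>" "B \<in> TY M l (extC M i \<Gamma> A)"
    using assms by (auto simp: judgement_defs)
  from assms(1)[unfolded is_model_def, THEN conjunct2, THEN conjunct2, THEN conjunct2, THEN conjunct2, THEN conjunct2, THEN conjunct2, THEN conjunct2, THEN conjunct2, THEN conjunct2, THEN conjunct2, THEN conjunct2, THEN conjunct2, THEN conjunct2, THEN conjunct2, THEN conjunct2, THEN conjunct2, THEN conjunct2, THEN conjunct2, THEN conjunct2, THEN conjunct2, THEN conjunct2,
    THEN conjunct1, THEN spec, THEN spec, THEN bspec, THEN bspec, THEN bspec, OF this,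
    THEN conjunct2, THEN conjunct2, THEN conjunct2, THEN conjunct2]
  show ?thesis .
qed

lemma is_model_imp_tt0_model:
  assumes m: "is_model M"
  shows "tt0_model M"
proof -
  \<comment> \<open>The clauses of \<open>is_model\<close> conclude bare memberships. A judgement
    also asserts that the context and the type exist; these facts supply that part for the rules
    where it is not among the premises.\<close>
  have raw: "\<Gamma> \<in> CON M \<Longrightarrow> UU M l \<Gamma> \<in> TY M (Suc l) \<Gamma>"
    "ty M l \<Gamma> A \<Longrightarrow> codeU M A \<in> TM M Ze \<Gamma> (UU M l \<Gamma>)"
    "\<Gamma> \<in> CON M \<Longrightarrow> extM M \<Gamma> \<in> CON M \<and> pM M \<Gamma> \<in> SUB M (extM M \<Gamma>) \<Gamma>"
    "tm M Ze l \<Gamma> A a \<Longrightarrow> upc M a \<in> TM M Om (extM M \<Gamma>) (tsub M A (pM M \<Gamma>))"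
    "sub M \<Gamma> \<Delta> \<sigma> \<Longrightarrow> ty M l \<Delta> A \<Longrightarrow> tsub M A \<sigma> \<in> TY M l \<Gamma>"
    "ty M l \<Gamma> A \<Longrightarrow> ty M l (extC M i \<Gamma> A) B \<Longrightarrow> SG M i \<Gamma> A B \<in> TY M l \<Gamma>"
    "tm M i l \<Gamma> A x \<Longrightarrow> spair M i (sid M \<Gamma>) x \<in> SUB M \<Gamma> (extC M i \<Gamma> A)" for \<Gamma> \<Delta> l A a \<sigma> i B x
    subgoal using m unfolding is_model_def judgement_defs by meson
    subgoal using m unfolding is_model_def judgement_defs by meson
    subgoal using m unfolding is_model_def judgement_defs by meson
    subgoal using m unfolding is_model_def judgement_defs by meson
    subgoal using m unfolding is_model_def judgement_defs by meson
    subgoal using m unfolding is_model_def judgement_defs by meson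
    subgoal using m unfolding is_model_def judgement_defs by metis
    done
  have upc: "tm M Ze l \<Gamma> A a \<Longrightarrow> tm M Om l (extM M \<Gamma>) (tsub M A (pM M \<Gamma>)) (upc M a)"
    and code: "ty M l \<Gamma> A \<Longrightarrow> tm M Ze (Suc l) \<Gamma> (UU M l \<Gamma>) (codeU M A)" for \<Gamma> l A a
    using raw(4)[of l \<Gamma> A a] raw(3)[of \<Gamma>] raw(5)[of "extM M \<Gamma>" \<Gamma> "pM M \<Gamma>" l A] raw(1)[of \<Gamma> l] raw(2)[of l \<Gamma> A]
    by (simp_all add: judgement_defs)
  have tpair: "tm M Om l \<Gamma> (SG M i \<Gamma> A B) (tpair M i \<Gamma> A B x b) \<and> proj M i \<Gamma> A B (tpair M i \<Gamma> A B x b) = (x, b)"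
    if "ty M l (extC M i \<Gamma> A) B" "tm M i l \<Gamma> A x" "tm M Om l \<Gamma> (tsub M B (spair M i (sid M \<Gamma>) x)) b" for l i \<Gamma> A B x b
  proof -
    have A: "ty M l \<Gamma> A" using that(2) by (simp add: judgement_defs)
    have x: "x \<in> TM M i \<Gamma> A" and b: "b \<in> TM M Om \<Gamma> (tsub M B (spair M i (sid M \<Gamma>) x))"
      using that by (simp_all add: tm_def)
    from is_model_Sigma[OF m A that(1), THEN conjunct1, THEN bspec, OF x, THEN bspec, OF b] raw(6)[OF A that(1)] A
    show ?thesis by (simp add: judgement_defs)
  qed
  have proj: "tm M i l \<Gamma> A (fst (proj M i \<Gamma> A B t)) \<and>
      tm M Om l \<Gamma> (tsub M B (spair M i (sid M \<Gamma>) (fst (proj M i \<Gamma> A B t)))) (snd (proj M i \<Gamma> A B t)) \<and>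
      tpair M i \<Gamma> A B (fst (proj M i \<Gamma> A B t)) (snd (proj M i \<Gamma> A B t)) = t"
    if "ty M l \<Gamma> A" "ty M l (extC M i \<Gamma> A) B" "tm M Om l \<Gamma> (SG M i \<Gamma> A B) t" for l i \<Gamma> A B t
  proof -
    have S: "fst (proj M i \<Gamma> A B t) \<in> TM M i \<Gamma> A"
      "snd (proj M i \<Gamma> A B t) \<in> TM M Om \<Gamma> (tsub M B (spair M i (sid M \<Gamma>) (fst (proj M i \<Gamma> A B t))))"
      "tpair M i \<Gamma> A B (fst (proj M i \<Gamma> A B t)) (snd (proj M i \<Gamma> A B t)) = t"
      using is_model_Sigma[OF m that(1,2), THEN conjunct2, THEN bspec, of t] that(3) by (simp_all add: tm_def)
    have x: "tm M i l \<Gamma> A (fst (proj M i \<Gamma> A B t))" using S(1) that(1) by (simp add: judgement_defs)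
    have "sub M \<Gamma> (extC M i \<Gamma> A) (spair M i (sid M \<Gamma>) (fst (proj M i \<Gamma> A B t)))"
      using raw(7)[OF x] x that(2) by (simp add: judgement_defs)
    from raw(5)[OF this that(2)] S x show ?thesis by (simp add: judgement_defs)
  qed
  note proj1 = proj[THEN conjunct1] and proj2 = proj[THEN conjunct2, THEN conjunct1]
    and proj3 = proj[THEN conjunct2, THEN conjunct2]
    and tpair1 = tpair[THEN conjunct1] and tpair2 = tpair[THEN conjunct2]
  show ?thesis
    by unfold_locales
      ((rule upc code tpair1 tpair2 proj1 proj2 proj3; assumption) |
       (insert m, unfold is_model_def judgement_defs, meson)[1])+
qed

lemma tt0_model_imp_is_model:
  assumes "tt0_model M"
  shows "is_model M"
proof -
  interpret tt0_model M by (rule assms)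
  show ?thesis
    unfolding is_model_def
    apply (intro conjI ballI allI impI)
    subgoal by (meson sid_sub judgement_defs)
    subgoal by (meson comp_sub judgement_defs)
    subgoal by (meson sid_comp judgement_defs)
    subgoal by (meson comp_sid judgement_defs)
    subgoal by (meson comp_assoc judgement_defs)
    subgoal by (meson emp_con judgement_defs)
    subgoal by (meson eps_sub judgement_defs)
    subgoal by (meson eps_unique emp_con judgement_defs)
    subgoal by (meson ty_sub judgement_defs)
    subgoal by (meson ty_sid judgement_defs)
    subgoal by (meson ty_comp judgement_defs)
    subgoal by (meson tm_sub judgement_defs)
    subgoal by (meson tm_sid judgement_defs)
    subgoal by (meson tm_comp judgement_defs)
    subgoal by (meson mk_sub judgement_defs)
    subgoal by (meson ext_con judgement_defs)
    subgoal by (meson pp_sub judgement_defs)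
    subgoal by (meson qq_tm judgement_defs)
    subgoal by (meson spair_sub ty_sub judgement_defs)
    subgoal by (meson pp_spair ty_sub judgement_defs)
    subgoal by (meson qq_spair ty_sub judgement_defs)
    subgoal by (meson spair_eta ext_con judgement_defs)
    subgoal by (meson extM_con judgement_defs)
    subgoal by (meson pM_sub judgement_defs)
    subgoal by (meson extM_mk judgement_defs)
    subgoal by (meson spairM_sub judgement_defs)
    subgoal by (meson pM_spairM judgement_defs)
    subgoal by (meson spairM_eta extM_con judgement_defs)
    subgoal by (meson dn_tm ty_sub pM_sub extM_con judgement_defs)
    subgoal by (meson upc_dn ty_sub pM_sub extM_con judgement_defs)
    subgoal by (meson upc_tm ty_sub pM_sub extM_con judgement_defs)
    subgoal by (meson dn_upc ty_sub pM_sub extM_con judgement_defs)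
    subgoal by (meson dn_sub ty_sub pM_sub extM_con judgement_defs)
    subgoal by (meson PI_ty ext_con judgement_defs)
    subgoal by (meson SG_ty ext_con judgement_defs)
    subgoal by (meson lam_tm PI_ty ext_con judgement_defs)
    subgoal by (meson app_lam PI_ty ext_con judgement_defs)
    subgoal by (meson app_tm PI_ty ext_con judgement_defs)
    subgoal by (meson lam_app PI_ty ext_con judgement_defs)
    subgoal by (meson tpair_tm SG_ty sid_spair_sub ty_sub ext_con judgement_defs)
    subgoal by (meson proj_tpair SG_ty sid_spair_sub ty_sub ext_con judgement_defs)
    subgoal by (meson fst_proj_tm SG_ty sid_spair_sub ty_sub ext_con judgement_defs)
    subgoal by (meson snd_proj_tm SG_ty sid_spair_sub ty_sub ext_con judgement_defs)
    subgoal by (meson tpair_proj SG_ty sid_spair_sub ty_sub ext_con judgement_defs)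
    subgoal by (meson PI_sub ext_con judgement_defs)
    subgoal by (meson SG_sub ext_con judgement_defs)
    subgoal by (meson lam_sub ext_con judgement_defs)
    subgoal by (meson tpair_sub SG_ty sid_spair_sub ty_sub ext_con judgement_defs)
    subgoal by (meson UU_ty judgement_defs)
    subgoal by (meson EL_ty UU_ty judgement_defs)
    subgoal by (meson code_EL UU_ty judgement_defs)
    subgoal by (meson code_tm judgement_defs)
    subgoal by (meson EL_code judgement_defs)
    subgoal by (meson UU_sub judgement_defs)
    subgoal by (meson EL_sub UU_ty judgement_defs)
    done
qed

section \<open>Morphisms\<close>

locale tt0_morph = M: tt0_model M
  for M :: "('c,'s,'t,'m) tt0" and N :: "('c,'s,'t,'m) tt0" and F :: "('c,'s,'t,'m) hom" +
  assumes hC_con: "\<Gamma> \<in> CON M \<Longrightarrow> hC F \<Gamma> \<in> CON N"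
    and hS_sub: "sub M \<Gamma> \<Delta> \<sigma> \<Longrightarrow> sub N (hC F \<Gamma>) (hC F \<Delta>) (hS F \<sigma>)"
    and hT_ty: "ty M l \<Gamma> A \<Longrightarrow> ty N l (hC F \<Gamma>) (hT F A)"
    and hM_tm: "tm M i l \<Gamma> A a \<Longrightarrow> tm N i l (hC F \<Gamma>) (hT F A) (hM F a)"
    and hC_mk: "\<Gamma> \<in> CON M \<Longrightarrow> MK M \<Gamma> \<Longrightarrow> MK N (hC F \<Gamma>)"
    and hS_sid: "\<Gamma> \<in> CON M \<Longrightarrow> hS F (sid M \<Gamma>) = sid N (hC F \<Gamma>)"
    and hS_comp: "sub M \<Delta> \<Theta> \<sigma> \<Longrightarrow> sub M \<Gamma> \<Delta> \<delta> \<Longrightarrow> hS F (\<sigma> \<cdot>\<^bsub>M\<^esub> \<delta>) = hS F \<sigma> \<cdot>\<^bsub>N\<^esub> hS F \<delta>"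
    and hC_emp: "hC F (emp M) = emp N"
    and hS_eps: "\<Gamma> \<in> CON M \<Longrightarrow> hS F (epsS M \<Gamma>) = epsS N (hC F \<Gamma>)"
    and hT_sub: "sub M \<Gamma> \<Delta> \<sigma> \<Longrightarrow> ty M l \<Delta> A \<Longrightarrow> hT F (A \<lhd>\<^bsub>M\<^esub> \<sigma>) = hT F A \<lhd>\<^bsub>N\<^esub> hS F \<sigma>"
    and hM_sub: "sub M \<Gamma> \<Delta> \<sigma> \<Longrightarrow> tm M i l \<Delta> A a \<Longrightarrow> hM F (a \<unlhd>\<^bsub>M\<^esub> \<sigma>) = hM F a \<unlhd>\<^bsub>N\<^esub> hS F \<sigma>"
    and hC_ext: "ty M l \<Gamma> A \<Longrightarrow> hC F (extC M i \<Gamma> A) = extC N i (hC F \<Gamma>) (hT F A)"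
    and hS_pp: "ty M l \<Gamma> A \<Longrightarrow> hS F (pp M i \<Gamma> A) = pp N i (hC F \<Gamma>) (hT F A)"
    and hM_qq: "ty M l \<Gamma> A \<Longrightarrow> hM F (qq M i \<Gamma> A) = qq N i (hC F \<Gamma>) (hT F A)"
    and hS_spair: "ty M l \<Delta> A \<Longrightarrow> sub M \<Gamma> \<Delta> \<sigma> \<Longrightarrow> tm M i l \<Gamma> (A \<lhd>\<^bsub>M\<^esub> \<sigma>) t \<Longrightarrow>
      hS F (spair M i \<sigma> t) = spair N i (hS F \<sigma>) (hM F t)"
    and hC_extM: "\<Gamma> \<in> CON M \<Longrightarrow> hC F (extM M \<Gamma>) = extM N (hC F \<Gamma>)"
    and hS_pM: "\<Gamma> \<in> CON M \<Longrightarrow> hS F (pM M \<Gamma>) = pM N (hC F \<Gamma>)"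
    and hS_spairM: "sub M \<Gamma> \<Delta> \<sigma> \<Longrightarrow> MK M \<Gamma> \<Longrightarrow> hS F (spairM M \<sigma>) = spairM N (hS F \<sigma>)"
    and hM_dn: "ty M l \<Gamma> A \<Longrightarrow> tm M Om l (extM M \<Gamma>) (A \<lhd>\<^bsub>M\<^esub> pM M \<Gamma>) a \<Longrightarrow> hM F (dn M a) = dn N (hM F a)"
    and hM_upc: "tm M Ze l \<Gamma> A a \<Longrightarrow> hM F (upc M a) = upc N (hM F a)"
    and hT_PI: "ty M l \<Gamma> A \<Longrightarrow> ty M l (extC M i \<Gamma> A) B \<Longrightarrow> hT F (PI M i \<Gamma> A B) = PI N i (hC F \<Gamma>) (hT F A) (hT F B)"
    and hT_SG: "ty M l \<Gamma> A \<Longrightarrow> ty M l (extC M i \<Gamma> A) B \<Longrightarrow> hT F (SG M i \<Gamma> A B) = SG N i (hC F \<Gamma>) (hT F A) (hT F B)"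
    and hM_lam: "ty M l \<Gamma> A \<Longrightarrow> tm M Om l (extC M i \<Gamma> A) B t \<Longrightarrow>
      hM F (lam M i \<Gamma> A B t) = lam N i (hC F \<Gamma>) (hT F A) (hT F B) (hM F t)"
    and hM_app: "ty M l \<Gamma> A \<Longrightarrow> ty M l (extC M i \<Gamma> A) B \<Longrightarrow> tm M Om l \<Gamma> (PI M i \<Gamma> A B) t \<Longrightarrow>
      hM F (app M i \<Gamma> A B t) = app N i (hC F \<Gamma>) (hT F A) (hT F B) (hM F t)"
    and hM_tpair: "ty M l (extC M i \<Gamma> A) B \<Longrightarrow> tm M i l \<Gamma> A x \<Longrightarrow> tm M Om l \<Gamma> (B \<lhd>\<^bsub>M\<^esub> spair M i (sid M \<Gamma>) x) b \<Longrightarrow>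
      hM F (tpair M i \<Gamma> A B x b) = tpair N i (hC F \<Gamma>) (hT F A) (hT F B) (hM F x) (hM F b)"
    and hM_proj: "ty M l \<Gamma> A \<Longrightarrow> ty M l (extC M i \<Gamma> A) B \<Longrightarrow> tm M Om l \<Gamma> (SG M i \<Gamma> A B) t \<Longrightarrow>
      map_prod (hM F) (hM F) (proj M i \<Gamma> A B t) = proj N i (hC F \<Gamma>) (hT F A) (hT F B) (hM F t)"
    and hT_UU: "\<Gamma> \<in> CON M \<Longrightarrow> hT F (UU M l \<Gamma>) = UU N l (hC F \<Gamma>)"
    and hT_EL: "tm M Ze (Suc l) \<Gamma> (UU M l \<Gamma>) a \<Longrightarrow> hT F (EL M a) = EL N (hM F a)"
    and hM_code: "ty M l \<Gamma> A \<Longrightarrow> hM F (codeU M A) = codeU N (hT F A)"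

lemma is_morph_imp_tt0_morph:
  assumes "tt0_model M" and f: "is_morph M N F"
  shows "tt0_morph M N F"
proof -
  interpret tt0_model M by (rule assms)
  show ?thesis
    by unfold_locales ((insert f, unfold is_morph_def judgement_defs, elim conjE, simp)[1])+
qed

lemma tt0_morph_imp_is_morph:
  assumes "tt0_morph M N F"
  shows "is_morph M N F"
proof -
  interpret tt0_morph M N F by (rule assms)
  show ?thesis
    unfolding is_morph_def
    apply (intro conjI ballI allI impI)
    subgoal by (meson hC_con judgement_defs)
    subgoal by (meson hS_sub judgement_defs)
    subgoal by (meson hT_ty judgement_defs)
    subgoal by (meson hM_tm judgement_defs)
    subgoal by (meson hC_mk judgement_defs)
    subgoal by (meson hS_sid judgement_defs)
    subgoal by (meson hS_comp judgement_defs)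
    subgoal by (meson hC_emp judgement_defs)
    subgoal by (meson hS_eps judgement_defs)
    subgoal by (meson hT_sub judgement_defs)
    subgoal by (meson hM_sub judgement_defs)
    subgoal by (meson hC_ext judgement_defs)
    subgoal by (meson hS_pp judgement_defs)
    subgoal by (meson hM_qq judgement_defs)
    subgoal by (meson hS_spair M.ty_sub judgement_defs)
    subgoal by (meson hC_extM judgement_defs)
    subgoal by (meson hS_pM judgement_defs)
    subgoal by (meson hS_spairM judgement_defs)
    subgoal by (meson hM_dn M.ty_sub M.pM_sub M.extM_con judgement_defs)
    subgoal by (meson hM_upc judgement_defs)
    subgoal by (meson hT_PI M.ext_con judgement_defs)
    subgoal by (meson hT_SG M.ext_con judgement_defs)
    subgoal by (meson hM_lam M.ext_con judgement_defs)
    subgoal by (meson hM_app M.ext_con M.PI_ty judgement_defs)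
    subgoal by (meson hM_tpair M.ext_con M.ty_sub M.sid_spair_sub judgement_defs)
    subgoal by (meson hM_proj M.ext_con M.SG_ty judgement_defs)
    subgoal by (meson hT_UU judgement_defs)
    subgoal by (meson hT_EL M.UU_ty judgement_defs)
    subgoal by (meson hM_code judgement_defs)
    done
qed

section \<open>The erasure coercions\<close>

context tt0_model
begin

text \<open>The functorial action of \<Gamma> |-> \<Gamma> |> # on substitutions. With it the
  naturality of the coercions becomes plain commutation with substitution.\<close>

definition hash :: "'c \<Rightarrow> 's \<Rightarrow> 's" where
  "hash \<Gamma> \<sigma> = spairM M (\<sigma> \<cdot> pM M \<Gamma>)"

lemma
  assumes "sub M \<Gamma> \<Delta> \<sigma>"
  shows hash_sub: "sub M (extM M \<Gamma>) (extM M \<Delta>) (hash \<Gamma> \<sigma>)"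
    and pM_hash: "pM M \<Delta> \<cdot> hash \<Gamma> \<sigma> = \<sigma> \<cdot> pM M \<Gamma>"
proof -
  have G: "con \<Gamma>" using assms sub_con by blast
  note s = comp_sub[OF assms pM_sub[OF G]]
  show "sub M (extM M \<Gamma>) (extM M \<Delta>) (hash \<Gamma> \<sigma>)" "pM M \<Delta> \<cdot> hash \<Gamma> \<sigma> = \<sigma> \<cdot> pM M \<Gamma>"
    unfolding hash_def using spairM_sub[OF s extM_mk[OF G]] pM_spairM[OF s extM_mk[OF G]] by auto
qed

lemma hash_spairM:
  assumes "sub M \<Gamma> \<Delta> \<sigma>" "sub M \<Xi> \<Gamma> \<delta>" "MK M \<Xi>"
  shows "hash \<Gamma> \<sigma> \<cdot> spairM M \<delta> = spairM M (\<sigma> \<cdot> \<delta>)"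
proof -
  have G: "con \<Gamma>" using assms sub_con by blast
  note p = pM_sub[OF G] and d = spairM_sub[OF assms(2,3)]
  show ?thesis
    unfolding hash_def spairM_comp[OF comp_sub[OF assms(1) p] extM_mk[OF G] d] comp_assoc[OF assms(1) p d]
      pM_spairM[OF assms(2,3)] ..
qed

lemma ty_hash:
  assumes "sub M \<Gamma> \<Delta> \<sigma>" "ty M l \<Delta> A"
  shows "A \<lhd> pM M \<Delta> \<lhd> hash \<Gamma> \<sigma> = A \<lhd> \<sigma> \<lhd> pM M \<Gamma>"
proof -
  have G: "con \<Gamma>" "con \<Delta>" using assms sub_con by blast+
  show ?thesis
    using ty_comp[OF pM_sub[OF G(2)] hash_sub[OF assms(1)] assms(2)] ty_comp[OF assms(1) pM_sub[OF G(1)] assms(2)]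
      pM_hash[OF assms(1)] by simp
qed

text \<open>Over two markers it does not matter which one is forgotten, again because the marker is
  a proposition.\<close>

lemma hash_pM:
  assumes "con \<Gamma>"
  shows "hash (extM M \<Gamma>) (pM M \<Gamma>) = pM M (extM M \<Gamma>)"
  unfolding hash_def by (rule spairM_eta[OF assms pM_sub[OF extM_con[OF assms]]])

lemma dn_sub_hash:
  assumes "sub M \<Gamma> \<Delta> \<sigma>" "ty M l \<Delta> A" "tm M Om l (extM M \<Delta>) (A \<lhd> pM M \<Delta>) a"
  shows "dn M a \<unlhd> \<sigma> = dn M (a \<unlhd> hash \<Gamma> \<sigma>)"
  unfolding hash_def by (rule dn_sub[OF assms])

lemma upc_sub:
  assumes "sub M \<Gamma> \<Delta> \<sigma>" "tm M Ze l \<Delta> A a"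
  shows "upc M a \<unlhd> hash \<Gamma> \<sigma> = upc M (a \<unlhd> \<sigma>)"
proof -
  note t = tm_ty[OF assms(2)] and u = upc_tm[OF assms(2)]
  have "tm M Om l (extM M \<Gamma>) (A \<lhd> \<sigma> \<lhd> pM M \<Gamma>) (upc M a \<unlhd> hash \<Gamma> \<sigma>)"
    using tm_sub[OF hash_sub[OF assms(1)] u] ty_hash[OF assms(1) t] by simp
  from upc_dn[OF ty_sub[OF assms(1) t] this] dn_sub_hash[OF assms(1) t u] dn_upc[OF assms(2)]
  show ?thesis by simp
qed

lemma upc_inj: "tm M Ze l \<Gamma> A a \<Longrightarrow> tm M Ze l \<Gamma> A b \<Longrightarrow> upc M a = upc M b \<Longrightarrow> a = b"
  using dn_upc by metis

lemma dn_inj: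
  "ty M l \<Gamma> A \<Longrightarrow> tm M Om l (extM M \<Gamma>) (A \<lhd> pM M \<Gamma>) a \<Longrightarrow> tm M Om l (extM M \<Gamma>) (A \<lhd> pM M \<Gamma>) b \<Longrightarrow>
   dn M a = dn M b \<Longrightarrow> a = b"
  using upc_dn by metis

lemma downstar_tm:
  assumes "tm M i l \<Gamma> A a"
  shows "tm M Ze l \<Gamma> A (downstar M i \<Gamma> a)"
  using assms dn_tm[OF tm_ty[OF assms] tm_sub[OF pM_sub[OF tm_con[OF assms]]]]
  by (cases i) (auto simp: downstar_def)

lemma tm_pM_comm:
  assumes "sub M \<Gamma> \<Delta> \<sigma>" "tm M i l \<Delta> A a"
  shows "a \<unlhd> pM M \<Delta> \<unlhd> hash \<Gamma> \<sigma> = a \<unlhd> \<sigma> \<unlhd> pM M \<Gamma>"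
proof -
  have G: "con \<Gamma>" "con \<Delta>" using assms sub_con by blast+
  show ?thesis
    using tm_comp[OF pM_sub[OF G(2)] hash_sub[OF assms(1)] assms(2)] tm_comp[OF assms(1) pM_sub[OF G(1)] assms(2)]
      pM_hash[OF assms(1)] by simp
qed

lemma downstar_sub:
  assumes "sub M \<Gamma> \<Delta> \<sigma>" "tm M i l \<Delta> A a"
  shows "downstar M i \<Delta> a \<unlhd> \<sigma> = downstar M i \<Gamma> (a \<unlhd> \<sigma>)"
proof (cases i)
  case Om
  have D: "con \<Delta>" using assms sub_con by blast
  show ?thesis
    using dn_sub_hash[OF assms(1) tm_ty[OF assms(2)] tm_sub[OF pM_sub[OF D] assms(2)[unfolded Om]]]
      tm_pM_comm[OF assms] by (simp add: Om downstar_def)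
qed (simp add: downstar_def)

lemma liftT_tm:
  assumes "tm M Ze l \<Gamma> A x"
  shows "tm M i l (extM M \<Gamma>) (A \<lhd> pM M \<Gamma>) (liftT M i \<Gamma> x)"
  using upc_tm[OF assms] tm_sub[OF pM_sub[OF tm_con[OF assms]] assms]
  by (cases i) (auto simp: liftT_def)

lemma liftT_sub:
  assumes "sub M \<Gamma> \<Delta> \<sigma>" "tm M Ze l \<Delta> A x"
  shows "liftT M i \<Delta> x \<unlhd> hash \<Gamma> \<sigma> = liftT M i \<Gamma> (x \<unlhd> \<sigma>)"
  using upc_sub[OF assms] tm_pM_comm[OF assms] by (cases i) (auto simp: liftT_def)

text \<open>With \<open>liftT_downstar\<close> this says that the passages between the modes are
  mutually inverse up to weakening by p_#. In the runtime case \<open>hash_pM\<close> lets the outer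
  weakening be read as \<open>hash\<close> of p_#, so that naturality of \<open>upc\<close>
  applies.\<close>

lemma downstar_liftT:
  assumes "tm M Ze l \<Gamma> A x"
  shows "downstar M i (extM M \<Gamma>) (liftT M i \<Gamma> x) = x \<unlhd> pM M \<Gamma>"
proof (cases i)
  case Om
  note G = tm_con[OF assms]
  show ?thesis
    using upc_sub[OF pM_sub[OF G] assms] dn_upc[OF tm_sub[OF pM_sub[OF G] assms]]
    by (simp add: Om downstar_def liftT_def hash_pM[OF G])
qed (simp add: downstar_def liftT_def)

lemma liftT_downstar:
  assumes "tm M i l \<Gamma> A t"
  shows "liftT M i \<Gamma> (downstar M i \<Gamma> t) = t \<unlhd> pM M \<Gamma>"
proof (cases i)
  case Om
  show ?thesis
    using upc_dn[OF tm_ty[OF assms] tm_sub[OF pM_sub[OF tm_con[OF assms]] assms[unfolded Om]]]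
    by (simp add: Om downstar_def liftT_def)
qed (simp add: downstar_def liftT_def)

section \<open>The comparison (p_i, down_star q_i) and substitutions invertible over the
  marker\<close>

lemma
  assumes "ty M l \<Gamma> A"
  shows wS_sub: "sub M (extC M i \<Gamma> A) (extC M Ze \<Gamma> A) (wS M i \<Gamma> A)"
    and pp_wS: "pp M Ze \<Gamma> A \<cdot> wS M i \<Gamma> A = pp M i \<Gamma> A"
    and qq_wS: "qq M Ze \<Gamma> A \<unlhd> wS M i \<Gamma> A = downstar M i (extC M i \<Gamma> A) (qq M i \<Gamma> A)"
  unfolding wS_def
  by (rule spair_sub[OF assms pp_sub[OF assms] downstar_tm[OF qq_tm[OF assms]]]
      pp_spair[OF assms pp_sub[OF assms] downstar_tm[OF qq_tm[OF assms]]]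
      qq_spair[OF assms pp_sub[OF assms] downstar_tm[OF qq_tm[OF assms]]])+

lemma wS_comp:
  assumes "ty M l \<Delta> A" "sub M \<Gamma> (extC M i \<Delta> A) \<tau>"
  shows "wS M i \<Delta> A \<cdot> \<tau> = spair M Ze (pp M i \<Delta> A \<cdot> \<tau>) (downstar M i \<Gamma> (qq M i \<Delta> A \<unlhd> \<tau>))"
  unfolding wS_def
    spair_comp[OF assms(1) pp_sub[OF assms(1)] downstar_tm[OF qq_tm[OF assms(1)]] assms(2)]
    downstar_sub[OF assms(2) qq_tm[OF assms(1)]] ..

lemma wS_spair:
  assumes "ty M l \<Delta> A" "sub M \<Gamma> \<Delta> \<sigma>" "tm M i l \<Gamma> (A \<lhd> \<sigma>) t"
  shows "wS M i \<Delta> A \<cdot> spair M i \<sigma> t = spair M Ze \<sigma> (downstar M i \<Gamma> t)"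
  unfolding wS_comp[OF assms(1) spair_sub[OF assms]] pp_spair[OF assms] qq_spair[OF assms] ..

text \<open>Naturality of the comparison; the stability of \<Pi>_i and \<Sigma>_i in the zeroed
  model under substitution rests on it.\<close>

lemma wS_lift:
  assumes "sub M \<Gamma> \<Delta> \<sigma>" "ty M l \<Delta> A"
  shows "wS M i \<Delta> A \<cdot> liftS M i \<Gamma> A \<sigma> = liftS M Ze \<Gamma> A \<sigma> \<cdot> wS M i \<Gamma> (A \<lhd> \<sigma>)"
proof -
  note t = ty_sub[OF assms]
  have q: "tm M Ze l (extC M i \<Gamma> (A \<lhd> \<sigma>)) (A \<lhd> \<sigma> \<lhd> pp M i \<Gamma> (A \<lhd> \<sigma>))
      (downstar M i (extC M i \<Gamma> (A \<lhd> \<sigma>)) (qq M i \<Gamma> (A \<lhd> \<sigma>)))"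
    by (rule downstar_tm[OF qq_tm[OF t]])
  show ?thesis
    unfolding wS_comp[OF assms(2) lift_sub[OF assms]] pp_lift[OF assms] qq_lift[OF assms]
    unfolding wS_def lift_spair[OF assms pp_sub[OF t] q] ..
qed

text \<open>A substitution that becomes invertible after extending both contexts by the marker acts
  bijectively on erased terms, because erased terms are runtime terms over the extended context.\<close>

lemma erased_equiv_inj:
  assumes s: "sub M \<Gamma> \<Delta> \<sigma>" and r: "sub M (extM M \<Delta>) \<Gamma> \<rho>" and e: "\<sigma> \<cdot> \<rho> = pM M \<Delta>"
    and x: "tm M Ze l \<Delta> B x" and y: "tm M Ze l \<Delta> B y" and xy: "x \<unlhd> \<sigma> = y \<unlhd> \<sigma>"
  shows "x = y"
proof -
  have D: "con \<Delta>" using s sub_con by blast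
  note R = spairM_sub[OF r extM_mk[OF D]]
  have *: "upc M z \<unlhd> hash \<Gamma> \<sigma> \<unlhd> spairM M \<rho> = upc M z" if "tm M Ze l \<Delta> B z" for z
    using tm_comp[OF hash_sub[OF s] R upc_tm[OF that]] hash_spairM[OF s r extM_mk[OF D]] e
      spairM_pM[OF D] tm_sid[OF upc_tm[OF that]] by simp
  have "upc M x = upc M y"
    using *[OF x] *[OF y] upc_sub[OF s x] upc_sub[OF s y] xy by simp
  then show ?thesis by (rule upc_inj[OF x y])
qed

text \<open>The preimage of \<open>b\<close> is obtained by viewing \<open>b\<close> over the
  marker, pulling it back along the inverse and returning with \<open>dn\<close>. Here the inverse
  is two-sided: \<open>e\<close> types the preimage, and \<open>f\<close> shows that it is sent to
  \<open>b\<close>.\<close>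

lemma erased_equiv_surj:
  assumes s: "sub M \<Gamma> \<Delta> \<sigma>" and r: "sub M (extM M \<Delta>) \<Gamma> \<rho>" and e: "\<sigma> \<cdot> \<rho> = pM M \<Delta>"
    and f: "\<rho> \<cdot> hash \<Gamma> \<sigma> = pM M \<Gamma>"
    and B: "ty M l \<Delta> B" and b: "tm M Ze l \<Gamma> (B \<lhd> \<sigma>) b"
  obtains a where "tm M Ze l \<Delta> B a" "a \<unlhd> \<sigma> = b"
proof -
  have D: "con \<Delta>" and G: "con \<Gamma>" using s sub_con by blast+
  note R = spairM_sub[OF r extM_mk[OF D]] and Bs = ty_sub[OF s B]
  have "B \<lhd> \<sigma> \<lhd> pM M \<Gamma> \<lhd> spairM M \<rho> = B \<lhd> pM M \<Delta>"
    using ty_comp[OF pM_sub[OF G] R Bs] pM_spairM[OF r extM_mk[OF D]] ty_comp[OF s r B] e by simp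
  then have t: "tm M Om l (extM M \<Delta>) (B \<lhd> pM M \<Delta>) (upc M b \<unlhd> spairM M \<rho>)"
    using tm_sub[OF R upc_tm[OF b]] by simp
  have "spairM M \<rho> \<cdot> hash \<Gamma> \<sigma> = sid M (extM M \<Gamma>)"
    using spairM_comp[OF r extM_mk[OF D] hash_sub[OF s]] f spairM_pM[OF G] by simp
  then have "upc M b \<unlhd> spairM M \<rho> \<unlhd> hash \<Gamma> \<sigma> = upc M b"
    using tm_comp[OF R hash_sub[OF s] upc_tm[OF b]] tm_sid[OF upc_tm[OF b]] by simp
  then have "dn M (upc M b \<unlhd> spairM M \<rho>) \<unlhd> \<sigma> = b"
    using dn_sub_hash[OF s B t] dn_upc[OF b] by simp
  with dn_tm[OF B t] that show ?thesis by blast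
qed

text \<open>p_# itself is of this kind, with the identity as inverse over the marker. Hence
  weakening by p_# is injective on erased terms and reaches every erased term over \<Gamma> |> #
  whose type is weakened (\<open>tm_pM_inj\<close>, \<open>liftT_surj\<close>).\<close>

lemma pM_equiv:
  assumes "con \<Gamma>"
  shows "sub M (extM M \<Gamma>) (extM M \<Gamma>) (sid M (extM M \<Gamma>))"
    "pM M \<Gamma> \<cdot> sid M (extM M \<Gamma>) = pM M \<Gamma>"
    "sid M (extM M \<Gamma>) \<cdot> hash (extM M \<Gamma>) (pM M \<Gamma>) = pM M (extM M \<Gamma>)"
  using sid_sub[OF extM_con[OF assms]] comp_sid[OF pM_sub[OF assms]] hash_pM[OF assms]
    sid_comp[OF pM_sub[OF extM_con[OF assms]]] by auto

lemma tm_pM_inj: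
  assumes "tm M Ze l \<Gamma> A x" "tm M Ze l \<Gamma> A y" "x \<unlhd> pM M \<Gamma> = y \<unlhd> pM M \<Gamma>"
  shows "x = y"
  using erased_equiv_inj[OF pM_sub pM_equiv(1,2) assms] tm_con[OF assms(1)] by blast

lemma liftT_inj:
  assumes "tm M Ze l \<Gamma> A x" "tm M Ze l \<Gamma> A y" "liftT M i \<Gamma> x = liftT M i \<Gamma> y"
  shows "x = y"
  using tm_pM_inj[OF assms(1,2)] upc_inj[OF assms(1,2)] assms(3) by (cases i) (auto simp: liftT_def)

lemma liftT_surj:
  assumes "ty M l \<Gamma> A" "tm M i l (extM M \<Gamma>) (A \<lhd> pM M \<Gamma>) y"
  obtains x where "tm M Ze l \<Gamma> A x" "liftT M i \<Gamma> x = y"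
proof (cases i)
  case Ze
  note G = ty_con[OF assms(1)]
  show ?thesis
    using erased_equiv_surj[OF pM_sub pM_equiv assms(1) assms(2)[unfolded Ze]] G that
    by (auto simp: Ze liftT_def)
next
  case Om
  show ?thesis
    using that[OF dn_tm[OF assms(1) assms(2)[unfolded Om]]] upc_dn[OF assms(1) assms(2)[unfolded Om]]
    by (simp add: Om liftT_def)
qed

text \<open>Over the marker the erased variable can be viewed at mode \<open>i\<close> by
  \<open>liftT\<close>, and this inverts the comparison. Hence \<Gamma> |>_0 A and \<Gamma> |>_i A
  have the same erased terms.\<close>

lemma wS_equiv:
  fixes i :: mode
  assumes A: "ty M l \<Gamma> A"
  defines "\<rho> \<equiv> spair M i (pp M Ze \<Gamma> A \<cdot> pM M (extC M Ze \<Gamma> A)) (liftT M i (extC M Ze \<Gamma> A) (qq M Ze \<Gamma> A))"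
  shows "sub M (extM M (extC M Ze \<Gamma> A)) (extC M i \<Gamma> A) \<rho>"
    "wS M i \<Gamma> A \<cdot> \<rho> = pM M (extC M Ze \<Gamma> A)"
    "\<rho> \<cdot> hash (extC M i \<Gamma> A) (wS M i \<Gamma> A) = pM M (extC M i \<Gamma> A)"
proof -
  let ?E = "extC M Ze \<Gamma> A" and ?Ei = "extC M i \<Gamma> A"
  have E: "con ?E" and Ei: "con ?Ei" using ext_con[OF A] by auto
  note p = pp_sub[OF A] and q = qq_tm[OF A] and w = wS_sub[OF A, of i]
  note pm = comp_sub[OF p pM_sub[OF E]]
  have t: "tm M i l (extM M ?E) (A \<lhd> (pp M Ze \<Gamma> A \<cdot> pM M ?E)) (liftT M i ?E (qq M Ze \<Gamma> A))"
    using liftT_tm[OF q, of i] ty_comp[OF p pM_sub[OF E] A] by simp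
  show r: "sub M (extM M ?E) ?Ei \<rho>" unfolding \<rho>_def by (rule spair_sub[OF A pm t])
  show "wS M i \<Gamma> A \<cdot> \<rho> = pM M ?E"
    unfolding \<rho>_def wS_spair[OF A pm t] downstar_liftT[OF q] by (rule spair_eta[OF A pM_sub[OF E]])
  have 1: "pp M Ze \<Gamma> A \<cdot> pM M ?E \<cdot> hash ?Ei (wS M i \<Gamma> A) = pp M i \<Gamma> A \<cdot> pM M ?Ei"
    unfolding comp_assoc[OF p pM_sub[OF E] hash_sub[OF w]] pM_hash[OF w]
      comp_assoc[OF p w pM_sub[OF Ei], symmetric] pp_wS[OF A] ..
  have 2: "liftT M i ?E (qq M Ze \<Gamma> A) \<unlhd> hash ?Ei (wS M i \<Gamma> A) = qq M i \<Gamma> A \<unlhd> pM M ?Ei"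
    unfolding liftT_sub[OF w q] qq_wS[OF A] liftT_downstar[OF q] ..
  show "\<rho> \<cdot> hash ?Ei (wS M i \<Gamma> A) = pM M ?Ei"
    unfolding \<rho>_def spair_comp[OF A pm t hash_sub[OF w]] 1 2 by (rule spair_eta[OF A pM_sub[OF Ei]])
qed

lemma tm_wS_inj:
  assumes "ty M l \<Gamma> A" "tm M Ze k (extC M Ze \<Gamma> A) B x" "tm M Ze k (extC M Ze \<Gamma> A) B y"
    "x \<unlhd> wS M i \<Gamma> A = y \<unlhd> wS M i \<Gamma> A"
  shows "x = y"
  by (rule erased_equiv_inj[OF wS_sub[OF assms(1)] wS_equiv(1,2)[OF assms(1)] assms(2-4)])

lemma tm_wS_surj:
  assumes "ty M l \<Gamma> A" "ty M k (extC M Ze \<Gamma> A) B" "tm M Ze k (extC M i \<Gamma> A) (B \<lhd> wS M i \<Gamma> A) b"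
  obtains a where "tm M Ze k (extC M Ze \<Gamma> A) B a" "a \<unlhd> wS M i \<Gamma> A = b"
  by (rule erased_equiv_surj[OF wS_sub[OF assms(1)] wS_equiv[OF assms(1)] assms(2,3)])

end

section \<open>Erased abstraction\<close>

context tt0_model
begin

lemma s3_eq: "s3 M i \<Gamma> A = liftS M i (extM M \<Gamma>) A (pM M \<Gamma>)"
  by (simp add: s3_def liftS_def)

lemma s3_sub: "ty M l \<Gamma> A \<Longrightarrow> sub M (extC M i (extM M \<Gamma>) (A \<lhd> pM M \<Gamma>)) (extC M i \<Gamma> A) (s3 M i \<Gamma> A)"
  unfolding s3_eq by (rule lift_sub[OF pM_sub[OF ty_con]])

lemma s3_spair:
  assumes A: "ty M l \<Gamma> A" and x: "tm M i l (extM M \<Gamma>) (A \<lhd> pM M \<Gamma>) x"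
  shows "s3 M i \<Gamma> A \<cdot> spair M i (sid M (extM M \<Gamma>)) x = spair M i (pM M \<Gamma>) x"
proof -
  note G = ty_con[OF A]
  have "tm M i l (extM M \<Gamma>) (A \<lhd> pM M \<Gamma> \<lhd> sid M (extM M \<Gamma>)) x"
    using x ty_sid[OF tm_ty[OF x]] by simp
  then show ?thesis
    unfolding s3_eq using lift_spair[OF pM_sub[OF G] A sid_sub[OF extM_con[OF G]]] comp_sid[OF pM_sub[OF G]]
    by simp
qed

lemma
  assumes A: "ty M l \<Gamma> A"
  shows swapS_sub: "sub M (extC M i (extM M \<Gamma>) (A \<lhd> pM M \<Gamma>)) (extM M (extC M i \<Gamma> A)) (swapS M i \<Gamma> A)"
    and pM_swapS: "pM M (extC M i \<Gamma> A) \<cdot> swapS M i \<Gamma> A = s3 M i \<Gamma> A"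
proof -
  note G = ty_con[OF A]
  have "MK M (extC M i (extM M \<Gamma>) (A \<lhd> pM M \<Gamma>))"
    by (rule mk_sub[OF pp_sub[OF ty_sub[OF pM_sub[OF G] A]] extM_mk[OF G]])
  then show "sub M (extC M i (extM M \<Gamma>) (A \<lhd> pM M \<Gamma>)) (extM M (extC M i \<Gamma> A)) (swapS M i \<Gamma> A)"
    "pM M (extC M i \<Gamma> A) \<cdot> swapS M i \<Gamma> A = s3 M i \<Gamma> A"
    unfolding swapS_def using spairM_sub[OF s3_sub[OF A]] pM_spairM[OF s3_sub[OF A]] by auto
qed

lemma ty_swapS:
  assumes A: "ty M l \<Gamma> A" and B: "ty M k (extC M i \<Gamma> A) B"
  shows "B \<lhd> pM M (extC M i \<Gamma> A) \<lhd> swapS M i \<Gamma> A = B \<lhd> s3 M i \<Gamma> A"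
  using ty_comp[OF pM_sub[OF ext_con[OF A]] swapS_sub[OF A] B] pM_swapS[OF A] by simp

lemma tm_swapS:
  assumes A: "ty M l \<Gamma> A" and t: "tm M j k (extC M i \<Gamma> A) B t"
  shows "t \<unlhd> pM M (extC M i \<Gamma> A) \<unlhd> swapS M i \<Gamma> A = t \<unlhd> s3 M i \<Gamma> A"
  using tm_comp[OF pM_sub[OF ext_con[OF A]] swapS_sub[OF A] t] pM_swapS[OF A] by simp

definition unswap :: "mode \<Rightarrow> 'c \<Rightarrow> 't \<Rightarrow> 's" where
  "unswap i \<Gamma> A = spair M i (spairM M (pp M i \<Gamma> A \<cdot> pM M (extC M i \<Gamma> A)))
                           (qq M i \<Gamma> A \<unlhd> pM M (extC M i \<Gamma> A))"

text \<open>Extending by a variable and extending by the marker commute. Through this isomorphism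
  the bijection lam/app over \<Gamma> |> # becomes one for \<open>lam0\<close>.\<close>

lemma
  fixes i :: mode
  assumes A: "ty M l \<Gamma> A"
  defines "E \<equiv> extC M i \<Gamma> A" and "E' \<equiv> extC M i (extM M \<Gamma>) (A \<lhd> pM M \<Gamma>)"
  shows unswap_sub: "sub M (extM M E) E' (unswap i \<Gamma> A)"
    and swapS_unswap: "swapS M i \<Gamma> A \<cdot> unswap i \<Gamma> A = sid M (extM M E)"
    and unswap_swapS: "unswap i \<Gamma> A \<cdot> swapS M i \<Gamma> A = sid M E'"
proof -
  note G = ty_con[OF A] and E = ext_con[OF A, of i, folded E_def] and p = pp_sub[OF A, of i, folded E_def]
    and q = qq_tm[OF A, of i, folded E_def]
  note pm = pM_sub[OF E] and A' = ty_sub[OF pM_sub[OF G] A]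
  note pp = comp_sub[OF p pm] and sw = swapS_sub[OF A, of i, folded E_def E'_def]
  note s = spairM_sub[OF pp extM_mk[OF E]] and ps = pM_spairM[OF pp extM_mk[OF E]]
  have ty: "A \<lhd> pM M \<Gamma> \<lhd> spairM M (pp M i \<Gamma> A \<cdot> pM M E) = A \<lhd> pp M i \<Gamma> A \<lhd> pM M E"
    using ty_comp[OF pM_sub[OF G] s A] ps ty_comp[OF p pm A] by simp
  have t: "tm M i l (extM M E) (A \<lhd> pM M \<Gamma> \<lhd> spairM M (pp M i \<Gamma> A \<cdot> pM M E)) (qq M i \<Gamma> A \<unlhd> pM M E)"
    using tm_sub[OF pm q] ty by simp
  show u: "sub M (extM M E) E' (unswap i \<Gamma> A)"
    unfolding unswap_def E'_def using spair_sub[OF A' s t] by (simp add: E_def)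
  have "s3 M i \<Gamma> A \<cdot> unswap i \<Gamma> A = pM M E"
    unfolding s3_eq unswap_def E_def[symmetric] lift_spair[OF pM_sub[OF G] A s t] ps
    by (rule spair_eta[OF A pm[unfolded E_def], folded E_def])
  then show "swapS M i \<Gamma> A \<cdot> unswap i \<Gamma> A = sid M (extM M E)"
    using spairM_eta[OF E comp_sub[OF sw u]] comp_assoc[OF pM_sub[OF E] sw u] pM_swapS[OF A, of i]
      spairM_pM[OF E] by (simp add: E_def)
  have p': "sub M E' (extM M \<Gamma>) (pp M i (extM M \<Gamma>) (A \<lhd> pM M \<Gamma>))"
    unfolding E'_def by (rule pp_sub[OF A'])
  have "pp M i \<Gamma> A \<cdot> pM M E \<cdot> swapS M i \<Gamma> A = pM M \<Gamma> \<cdot> pp M i (extM M \<Gamma>) (A \<lhd> pM M \<Gamma>)"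
    using comp_assoc[OF p pm sw] pM_swapS[OF A, of i] pp_lift[OF pM_sub[OF G] A, of i] by (simp add: E_def s3_eq)
  then have 1: "spairM M (pp M i \<Gamma> A \<cdot> pM M E) \<cdot> swapS M i \<Gamma> A = pp M i (extM M \<Gamma>) (A \<lhd> pM M \<Gamma>)"
    using spairM_comp[OF pp extM_mk[OF E] sw] spairM_eta[OF G p'] by simp
  have 2: "qq M i \<Gamma> A \<unlhd> pM M E \<unlhd> swapS M i \<Gamma> A = qq M i (extM M \<Gamma>) (A \<lhd> pM M \<Gamma>)"
    using tm_swapS[OF A q[unfolded E_def]] qq_lift[OF pM_sub[OF G] A, of i] by (simp add: E_def s3_eq)
  show "unswap i \<Gamma> A \<cdot> swapS M i \<Gamma> A = sid M E'"
    unfolding unswap_def E_def[symmetric] spair_comp[OF A' s t sw] 1 2 E'_def by (rule spair_pp_qq[OF A'])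
qed

section \<open>Typing and bijectivity of the erased lambda\<close>

lemma lam0_body:
  assumes A: "ty M l \<Gamma> A" and t: "tm M Ze l (extC M i \<Gamma> A) B t"
  shows "tm M Om l (extC M i (extM M \<Gamma>) (A \<lhd> pM M \<Gamma>)) (B \<lhd> s3 M i \<Gamma> A) (upc M t \<unlhd> swapS M i \<Gamma> A)"
  using tm_sub[OF swapS_sub[OF A] upc_tm[OF t]] ty_swapS[OF A tm_ty[OF t]] by simp

lemma lam0_eq:
  assumes A: "ty M l \<Gamma> A" and B: "ty M l (extC M i \<Gamma> A) B"
  shows "lam0 M i \<Gamma> A B t =
    dn M (lam M i (extM M \<Gamma>) (A \<lhd> pM M \<Gamma>) (B \<lhd> s3 M i \<Gamma> A) (upc M t \<unlhd> swapS M i \<Gamma> A))"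
  unfolding lam0_def ty_swapS[OF A B] ..

lemma PI_pM:
  assumes A: "ty M l \<Gamma> A" and B: "ty M l (extC M i \<Gamma> A) B"
  shows "PI M i \<Gamma> A B \<lhd> pM M \<Gamma> = PI M i (extM M \<Gamma>) (A \<lhd> pM M \<Gamma>) (B \<lhd> s3 M i \<Gamma> A)"
    and "SG M i \<Gamma> A B \<lhd> pM M \<Gamma> = SG M i (extM M \<Gamma>) (A \<lhd> pM M \<Gamma>) (B \<lhd> s3 M i \<Gamma> A)"
  unfolding s3_eq by (rule PI_sub[OF pM_sub[OF ty_con[OF A]] A B] SG_sub[OF pM_sub[OF ty_con[OF A]] A B])+

lemma lam0_lam_tm:
  assumes A: "ty M l \<Gamma> A" and t: "tm M Ze l (extC M i \<Gamma> A) B t"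
  shows "tm M Om l (extM M \<Gamma>) (PI M i \<Gamma> A B \<lhd> pM M \<Gamma>)
    (lam M i (extM M \<Gamma>) (A \<lhd> pM M \<Gamma>) (B \<lhd> s3 M i \<Gamma> A) (upc M t \<unlhd> swapS M i \<Gamma> A))"
  using lam_tm[OF ty_sub[OF pM_sub[OF ty_con[OF A]] A] lam0_body[OF A t]] PI_pM(1)[OF A tm_ty[OF t]] by simp

lemma lam0_tm:
  assumes A: "ty M l \<Gamma> A" and t: "tm M Ze l (extC M i \<Gamma> A) B t"
  shows "tm M Ze l \<Gamma> (PI M i \<Gamma> A B) (lam0 M i \<Gamma> A B t)"
  unfolding lam0_eq[OF A tm_ty[OF t]]
  by (rule dn_tm[OF PI_ty[OF A tm_ty[OF t]] lam0_lam_tm[OF A t]])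

text \<open>\<open>lam0\<close> is a composite of injective maps: \<open>upc\<close>, substitution
  by the invertible \<open>swapS\<close>, \<open>lam\<close> and \<open>dn\<close>.\<close>

lemma lam0_inj:
  assumes A: "ty M l \<Gamma> A" and t: "tm M Ze l (extC M i \<Gamma> A) B t" and u: "tm M Ze l (extC M i \<Gamma> A) B u"
    and e: "lam0 M i \<Gamma> A B t = lam0 M i \<Gamma> A B u"
  shows "t = u"
proof -
  note B = tm_ty[OF t] and A' = ty_sub[OF pM_sub[OF ty_con[OF A]] A]
  have *: "upc M x = upc M x \<unlhd> swapS M i \<Gamma> A \<unlhd> unswap i \<Gamma> A" if "tm M Ze l (extC M i \<Gamma> A) B x" for x
    using tm_comp[OF swapS_sub[OF A] unswap_sub[OF A] upc_tm[OF that]] swapS_unswap[OF A]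
      tm_sid[OF upc_tm[OF that]] by simp
  have "lam M i (extM M \<Gamma>) (A \<lhd> pM M \<Gamma>) (B \<lhd> s3 M i \<Gamma> A) (upc M t \<unlhd> swapS M i \<Gamma> A) =
    lam M i (extM M \<Gamma>) (A \<lhd> pM M \<Gamma>) (B \<lhd> s3 M i \<Gamma> A) (upc M u \<unlhd> swapS M i \<Gamma> A)"
    by (rule dn_inj[OF PI_ty[OF A B] lam0_lam_tm[OF A t] lam0_lam_tm[OF A u] e[unfolded lam0_eq[OF A B]]])
  then have "upc M t \<unlhd> swapS M i \<Gamma> A = upc M u \<unlhd> swapS M i \<Gamma> A"
    using app_lam[OF A' lam0_body[OF A t]] app_lam[OF A' lam0_body[OF A u]] by metis
  then have "upc M t = upc M u" using *[OF t] *[OF u] by simp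
  then show ?thesis by (rule upc_inj[OF t u])
qed

lemma lam0_surj:
  assumes A: "ty M l \<Gamma> A" and B: "ty M l (extC M i \<Gamma> A) B" and s: "tm M Ze l \<Gamma> (PI M i \<Gamma> A B) s"
  obtains t where "tm M Ze l (extC M i \<Gamma> A) B t" "lam0 M i \<Gamma> A B t = s"
proof -
  note G = ty_con[OF A] and A' = ty_sub[OF pM_sub[OF ty_con[OF A]] A]
    and B' = ty_sub[OF s3_sub[OF A] B]
  \<comment> \<open>The stages of \<open>lam0\<close> are undone in reverse order:
    \<open>upc\<close> and \<open>app\<close> give \<open>v\<close>, then \<open>unswap\<close> and
    \<open>dn\<close> lead back to an erased term over \<Gamma> |>_i A.\<close>
  define v where "v = app M i (extM M \<Gamma>) (A \<lhd> pM M \<Gamma>) (B \<lhd> s3 M i \<Gamma> A) (upc M s)"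
  have us: "tm M Om l (extM M \<Gamma>) (PI M i (extM M \<Gamma>) (A \<lhd> pM M \<Gamma>) (B \<lhd> s3 M i \<Gamma> A)) (upc M s)"
    using upc_tm[OF s] PI_pM(1)[OF A B] by simp
  have v: "tm M Om l (extC M i (extM M \<Gamma>) (A \<lhd> pM M \<Gamma>)) (B \<lhd> s3 M i \<Gamma> A) v"
    unfolding v_def by (rule app_tm[OF A' B' us])
  have "s3 M i \<Gamma> A \<cdot> unswap i \<Gamma> A = pM M (extC M i \<Gamma> A)"
    using comp_assoc[OF pM_sub[OF ext_con[OF A]] swapS_sub[OF A] unswap_sub[OF A]] pM_swapS[OF A] swapS_unswap[OF A]
      comp_sid[OF pM_sub[OF ext_con[OF A]]] by simp
  then have w: "tm M Om l (extM M (extC M i \<Gamma> A)) (B \<lhd> pM M (extC M i \<Gamma> A)) (v \<unlhd> unswap i \<Gamma> A)"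
    using tm_sub[OF unswap_sub[OF A] v] ty_comp[OF s3_sub[OF A] unswap_sub[OF A] B] by simp
  have "v \<unlhd> unswap i \<Gamma> A \<unlhd> swapS M i \<Gamma> A = v"
    using tm_comp[OF unswap_sub[OF A] swapS_sub[OF A] v] unswap_swapS[OF A] tm_sid[OF v] by simp
  then have "lam0 M i \<Gamma> A B (dn M (v \<unlhd> unswap i \<Gamma> A)) = s"
    unfolding lam0_eq[OF A B] upc_dn[OF B w]
    using lam_app[OF A' B' us] dn_upc[OF s] by (simp add: v_def)
  with that dn_tm[OF B w] show ?thesis by blast
qed

text \<open>Both composites are the pairing of \<sigma> after the two weakenings with the variable
  q_i.\<close>

lemma s3_lift:
  assumes s: "sub M \<Gamma> \<Delta> \<sigma>" and A: "ty M l \<Delta> A"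
  shows "s3 M i \<Delta> A \<cdot> liftS M i (extM M \<Gamma>) (A \<lhd> pM M \<Delta>) (hash \<Gamma> \<sigma>) = liftS M i \<Gamma> A \<sigma> \<cdot> s3 M i \<Gamma> (A \<lhd> \<sigma>)"
proof -
  note G = sub_con(1)[OF s] and D = sub_con(2)[OF s]
  note pD = pM_sub[OF D] and pG = pM_sub[OF G] and h = hash_sub[OF s] and As = ty_sub[OF s A]
  note th = ty_hash[OF s A] and ApD = ty_sub[OF pD A]
  note AsG = ty_sub[OF pG As]
  let ?E = "extC M i (extM M \<Gamma>) (A \<lhd> \<sigma> \<lhd> pM M \<Gamma>)" let ?p = "pp M i (extM M \<Gamma>) (A \<lhd> \<sigma> \<lhd> pM M \<Gamma>)"
  let ?q = "qq M i (extM M \<Gamma>) (A \<lhd> \<sigma> \<lhd> pM M \<Gamma>)"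
  note p = pp_sub[OF AsG, of i] and q = qq_tm[OF AsG, of i]
  have 1: "tm M i l ?E (A \<lhd> pM M \<Delta> \<lhd> (hash \<Gamma> \<sigma> \<cdot> ?p)) ?q"
    using q ty_comp[OF h p ApD] th by simp
  have 2: "tm M i l ?E (A \<lhd> \<sigma> \<lhd> (pM M \<Gamma> \<cdot> ?p)) ?q"
    using q ty_comp[OF pG p As] by simp
  have 3: "pM M \<Delta> \<cdot> (hash \<Gamma> \<sigma> \<cdot> ?p) = \<sigma> \<cdot> (pM M \<Gamma> \<cdot> ?p)"
    using comp_assoc[OF pD h p] comp_assoc[OF s pG p] pM_hash[OF s] by simp
  have "s3 M i \<Delta> A \<cdot> liftS M i (extM M \<Gamma>) (A \<lhd> pM M \<Delta>) (hash \<Gamma> \<sigma>) = spair M i (pM M \<Delta> \<cdot> (hash \<Gamma> \<sigma> \<cdot> ?p)) ?q"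
    using lift_spair[OF pD A comp_sub[OF h p] 1] th by (simp add: s3_eq liftS_def[of M i "extM M \<Gamma>" "A \<lhd> pM M \<Delta>"])
  also have "\<dots> = liftS M i \<Gamma> A \<sigma> \<cdot> s3 M i \<Gamma> (A \<lhd> \<sigma>)"
    using lift_spair[OF s A comp_sub[OF pG p] 2] 3 by (simp add: s3_def)
  finally show ?thesis .
qed

text \<open>The target ends with the marker, so it suffices to compare after p_#, and there the
  equation is \<open>s3_lift\<close>.\<close>

lemma swapS_lift:
  assumes s: "sub M \<Gamma> \<Delta> \<sigma>" and A: "ty M l \<Delta> A"
  shows "swapS M i \<Delta> A \<cdot> liftS M i (extM M \<Gamma>) (A \<lhd> pM M \<Delta>) (hash \<Gamma> \<sigma>) =
    hash (extC M i \<Gamma> (A \<lhd> \<sigma>)) (liftS M i \<Gamma> A \<sigma>) \<cdot> swapS M i \<Gamma> (A \<lhd> \<sigma>)"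
proof -
  note G = sub_con(1)[OF s] and D = sub_con(2)[OF s]
  note As = ty_sub[OF s A] and l = lift_sub[OF s A, of i] and E = ext_con[OF A, of i]
  have L: "sub M (extC M i (extM M \<Gamma>) (A \<lhd> \<sigma> \<lhd> pM M \<Gamma>)) (extC M i (extM M \<Delta>) (A \<lhd> pM M \<Delta>))
      (liftS M i (extM M \<Gamma>) (A \<lhd> pM M \<Delta>) (hash \<Gamma> \<sigma>))"
    using lift_sub[OF hash_sub[OF s] ty_sub[OF pM_sub[OF D] A], of i] ty_hash[OF s A] by simp
  note sG = swapS_sub[OF As, of i] and sD = swapS_sub[OF A, of i] and h = hash_sub[OF l]
  show ?thesis
  proof (rule extM_sub_eqI[OF E comp_sub[OF sD L] comp_sub[OF h sG]])
    show "pM M (extC M i \<Delta> A) \<cdot> (swapS M i \<Delta> A \<cdot> liftS M i (extM M \<Gamma>) (A \<lhd> pM M \<Delta>) (hash \<Gamma> \<sigma>)) =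
      pM M (extC M i \<Delta> A) \<cdot> (hash (extC M i \<Gamma> (A \<lhd> \<sigma>)) (liftS M i \<Gamma> A \<sigma>) \<cdot> swapS M i \<Gamma> (A \<lhd> \<sigma>))"
      unfolding comp_assoc[OF pM_sub[OF E] sD L, symmetric] comp_assoc[OF pM_sub[OF E] h sG, symmetric]
        pM_swapS[OF A] pM_hash[OF l] comp_assoc[OF l pM_sub[OF ext_con[OF As]] sG] pM_swapS[OF As]
      by (rule s3_lift[OF s A])
  qed
qed

lemma ty_s3_lift:
  assumes s: "sub M \<Gamma> \<Delta> \<sigma>" and A: "ty M l \<Delta> A" and B: "ty M k (extC M i \<Delta> A) B"
  shows "B \<lhd> s3 M i \<Delta> A \<lhd> liftS M i (extM M \<Gamma>) (A \<lhd> pM M \<Delta>) (hash \<Gamma> \<sigma>) =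
    B \<lhd> liftS M i \<Gamma> A \<sigma> \<lhd> s3 M i \<Gamma> (A \<lhd> \<sigma>)"
proof -
  have L: "sub M (extC M i (extM M \<Gamma>) (A \<lhd> \<sigma> \<lhd> pM M \<Gamma>)) (extC M i (extM M \<Delta>) (A \<lhd> pM M \<Delta>))
      (liftS M i (extM M \<Gamma>) (A \<lhd> pM M \<Delta>) (hash \<Gamma> \<sigma>))"
    using lift_sub[OF hash_sub[OF s] ty_sub[OF pM_sub[OF sub_con(2)[OF s]] A], of i] ty_hash[OF s A] by simp
  show ?thesis
    using ty_comp[OF s3_sub[OF A] L B] ty_comp[OF lift_sub[OF s A] s3_sub[OF ty_sub[OF s A]] B] s3_lift[OF s A]
    by simp
qed

lemma lam0_sub:
  assumes s: "sub M \<Gamma> \<Delta> \<sigma>" and A: "ty M l \<Delta> A" and t: "tm M Ze l (extC M i \<Delta> A) B t"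
  shows "lam0 M i \<Delta> A B t \<unlhd> \<sigma> =
    lam0 M i \<Gamma> (A \<lhd> \<sigma>) (B \<lhd> liftS M i \<Gamma> A \<sigma>) (t \<unlhd> liftS M i \<Gamma> A \<sigma>)"
proof -
  note G = sub_con(1)[OF s] and D = sub_con(2)[OF s] and B = tm_ty[OF t]
  note As = ty_sub[OF s A] and l = lift_sub[OF s A, of i] and h = hash_sub[OF s]
  have L: "sub M (extC M i (extM M \<Gamma>) (A \<lhd> \<sigma> \<lhd> pM M \<Gamma>)) (extC M i (extM M \<Delta>) (A \<lhd> pM M \<Delta>))
      (liftS M i (extM M \<Gamma>) (A \<lhd> pM M \<Delta>) (hash \<Gamma> \<sigma>))"
    using lift_sub[OF h ty_sub[OF pM_sub[OF D] A], of i] ty_hash[OF s A] by simp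
  have body: "upc M t \<unlhd> swapS M i \<Delta> A \<unlhd> liftS M i (extM M \<Gamma>) (A \<lhd> pM M \<Delta>) (hash \<Gamma> \<sigma>) =
      upc M (t \<unlhd> liftS M i \<Gamma> A \<sigma>) \<unlhd> swapS M i \<Gamma> (A \<lhd> \<sigma>)"
    using tm_comp[OF swapS_sub[OF A] L upc_tm[OF t]] swapS_lift[OF s A]
      tm_comp[OF hash_sub[OF l] swapS_sub[OF As] upc_tm[OF t]] upc_sub[OF l t] by simp
  show ?thesis
    unfolding lam0_eq[OF A B] lam0_eq[OF As ty_sub[OF l B]]
      dn_sub_hash[OF s PI_ty[OF A B] lam0_lam_tm[OF A t]]
      lam_sub[OF h ty_sub[OF pM_sub[OF D] A] lam0_body[OF A t]] ty_hash[OF s A] ty_s3_lift[OF s A B] body ..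
qed

text \<open>\<open>upc\<close> cancels the \<open>dn\<close> inside \<open>downstar\<close>, and
  \<open>swapS\<close> after p_# is \<open>s3\<close>, the lift of p_# under the binder. What
  remains is the rule for substituting p_# into a lambda.\<close>

lemma lam0_downstar:
  assumes A: "ty M l \<Gamma> A" and t: "tm M Om l (extC M i \<Gamma> A) B t"
  shows "lam0 M i \<Gamma> A B (downstar M Om (extC M i \<Gamma> A) t) = downstar M Om \<Gamma> (lam M i \<Gamma> A B t)"
proof -
  note B = tm_ty[OF t]
  show ?thesis
    unfolding lam0_eq[OF A B] downstar_def mode.case
      upc_dn[OF B tm_sub[OF pM_sub[OF ext_con[OF A]] t]] tm_swapS[OF A t]
      lam_sub[OF pM_sub[OF ty_con[OF A]] A t] s3_eq ..
qed

end

section \<open>Erased pairing\<close>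

context tt0_model
begin

lemma pM_liftT_sub:
  assumes x: "tm M Ze l \<Gamma> A x"
  shows "sub M (extM M \<Gamma>) (extC M i \<Gamma> A) (spair M i (pM M \<Gamma>) (liftT M i \<Gamma> x))"
  by (rule spair_sub[OF tm_ty[OF x] pM_sub[OF tm_con[OF x]] liftT_tm[OF x]])

lemma ty_s3_spair:
  assumes A: "ty M l \<Gamma> A" and B: "ty M k (extC M i \<Gamma> A) B"
    and y: "tm M i l (extM M \<Gamma>) (A \<lhd> pM M \<Gamma>) y"
  shows "B \<lhd> s3 M i \<Gamma> A \<lhd> spair M i (sid M (extM M \<Gamma>)) y = B \<lhd> spair M i (pM M \<Gamma>) y"
  using ty_comp[OF s3_sub[OF A] sid_spair_sub[OF y] B] s3_spair[OF A y] by simp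

text \<open>For i = \<omega> the erased \<open>x\<close> cannot be substituted for the last variable
  of \<open>B\<close> over \<Gamma> itself, only over \<Gamma> |> #, where \<open>liftT\<close>
  views it at mode i. The type \<open>C\<close> of the second component is therefore specified only
  after weakening by p_#.\<close>

lemma pair0_tpair_tm:
  assumes x: "tm M Ze l \<Gamma> A x" and B: "ty M l (extC M i \<Gamma> A) B" and b: "tm M Ze l \<Gamma> C b"
    and C: "C \<lhd> pM M \<Gamma> = B \<lhd> spair M i (pM M \<Gamma>) (liftT M i \<Gamma> x)"
  shows "tm M Om l (extM M \<Gamma>)
      (B \<lhd> s3 M i \<Gamma> A \<lhd> spair M i (sid M (extM M \<Gamma>)) (liftT M i \<Gamma> x)) (upc M b)"
    and "tm M Om l (extM M \<Gamma>) (SG M i \<Gamma> A B \<lhd> pM M \<Gamma>)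
      (tpair M i (extM M \<Gamma>) (A \<lhd> pM M \<Gamma>) (B \<lhd> s3 M i \<Gamma> A) (liftT M i \<Gamma> x) (upc M b))"
proof -
  note A = tm_ty[OF x]
  show u: "tm M Om l (extM M \<Gamma>)
      (B \<lhd> s3 M i \<Gamma> A \<lhd> spair M i (sid M (extM M \<Gamma>)) (liftT M i \<Gamma> x)) (upc M b)"
    using upc_tm[OF b] C ty_s3_spair[OF A B liftT_tm[OF x]] by simp
  show "tm M Om l (extM M \<Gamma>) (SG M i \<Gamma> A B \<lhd> pM M \<Gamma>)
      (tpair M i (extM M \<Gamma>) (A \<lhd> pM M \<Gamma>) (B \<lhd> s3 M i \<Gamma> A) (liftT M i \<Gamma> x) (upc M b))"
    using tpair_tm[OF ty_sub[OF s3_sub[OF A] B] liftT_tm[OF x] u] PI_pM(2)[OF A B] by simp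
qed

lemma pair0_tm:
  assumes "tm M Ze l \<Gamma> A x" "ty M l (extC M i \<Gamma> A) B" "tm M Ze l \<Gamma> C b"
    "C \<lhd> pM M \<Gamma> = B \<lhd> spair M i (pM M \<Gamma>) (liftT M i \<Gamma> x)"
  shows "tm M Ze l \<Gamma> (SG M i \<Gamma> A B) (pair0 M i \<Gamma> A B x b)"
  unfolding pair0_def by (rule dn_tm[OF SG_ty[OF tm_ty[OF assms(1)] assms(2)] pair0_tpair_tm(2)[OF assms]])

text \<open>Injectivity of \<open>dn\<close>, of the pairing and of \<open>liftT\<close>. The types
  \<open>C\<close> and \<open>C'\<close> may differ: that \<open>b\<close> and \<open>b'\<close>
  agree is read off from \<open>upc M b = upc M b'\<close> alone.\<close>

lemma pair0_inj:
  assumes x: "tm M Ze l \<Gamma> A x" and x': "tm M Ze l \<Gamma> A x'" and B: "ty M l (extC M i \<Gamma> A) B"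
    and b: "tm M Ze l \<Gamma> C b" "C \<lhd> pM M \<Gamma> = B \<lhd> spair M i (pM M \<Gamma>) (liftT M i \<Gamma> x)"
    and b': "tm M Ze l \<Gamma> C' b'" "C' \<lhd> pM M \<Gamma> = B \<lhd> spair M i (pM M \<Gamma>) (liftT M i \<Gamma> x')"
    and e: "pair0 M i \<Gamma> A B x b = pair0 M i \<Gamma> A B x' b'"
  shows "x = x' \<and> b = b'"
proof -
  note A = tm_ty[OF x] and B' = ty_sub[OF s3_sub[OF tm_ty[OF x]] B]
  have "tpair M i (extM M \<Gamma>) (A \<lhd> pM M \<Gamma>) (B \<lhd> s3 M i \<Gamma> A) (liftT M i \<Gamma> x) (upc M b) =
    tpair M i (extM M \<Gamma>) (A \<lhd> pM M \<Gamma>) (B \<lhd> s3 M i \<Gamma> A) (liftT M i \<Gamma> x') (upc M b')"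
    by (rule dn_inj[OF SG_ty[OF A B] pair0_tpair_tm(2)[OF x B b] pair0_tpair_tm(2)[OF x' B b'] e[unfolded pair0_def]])
  then have "(liftT M i \<Gamma> x, upc M b) = (liftT M i \<Gamma> x', upc M b')"
    using proj_tpair[OF B' liftT_tm[OF x] pair0_tpair_tm(1)[OF x B b]]
      proj_tpair[OF B' liftT_tm[OF x'] pair0_tpair_tm(1)[OF x' B b']] by metis
  then have l: "liftT M i \<Gamma> x = liftT M i \<Gamma> x'" and u: "upc M b = upc M b'" by auto
  have "x = x'" by (rule liftT_inj[OF x x' l])
  moreover have "b = b'" using dn_upc[OF b(1)] dn_upc[OF b'(1)] u by metis
  ultimately show ?thesis by blast
qed

lemma pair0_sub:
  assumes s: "sub M \<Gamma> \<Delta> \<sigma>" and x: "tm M Ze l \<Delta> A x" and B: "ty M l (extC M i \<Delta> A) B"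
    and b: "tm M Ze l \<Delta> C b" "C \<lhd> pM M \<Delta> = B \<lhd> spair M i (pM M \<Delta>) (liftT M i \<Delta> x)"
  shows "pair0 M i \<Delta> A B x b \<unlhd> \<sigma> =
    pair0 M i \<Gamma> (A \<lhd> \<sigma>) (B \<lhd> liftS M i \<Gamma> A \<sigma>) (x \<unlhd> \<sigma>) (b \<unlhd> \<sigma>)"
proof -
  note A = tm_ty[OF x] and h = hash_sub[OF s]
  show ?thesis
    unfolding pair0_def dn_sub_hash[OF s SG_ty[OF A B] pair0_tpair_tm(2)[OF x B b]]
      tpair_sub[OF h ty_sub[OF s3_sub[OF A] B] liftT_tm[OF x] pair0_tpair_tm(1)[OF x B b]]
      ty_hash[OF s A] ty_s3_lift[OF s A B] liftT_sub[OF s x] upc_sub[OF s b(1)] ..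
qed

text \<open>The type condition of the erased pairing in the case where the first component is the
  erasure of a term of mode \<open>i\<close>.\<close>

lemma ty_pM_spair_downstar:
  assumes x: "tm M i l \<Gamma> A x" and B: "ty M k (extC M i \<Gamma> A) B"
  shows "B \<lhd> spair M i (sid M \<Gamma>) x \<lhd> pM M \<Gamma> = B \<lhd> spair M i (pM M \<Gamma>) (liftT M i \<Gamma> (downstar M i \<Gamma> x))"
proof -
  note A = tm_ty[OF x] and G = tm_con[OF x]
  have x': "tm M i l \<Gamma> (A \<lhd> sid M \<Gamma>) x" using x ty_sid[OF A] by simp
  show ?thesis
    unfolding ty_comp[OF sid_spair_sub[OF x] pM_sub[OF G] B, symmetric] spair_comp[OF A sid_sub[OF G] x' pM_sub[OF G]]
      sid_comp[OF pM_sub[OF G]] liftT_downstar[OF x] ..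
qed

lemma pair0_downstar:
  assumes B: "ty M l (extC M i \<Gamma> A) B" and x: "tm M i l \<Gamma> A x"
    and b: "tm M Om l \<Gamma> (B \<lhd> spair M i (sid M \<Gamma>) x) b"
  shows "pair0 M i \<Gamma> A B (downstar M i \<Gamma> x) (downstar M Om \<Gamma> b) = downstar M Om \<Gamma> (tpair M i \<Gamma> A B x b)"
proof -
  note A = tm_ty[OF x] and G = tm_con[OF x]
  have "upc M (downstar M Om \<Gamma> b) = b \<unlhd> pM M \<Gamma>"
    using liftT_downstar[OF b] by (simp add: liftT_def)
  then show ?thesis
    unfolding pair0_def liftT_downstar[OF x] by (simp add: downstar_def tpair_sub[OF pM_sub[OF G] B x b] s3_eq)
qed

text \<open>The type condition of the erased pairing in the zeroed model, whose codomains live over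
  \<Gamma> |>_0 A: the comparison turns the lifted \<open>x\<close> back into \<open>x\<close>
  weakened by p_#.\<close>

lemma ty_wS_pM_spair:
  assumes x: "tm M Ze l \<Gamma> A x" and B: "ty M k (extC M Ze \<Gamma> A) B"
  shows "B \<lhd> spair M Ze (sid M \<Gamma>) x \<lhd> pM M \<Gamma> = B \<lhd> wS M i \<Gamma> A \<lhd> spair M i (pM M \<Gamma>) (liftT M i \<Gamma> x)"
proof -
  note A = tm_ty[OF x] and G = tm_con[OF x]
  have x': "tm M Ze l \<Gamma> (A \<lhd> sid M \<Gamma>) x" using x ty_sid[OF A] by simp
  show ?thesis
    unfolding ty_comp[OF sid_spair_sub[OF x] pM_sub[OF G] B, symmetric] spair_comp[OF A sid_sub[OF G] x' pM_sub[OF G]]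
      sid_comp[OF pM_sub[OF G]] ty_comp[OF wS_sub[OF A] pM_liftT_sub[OF x] B, symmetric]
      wS_spair[OF A pM_sub[OF G] liftT_tm[OF x]] downstar_liftT[OF x] ..
qed

lemma pair0_surj:
  assumes A: "ty M l \<Gamma> A" and B: "ty M l (extC M Ze \<Gamma> A) B" and s: "tm M Ze l \<Gamma> (SG M i \<Gamma> A (B \<lhd> wS M i \<Gamma> A)) s"
  obtains x b where "tm M Ze l \<Gamma> A x" "tm M Ze l \<Gamma> (B \<lhd> spair M Ze (sid M \<Gamma>) x) b"
    "pair0 M i \<Gamma> A (B \<lhd> wS M i \<Gamma> A) x b = s"
proof -
  note G = ty_con[OF A] and A' = ty_sub[OF pM_sub[OF ty_con[OF A]] A] and Bw = ty_sub[OF wS_sub[OF A, of i] B]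
  note B' = ty_sub[OF s3_sub[OF A] Bw]
  have us: "tm M Om l (extM M \<Gamma>) (SG M i (extM M \<Gamma>) (A \<lhd> pM M \<Gamma>) (B \<lhd> wS M i \<Gamma> A \<lhd> s3 M i \<Gamma> A)) (upc M s)"
    using upc_tm[OF s] PI_pM(2)[OF A Bw] by simp
  define y where "y = fst (proj M i (extM M \<Gamma>) (A \<lhd> pM M \<Gamma>) (B \<lhd> wS M i \<Gamma> A \<lhd> s3 M i \<Gamma> A) (upc M s))"
  define c where "c = snd (proj M i (extM M \<Gamma>) (A \<lhd> pM M \<Gamma>) (B \<lhd> wS M i \<Gamma> A \<lhd> s3 M i \<Gamma> A) (upc M s))"
  have y: "tm M i l (extM M \<Gamma>) (A \<lhd> pM M \<Gamma>) y" unfolding y_def by (rule fst_proj_tm[OF A' B' us])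
  \<comment> \<open>The first projection has mode \<open>i\<close> over \<Gamma> |> #, hence is the
    lift of an erased term over \<Gamma>. The type of the second projection is then weakened by p_#,
    so \<open>dn\<close> applies to it.\<close>
  obtain x where x: "tm M Ze l \<Gamma> A x" "liftT M i \<Gamma> x = y" by (rule liftT_surj[OF A y])
  have c: "tm M Om l (extM M \<Gamma>) (B \<lhd> spair M Ze (sid M \<Gamma>) x \<lhd> pM M \<Gamma>) c"
    using snd_proj_tm[OF A' B' us] ty_s3_spair[OF A Bw y] ty_wS_pM_spair[OF x(1) B, of i] x(2)
    by (simp add: y_def c_def)
  note Bx = ty_sub[OF sid_spair_sub[OF x(1)] B]
  have "pair0 M i \<Gamma> A (B \<lhd> wS M i \<Gamma> A) x (dn M c) = s"
    unfolding pair0_def upc_dn[OF Bx c] x(2)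
    using tpair_proj[OF A' B' us] dn_upc[OF s] by (simp add: y_def c_def)
  with that x(1) dn_tm[OF Bx c] show ?thesis by blast
qed

end

section \<open>The zeroed model\<close>

text \<open>The fields \<open>app\<close> and \<open>proj\<close> are absent: they are definite
  descriptions, evaluated in \<open>zero_app\<close> and \<open>zero_proj\<close>.\<close>

lemma zero_model_sel:
  "CON (zero_model M) = CON M" "SUB (zero_model M) = SUB M" "sid (zero_model M) = sid M"
  "scomp (zero_model M) = scomp M" "emp (zero_model M) = emp M" "epsS (zero_model M) = epsS M"
  "TY (zero_model M) = TY M" "tsub (zero_model M) = tsub M" "TM (zero_model M) i = TM M Ze"
  "msub (zero_model M) = msub M" "MK (zero_model M) \<Gamma> = True" "extC (zero_model M) i = extC M Ze"
  "pp (zero_model M) i = pp M Ze" "qq (zero_model M) i = qq M Ze" "spair (zero_model M) i = spair M Ze"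
  "extM (zero_model M) \<Gamma> = \<Gamma>" "pM (zero_model M) = sid M" "spairM (zero_model M) \<sigma> = \<sigma>"
  "dn (zero_model M) a = a" "upc (zero_model M) a = a"
  "PI (zero_model M) i \<Gamma> A B = PI M i \<Gamma> A (tsub M B (wS M i \<Gamma> A))"
  "SG (zero_model M) i \<Gamma> A B = SG M i \<Gamma> A (tsub M B (wS M i \<Gamma> A))"
  "lam (zero_model M) i \<Gamma> A B t = lam0 M i \<Gamma> A (tsub M B (wS M i \<Gamma> A)) (msub M t (wS M i \<Gamma> A))"
  "tpair (zero_model M) i \<Gamma> A B x b = pair0 M i \<Gamma> A (tsub M B (wS M i \<Gamma> A)) x b"
  "UU (zero_model M) = UU M" "EL (zero_model M) = EL M" "codeU (zero_model M) = codeU M"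
  by (simp_all add: zero_model_def)

lemma zero_model_judgements:
  "sub (zero_model M) = sub M" "ty (zero_model M) = ty M" "tm (zero_model M) i = tm M Ze"
  by (auto simp: judgement_defs zero_model_sel fun_eq_iff)

lemma zero_model_liftS: "liftS (zero_model M) i = liftS M Ze"
  by (simp add: liftS_def zero_model_sel fun_eq_iff)

lemmas zero_model_simps = zero_model_sel zero_model_judgements zero_model_liftS

context tt0_model
begin

text \<open>Uniqueness for the description: \<open>lam0\<close> is injective, and so is restriction
  along the comparison on erased terms.\<close>

lemma zero_app:
  assumes A: "ty M l \<Gamma> A" and u: "tm M Ze l (extC M Ze \<Gamma> A) B u"
    and e: "lam0 M i \<Gamma> A (B \<lhd> wS M i \<Gamma> A) (u \<unlhd> wS M i \<Gamma> A) = t"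
  shows "app (zero_model M) i \<Gamma> A B t = u"
proof -
  have "v = u" if "v \<in> TM M Ze (extC M Ze \<Gamma> A) B \<and> lam0 M i \<Gamma> A (B \<lhd> wS M i \<Gamma> A) (v \<unlhd> wS M i \<Gamma> A) = t" for v
  proof -
    have v: "tm M Ze l (extC M Ze \<Gamma> A) B v" using that tm_ty[OF u] by (simp add: judgement_defs)
    note w = wS_sub[OF A, of i]
    have "v \<unlhd> wS M i \<Gamma> A = u \<unlhd> wS M i \<Gamma> A"
      by (rule lam0_inj[OF A tm_sub[OF w v] tm_sub[OF w u]]) (use that e in simp)
    then show ?thesis by (rule tm_wS_inj[OF A v u])
  qed
  then show ?thesis
    using u e by (auto simp: zero_model_def tm_def intro!: the_equality)
qed

text \<open>Existence for the description in two stages: \<open>lam0_surj\<close> yields a body over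
  \<Gamma> |>_i A, and \<open>tm_wS_surj\<close> moves it to \<Gamma> |>_0 A.\<close>

lemma zero_app_PI:
  assumes A: "ty M l \<Gamma> A" and B: "ty M l (extC M Ze \<Gamma> A) B" and t: "tm M Ze l \<Gamma> (PI M i \<Gamma> A (B \<lhd> wS M i \<Gamma> A)) t"
  defines "u \<equiv> app (zero_model M) i \<Gamma> A B t"
  shows "tm M Ze l (extC M Ze \<Gamma> A) B u" "lam0 M i \<Gamma> A (B \<lhd> wS M i \<Gamma> A) (u \<unlhd> wS M i \<Gamma> A) = t"
proof -
  obtain v where v: "tm M Ze l (extC M i \<Gamma> A) (B \<lhd> wS M i \<Gamma> A) v" "lam0 M i \<Gamma> A (B \<lhd> wS M i \<Gamma> A) v = t"
    by (rule lam0_surj[OF A ty_sub[OF wS_sub[OF A] B] t])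
  obtain w where w: "tm M Ze l (extC M Ze \<Gamma> A) B w" "w \<unlhd> wS M i \<Gamma> A = v"
    by (rule tm_wS_surj[OF A B v(1)])
  with v(2) have e: "lam0 M i \<Gamma> A (B \<lhd> wS M i \<Gamma> A) (w \<unlhd> wS M i \<Gamma> A) = t" by simp
  from zero_app[OF A w(1) e] have "u = w" unfolding u_def .
  with w(1) e show "tm M Ze l (extC M Ze \<Gamma> A) B u" "lam0 M i \<Gamma> A (B \<lhd> wS M i \<Gamma> A) (u \<unlhd> wS M i \<Gamma> A) = t"
    by simp_all
qed

lemma zero_proj:
  assumes x: "tm M Ze l \<Gamma> A x" and B: "ty M l (extC M Ze \<Gamma> A) B" and b: "tm M Ze l \<Gamma> (B \<lhd> spair M Ze (sid M \<Gamma>) x) b"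
    and e: "pair0 M i \<Gamma> A (B \<lhd> wS M i \<Gamma> A) x b = t"
  shows "proj (zero_model M) i \<Gamma> A B t = (x, b)"
proof -
  note A = tm_ty[OF x]
  have "yc = (x, b)" if "fst yc \<in> TM M Ze \<Gamma> A \<and> snd yc \<in> TM M Ze \<Gamma> (B \<lhd> spair M Ze (sid M \<Gamma>) (fst yc)) \<and>
      pair0 M i \<Gamma> A (B \<lhd> wS M i \<Gamma> A) (fst yc) (snd yc) = t" for yc
  proof -
    have y: "tm M Ze l \<Gamma> A (fst yc)" using that A by (simp add: judgement_defs)
    have c: "tm M Ze l \<Gamma> (B \<lhd> spair M Ze (sid M \<Gamma>) (fst yc)) (snd yc)"
      using that ty_sub[OF sid_spair_sub[OF y] B] by (simp add: judgement_defs)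
    have "x = fst yc \<and> b = snd yc"
      by (rule pair0_inj[where i = i, OF x y ty_sub[OF wS_sub[OF A] B] b ty_wS_pM_spair[OF x B] c ty_wS_pM_spair[OF y B]])
        (use that e in simp)
    then show ?thesis by (simp add: prod_eq_iff)
  qed
  then show ?thesis
    using x b e by (auto simp: zero_model_def tm_def intro!: the_equality)
qed

lemma zero_proj_SG:
  assumes A: "ty M l \<Gamma> A" and B: "ty M l (extC M Ze \<Gamma> A) B" and t: "tm M Ze l \<Gamma> (SG M i \<Gamma> A (B \<lhd> wS M i \<Gamma> A)) t"
  defines "p \<equiv> proj (zero_model M) i \<Gamma> A B t"
  shows "tm M Ze l \<Gamma> A (fst p)" "tm M Ze l \<Gamma> (B \<lhd> spair M Ze (sid M \<Gamma>) (fst p)) (snd p)"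
    "pair0 M i \<Gamma> A (B \<lhd> wS M i \<Gamma> A) (fst p) (snd p) = t"
proof -
  obtain x b where *: "tm M Ze l \<Gamma> A x" "tm M Ze l \<Gamma> (B \<lhd> spair M Ze (sid M \<Gamma>) x) b"
    "pair0 M i \<Gamma> A (B \<lhd> wS M i \<Gamma> A) x b = t"
    by (rule pair0_surj[OF A B t])
  have "p = (x, b)" unfolding p_def by (rule zero_proj[OF *(1) B *(2,3)])
  with * show "tm M Ze l \<Gamma> A (fst p)" "tm M Ze l \<Gamma> (B \<lhd> spair M Ze (sid M \<Gamma>) (fst p)) (snd p)"
    "pair0 M i \<Gamma> A (B \<lhd> wS M i \<Gamma> A) (fst p) (snd p) = t" by simp_all
qed

lemma ty_wS_lift:
  assumes s: "sub M \<Gamma> \<Delta> \<sigma>" and A: "ty M l \<Delta> A" and B: "ty M k (extC M Ze \<Delta> A) B"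
  shows "B \<lhd> wS M i \<Delta> A \<lhd> liftS M i \<Gamma> A \<sigma> = B \<lhd> liftS M Ze \<Gamma> A \<sigma> \<lhd> wS M i \<Gamma> (A \<lhd> \<sigma>)"
  using ty_comp[OF wS_sub[OF A] lift_sub[OF s A] B] ty_comp[OF lift_sub[OF s A] wS_sub[OF ty_sub[OF s A]] B]
    wS_lift[OF s A] by simp

lemma tm_wS_lift:
  assumes s: "sub M \<Gamma> \<Delta> \<sigma>" and A: "ty M l \<Delta> A" and t: "tm M j k (extC M Ze \<Delta> A) B t"
  shows "t \<unlhd> wS M i \<Delta> A \<unlhd> liftS M i \<Gamma> A \<sigma> = t \<unlhd> liftS M Ze \<Gamma> A \<sigma> \<unlhd> wS M i \<Gamma> (A \<lhd> \<sigma>)"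
  using tm_comp[OF wS_sub[OF A] lift_sub[OF s A] t] tm_comp[OF lift_sub[OF s A] wS_sub[OF ty_sub[OF s A]] t]
    wS_lift[OF s A] by simp

lemma zero_lam_sub:
  assumes s: "sub M \<Gamma> \<Delta> \<sigma>" and A: "ty M l \<Delta> A" and t: "tm M Ze l (extC M Ze \<Delta> A) B t"
  shows "lam0 M i \<Delta> A (B \<lhd> wS M i \<Delta> A) (t \<unlhd> wS M i \<Delta> A) \<unlhd> \<sigma> =
    lam0 M i \<Gamma> (A \<lhd> \<sigma>) (B \<lhd> liftS M Ze \<Gamma> A \<sigma> \<lhd> wS M i \<Gamma> (A \<lhd> \<sigma>)) (t \<unlhd> liftS M Ze \<Gamma> A \<sigma> \<unlhd> wS M i \<Gamma> (A \<lhd> \<sigma>))"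
  unfolding lam0_sub[OF s A tm_sub[OF wS_sub[OF A] t]] ty_wS_lift[OF s A tm_ty[OF t]] tm_wS_lift[OF s A t] ..

lemma zero_tpair_sub:
  assumes s: "sub M \<Gamma> \<Delta> \<sigma>" and B: "ty M l (extC M Ze \<Delta> A) B" and x: "tm M Ze l \<Delta> A x"
    and b: "tm M Ze l \<Delta> (B \<lhd> spair M Ze (sid M \<Delta>) x) b"
  shows "pair0 M i \<Delta> A (B \<lhd> wS M i \<Delta> A) x b \<unlhd> \<sigma> =
    pair0 M i \<Gamma> (A \<lhd> \<sigma>) (B \<lhd> liftS M Ze \<Gamma> A \<sigma> \<lhd> wS M i \<Gamma> (A \<lhd> \<sigma>)) (x \<unlhd> \<sigma>) (b \<unlhd> \<sigma>)"
  unfolding pair0_sub[OF s x ty_sub[OF wS_sub[OF tm_ty[OF x]] B] b ty_wS_pM_spair[OF x B]] ty_wS_lift[OF s tm_ty[OF x] B] ..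

lemma zero_lam_tm:
  assumes A: "ty M l \<Gamma> A" and t: "tm M Ze l (extC M Ze \<Gamma> A) B t"
  shows "tm M Ze l \<Gamma> (PI M i \<Gamma> A (B \<lhd> wS M i \<Gamma> A)) (lam0 M i \<Gamma> A (B \<lhd> wS M i \<Gamma> A) (t \<unlhd> wS M i \<Gamma> A))"
  by (rule lam0_tm[OF A tm_sub[OF wS_sub[OF A] t]])

lemma zero_tpair_tm:
  assumes B: "ty M l (extC M Ze \<Gamma> A) B" and x: "tm M Ze l \<Gamma> A x"
    and b: "tm M Ze l \<Gamma> (B \<lhd> spair M Ze (sid M \<Gamma>) x) b"
  shows "tm M Ze l \<Gamma> (SG M i \<Gamma> A (B \<lhd> wS M i \<Gamma> A)) (pair0 M i \<Gamma> A (B \<lhd> wS M i \<Gamma> A) x b)"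
  by (rule pair0_tm[OF x ty_sub[OF wS_sub[OF tm_ty[OF x]] B] b ty_wS_pM_spair[OF x B]])

lemma zero_PI_sub:
  assumes s: "sub M \<Gamma> \<Delta> \<sigma>" and A: "ty M l \<Delta> A" and B: "ty M l (extC M Ze \<Delta> A) B"
  shows "PI M i \<Delta> A (B \<lhd> wS M i \<Delta> A) \<lhd> \<sigma> =
      PI M i \<Gamma> (A \<lhd> \<sigma>) (B \<lhd> liftS M Ze \<Gamma> A \<sigma> \<lhd> wS M i \<Gamma> (A \<lhd> \<sigma>))"
    and "SG M i \<Delta> A (B \<lhd> wS M i \<Delta> A) \<lhd> \<sigma> =
      SG M i \<Gamma> (A \<lhd> \<sigma>) (B \<lhd> liftS M Ze \<Gamma> A \<sigma> \<lhd> wS M i \<Gamma> (A \<lhd> \<sigma>))"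
  unfolding PI_sub[OF s A ty_sub[OF wS_sub[OF A] B]] SG_sub[OF s A ty_sub[OF wS_sub[OF A] B]]
    ty_wS_lift[OF s A B] by simp_all

lemma zero_PI_ty:
  assumes A: "ty M l \<Gamma> A" and B: "ty M l (extC M Ze \<Gamma> A) B"
  shows "ty M l \<Gamma> (PI M i \<Gamma> A (B \<lhd> wS M i \<Gamma> A))" "ty M l \<Gamma> (SG M i \<Gamma> A (B \<lhd> wS M i \<Gamma> A))"
  by (rule PI_ty[OF A ty_sub[OF wS_sub[OF A] B]] SG_ty[OF A ty_sub[OF wS_sub[OF A] B]])+

text \<open>Structural rules are those of \<open>M\<close> at mode 0, and the rules for the marker
  collapse because p_# and the coercions are identities. The work lies in \<Pi> and \<Sigma>,
  prepared above.\<close>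

lemma zero_model_tt0_model: "tt0_model (zero_model M)"
  by (unfold_locales, unfold zero_model_simps)
    ((rule sid_sub comp_sub sid_comp comp_sid comp_assoc emp_con eps_sub eps_unique ty_sub ty_sid ty_comp
        tm_sub tm_sid tm_comp pp_sub qq_tm spair_sub pp_spair qq_spair spair_eta zero_PI_ty zero_lam_tm
        zero_app[OF _ _ refl] zero_app_PI zero_tpair_tm zero_proj[OF _ _ _ refl] zero_proj_SG zero_PI_sub zero_lam_sub
        zero_tpair_sub UU_ty EL_ty code_EL code_tm EL_code UU_sub EL_sub TrueI; assumption) |
      simp add: sid_sub sid_comp comp_sid ty_sid[OF tm_ty] ty_sid; fail)+

end

section \<open>Relabelling of contexts\<close>

definition relabel :: "('c,'s,'t,'m) tt0 \<Rightarrow> 'c set \<Rightarrow> ('c \<Rightarrow> 'c) \<Rightarrow> 'c \<Rightarrow> (mode \<Rightarrow> 'c \<Rightarrow> 't \<Rightarrow> 'c) \<Rightarrow> ('c \<Rightarrow> 'c) \<Rightarrow> ('c,'s,'t,'m) tt0" where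
  "relabel M C d e x m = M\<lparr>
     CON := C, SUB := (\<lambda>\<Gamma> \<Delta>. SUB M (d \<Gamma>) (d \<Delta>)), sid := (\<lambda>\<Gamma>. sid M (d \<Gamma>)),
     emp := e, epsS := (\<lambda>\<Gamma>. epsS M (d \<Gamma>)),
     TY := (\<lambda>l \<Gamma>. TY M l (d \<Gamma>)), TM := (\<lambda>i \<Gamma>. TM M i (d \<Gamma>)), MK := (\<lambda>\<Gamma>. MK M (d \<Gamma>)),
     extC := x, pp := (\<lambda>i \<Gamma>. pp M i (d \<Gamma>)), qq := (\<lambda>i \<Gamma>. qq M i (d \<Gamma>)),
     extM := m, pM := (\<lambda>\<Gamma>. pM M (d \<Gamma>)),
     PI := (\<lambda>i \<Gamma>. PI M i (d \<Gamma>)), SG := (\<lambda>i \<Gamma>. SG M i (d \<Gamma>)),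
     lam := (\<lambda>i \<Gamma>. lam M i (d \<Gamma>)), app := (\<lambda>i \<Gamma>. app M i (d \<Gamma>)),
     tpair := (\<lambda>i \<Gamma>. tpair M i (d \<Gamma>)), proj := (\<lambda>i \<Gamma>. proj M i (d \<Gamma>)),
     UU := (\<lambda>l \<Gamma>. UU M l (d \<Gamma>))\<rparr>"

locale relabelling = tt0_model M for M :: "('c,'s,'t,'m) tt0" (structure) +
  fixes C :: "'c set" and d :: "'c \<Rightarrow> 'c" and e :: 'c and x :: "mode \<Rightarrow> 'c \<Rightarrow> 't \<Rightarrow> 'c" and m :: "'c \<Rightarrow> 'c"
  assumes d_con: "\<Gamma> \<in> C \<Longrightarrow> d \<Gamma> \<in> CON M"
    and e: "e \<in> C" "d e = emp M"
    and x: "\<Gamma> \<in> C \<Longrightarrow> ty M l (d \<Gamma>) A \<Longrightarrow> x i \<Gamma> A \<in> C" "\<Gamma> \<in> C \<Longrightarrow> ty M l (d \<Gamma>) A \<Longrightarrow> d (x i \<Gamma> A) = extC M i (d \<Gamma>) A"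
    and m: "\<Gamma> \<in> C \<Longrightarrow> m \<Gamma> \<in> C" "\<Gamma> \<in> C \<Longrightarrow> d (m \<Gamma>) = extM M (d \<Gamma>)"
begin

abbreviation R where "R \<equiv> relabel M C d e x m"

lemma relabel_sel:
  "CON R = C" "SUB R \<Gamma> \<Delta> = SUB M (d \<Gamma>) (d \<Delta>)" "sid R \<Gamma> = sid M (d \<Gamma>)" "scomp R = scomp M" "emp R = e"
  "epsS R \<Gamma> = epsS M (d \<Gamma>)" "TY R l \<Gamma> = TY M l (d \<Gamma>)" "tsub R = tsub M" "TM R i \<Gamma> = TM M i (d \<Gamma>)"
  "msub R = msub M" "MK R \<Gamma> = MK M (d \<Gamma>)" "extC R = x" "pp R i \<Gamma> = pp M i (d \<Gamma>)" "qq R i \<Gamma> = qq M i (d \<Gamma>)"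
  "spair R = spair M" "extM R = m" "pM R \<Gamma> = pM M (d \<Gamma>)" "spairM R = spairM M" "dn R = dn M" "upc R = upc M"
  "PI R i \<Gamma> = PI M i (d \<Gamma>)" "SG R i \<Gamma> = SG M i (d \<Gamma>)" "lam R i \<Gamma> = lam M i (d \<Gamma>)" "app R i \<Gamma> = app M i (d \<Gamma>)"
  "tpair R i \<Gamma> = tpair M i (d \<Gamma>)" "proj R i \<Gamma> = proj M i (d \<Gamma>)" "UU R l \<Gamma> = UU M l (d \<Gamma>)" "EL R = EL M" "codeU R = codeU M"
  by (simp_all add: relabel_def)

lemma relabel_judgements:
  "sub R \<Gamma> \<Delta> \<sigma> \<longleftrightarrow> \<Gamma> \<in> C \<and> \<Delta> \<in> C \<and> sub M (d \<Gamma>) (d \<Delta>) \<sigma>"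
  "ty R l \<Gamma> A \<longleftrightarrow> \<Gamma> \<in> C \<and> ty M l (d \<Gamma>) A"
  "tm R i l \<Gamma> A a \<longleftrightarrow> \<Gamma> \<in> C \<and> tm M i l (d \<Gamma>) A a"
  by (auto simp: judgement_defs relabel_sel d_con)

lemma relabel_liftS: "liftS R i \<Gamma> = liftS M i (d \<Gamma>)"
  by (simp add: liftS_def relabel_sel fun_eq_iff)

lemma relabel_tt0_model: "tt0_model R"
proof -
  note simps = relabel_sel relabel_judgements relabel_liftS
  show ?thesis
    by (unfold_locales, unfold simps)
      (use e x m d_con x(2)[OF _ tm_ty] in \<open>auto intro: sid_sub comp_sub sid_comp comp_sid comp_assoc emp_con eps_sub eps_unique ty_sub ty_sid ty_comp
        tm_sub tm_sid tm_comp mk_sub pp_sub qq_tm spair_sub pp_spair qq_spair spair_eta pM_sub extM_mk spairM_sub pM_spairM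
        spairM_eta dn_tm upc_dn upc_tm dn_upc dn_sub PI_ty SG_ty lam_tm app_lam app_tm lam_app tpair_tm proj_tpair
        fst_proj_tm snd_proj_tm tpair_proj PI_sub SG_sub lam_sub tpair_sub UU_ty EL_ty code_EL code_tm EL_code UU_sub
        EL_sub\<close>)
qed

text \<open>Decoding is a strict morphism from the relabelled model to \<open>M\<close>. The
  composite is an endomorphism of \<open>M\<close>, hence the identity, which makes the context part
  of \<open>F\<close> a section of \<open>d\<close>.\<close>

lemma forget_morph:
  assumes "tt0_morph M R F"
  shows "tt0_morph M M (F\<lparr>hC := d \<circ> hC F\<rparr>)"
proof -
  interpret F: tt0_morph M R F by (rule assms)
  note simps = relabel_sel relabel_judgements
  have ext: "d (x i (hC F \<Gamma>) (hT F A)) = extC M i (d (hC F \<Gamma>)) (hT F A)" if "ty M l \<Gamma> A" for i l \<Gamma> A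
    using F.hT_ty[OF that] by (auto simp: simps intro: x(2))
  show ?thesis
    by unfold_locales
      (use F.hC_con F.hS_sub F.hT_ty F.hM_tm F.hC_mk F.hS_sid F.hS_comp F.hC_emp F.hS_eps F.hT_sub F.hM_sub F.hC_ext F.hS_pp F.hM_qq
        F.hS_spair F.hC_extM F.hS_pM F.hS_spairM F.hM_dn F.hM_upc F.hT_PI F.hT_SG F.hM_lam F.hM_app F.hM_tpair F.hM_proj
        F.hT_UU F.hT_EL F.hM_code e x m d_con ext in \<open>simp_all add: simps\<close>)
qed

end

section \<open>Initial models\<close>

lemma (in tt0_model) id_morph: "tt0_morph M M \<lparr>hC = id, hS = id, hT = id, hM = id\<rparr>"
  by unfold_locales (simp_all add: prod.map_id0)

locale initial_tt0_model =
  fixes M :: "('c,'s,'t,'m) tt0" (structure)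
  assumes initial: "is_initial M"

sublocale initial_tt0_model \<subseteq> tt0_model M
  using initial is_model_imp_tt0_model by (auto simp: is_initial_def)

context initial_tt0_model
begin

lemma morph_ex:
  assumes "tt0_model N"
  obtains F where "tt0_morph M N F"
  using initial tt0_model_imp_is_model[OF assms] is_morph_imp_tt0_morph[OF tt0_model_axioms]
  unfolding is_initial_def by blast

lemma endo_id:
  assumes "tt0_morph M M F"
  shows "\<Gamma> \<in> CON M \<Longrightarrow> hC F \<Gamma> = \<Gamma>" "sub M \<Gamma> \<Delta> \<sigma> \<Longrightarrow> hS F \<sigma> = \<sigma>"
    "ty M l \<Gamma> A \<Longrightarrow> hT F A = A" "tm M i l \<Gamma> A a \<Longrightarrow> hM F a = a"
proof -
  have "morph_eq M F \<lparr>hC = id, hS = id, hT = id, hM = id\<rparr>"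
    using initial tt0_model_imp_is_model[OF tt0_model_axioms] tt0_morph_imp_is_morph[OF assms]
      tt0_morph_imp_is_morph[OF id_morph] unfolding is_initial_def by blast
  then show "\<Gamma> \<in> CON M \<Longrightarrow> hC F \<Gamma> = \<Gamma>" "sub M \<Gamma> \<Delta> \<sigma> \<Longrightarrow> hS F \<sigma> = \<sigma>"
    "ty M l \<Gamma> A \<Longrightarrow> hT F A = A" "tm M i l \<Gamma> A a \<Longrightarrow> hM F a = a"
    unfolding morph_eq_def judgement_defs by auto
qed

text \<open>\<open>h\<close> is the context part of the morphism into the relabelled model. Its
  recursion equations mention the type \<open>A\<close> itself, because the decoded morphism is the
  identity and so leaves types fixed.\<close>

lemma relabel_ex:
  assumes "relabelling M C d e x m"
  obtains h where "\<And>\<Gamma>. \<Gamma> \<in> CON M \<Longrightarrow> h \<Gamma> \<in> C" "\<And>\<Gamma>. \<Gamma> \<in> CON M \<Longrightarrow> d (h \<Gamma>) = \<Gamma>" "h (emp M) = e"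
    "\<And>i l \<Gamma> A. ty M l \<Gamma> A \<Longrightarrow> h (extC M i \<Gamma> A) = x i (h \<Gamma>) A" "\<And>\<Gamma>. \<Gamma> \<in> CON M \<Longrightarrow> h (extM M \<Gamma>) = m (h \<Gamma>)"
proof -
  interpret relabelling M C d e x m by (rule assms)
  obtain F where F: "tt0_morph M R F" by (rule morph_ex[OF relabel_tt0_model])
  interpret F: tt0_morph M R F by (rule F)
  note id = endo_id[OF forget_morph[OF F]]
  show thesis
    by (rule that[of "hC F"])
      (use F.hC_con F.hC_emp F.hC_ext F.hC_extM id(1,3) in \<open>simp_all add: relabel_sel\<close>)
qed

text \<open>Taking the contexts with \<open>P\<close> as labels, decoded by the identity, the
  section of \<open>relabel_ex\<close> is the identity and lands in this set.\<close>

lemma context_induct [consumes 1, case_names emp ext extM]: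
  assumes "\<Gamma> \<in> CON M" and "P (emp M)"
    and "\<And>i l \<Gamma> A. ty M l \<Gamma> A \<Longrightarrow> P \<Gamma> \<Longrightarrow> P (extC M i \<Gamma> A)"
    and "\<And>\<Gamma>. \<Gamma> \<in> CON M \<Longrightarrow> P \<Gamma> \<Longrightarrow> P (extM M \<Gamma>)"
  shows "P \<Gamma>"
proof -
  have "relabelling M {\<Gamma> \<in> CON M. P \<Gamma>} (\<lambda>\<Gamma>. \<Gamma>) (emp M) (extC M) (extM M)"
    by unfold_locales (use assms(2-4) emp_con ext_con extM_con in auto)
  then obtain h where "\<And>\<Gamma>. \<Gamma> \<in> CON M \<Longrightarrow> h \<Gamma> \<in> {\<Gamma> \<in> CON M. P \<Gamma>}" "\<And>\<Gamma>. \<Gamma> \<in> CON M \<Longrightarrow> h \<Gamma> = \<Gamma>"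
    by (rule relabel_ex) blast
  with assms(1) show ?thesis by fastforce
qed

text \<open>The spare label $f$ serves as a second name of $\<theta>$; only the formations of $\<theta>$ that are marked
  by $Z$, $X$ or $Y$ are given this name.\<close>

lemma context_mark:
  fixes \<iota> :: "'c \<Rightarrow> 'c" and X :: "mode \<Rightarrow> 'c \<Rightarrow> 't \<Rightarrow> bool" and Y :: "'c \<Rightarrow> bool"
  assumes iota: "inj \<iota>" "f \<notin> range \<iota>" and \<theta>: "\<theta> \<in> CON M" and Z: "Z \<Longrightarrow> emp M = \<theta>"
    and X: "\<And>i l \<Gamma> A. ty M l \<Gamma> A \<Longrightarrow> X i \<Gamma> A \<Longrightarrow> extC M i \<Gamma> A = \<theta>" and Y: "\<And>\<Gamma>. \<Gamma> \<in> CON M \<Longrightarrow> Y \<Gamma> \<Longrightarrow> extM M \<Gamma> = \<theta>"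
  shows "\<exists>h. h (emp M) = Z \<and> (\<forall>i l \<Gamma> A. ty M l \<Gamma> A \<longrightarrow> h (extC M i \<Gamma> A) = X i \<Gamma> A) \<and>
    (\<forall>\<Gamma>\<in>CON M. h (extM M \<Gamma>) = Y \<Gamma>)"
proof -
  \<comment> \<open>Every context has its regular label under \<open>\<iota>\<close>; outside these,
    \<open>f\<close> is decoded to \<theta>, so that \<theta> has two names.\<close>
  define d where "d \<Gamma> = (if \<Gamma> = f then \<theta> else inv \<iota> \<Gamma>)" for \<Gamma>
  have df: "d f = \<theta>" and di: "d (\<iota> \<Gamma>) = \<Gamma>" and fi: "\<iota> \<Gamma> \<noteq> f" for \<Gamma>
    using iota by (auto simp: d_def inv_f_f)
  have "relabelling M (insert f (\<iota> ` CON M)) d (if Z then f else \<iota> (emp M))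
      (\<lambda>i \<Gamma> A. if X i (d \<Gamma>) A then f else \<iota> (extC M i (d \<Gamma>) A))
      (\<lambda>\<Gamma>. if Y (d \<Gamma>) then f else \<iota> (extM M (d \<Gamma>)))"
    by unfold_locales (use emp_con \<theta> Z X Y ext_con extM_con ty_con in \<open>auto simp: df di\<close>)
  then obtain h where h: "\<And>\<Gamma>. \<Gamma> \<in> CON M \<Longrightarrow> d (h \<Gamma>) = \<Gamma>" "h (emp M) = (if Z then f else \<iota> (emp M))"
    "\<And>i l \<Gamma> A. ty M l \<Gamma> A \<Longrightarrow> h (extC M i \<Gamma> A) = (if X i (d (h \<Gamma>)) A then f else \<iota> (extC M i (d (h \<Gamma>)) A))"
    "\<And>\<Gamma>. \<Gamma> \<in> CON M \<Longrightarrow> h (extM M \<Gamma>) = (if Y (d (h \<Gamma>)) then f else \<iota> (extM M (d (h \<Gamma>))))"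
    by (rule relabel_ex) blast
  show ?thesis
  \<comment> \<open>The predicate sought is that the label chosen by \<open>h\<close> is
    \<open>f\<close>.\<close>
  proof (intro exI conjI allI impI ballI)
    show "(h (emp M) = f) = Z" using h(2) fi by simp
    show "(h (extC M i \<Gamma> A) = f) = X i \<Gamma> A" if "ty M l \<Gamma> A" for i l \<Gamma> A
      using h(1)[OF ty_con[OF that]] h(3)[OF that] fi by simp
    show "(h (extM M \<Gamma>) = f) = Y \<Gamma>" if "\<Gamma> \<in> CON M" for \<Gamma>
      using h(1)[OF that] h(4)[OF that] fi by simp
  qed
qed

text \<open>Only one of the ways of forming the context is marked. As the mark depends on the
  context alone, every decomposition of the same context has to be the marked one.\<close>

lemma extC_mark:
  fixes \<iota> :: "'c \<Rightarrow> 'c"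
  assumes iota: "inj \<iota>" "f \<notin> range \<iota>" and A: "ty M l \<Gamma> A"
  obtains h where "\<not> h (emp M)"
    "\<And>j k \<Delta> B. ty M k \<Delta> B \<Longrightarrow> h (extC M j \<Delta> B) \<longleftrightarrow> j = i \<and> \<Delta> = \<Gamma> \<and> B = A"
    "\<And>\<Delta>. \<Delta> \<in> CON M \<Longrightarrow> \<not> h (extM M \<Delta>)"
proof -
  have "\<exists>h. h (emp M) = False \<and> (\<forall>j k \<Delta> B. ty M k \<Delta> B \<longrightarrow> h (extC M j \<Delta> B) = (j = i \<and> \<Delta> = \<Gamma> \<and> B = A)) \<and>
      (\<forall>\<Delta>\<in>CON M. h (extM M \<Delta>) = False)"
    by (rule context_mark[OF iota ext_con[OF A, of i]]) simp_all
  then obtain h where h: "h (emp M) = False" "\<forall>j k \<Delta> B. ty M k \<Delta> B \<longrightarrow> h (extC M j \<Delta> B) = (j = i \<and> \<Delta> = \<Gamma> \<and> B = A)"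
    "\<forall>\<Delta>\<in>CON M. h (extM M \<Delta>) = False" by metis
  show thesis by (rule that[of h]) (simp_all add: h)
qed

lemma extC_inj:
  fixes \<iota> :: "'c \<Rightarrow> 'c"
  assumes iota: "inj \<iota>" "f \<notin> range \<iota>" and A: "ty M l \<Gamma> A" and B: "ty M k \<Delta> B" and e: "extC M i \<Gamma> A = extC M j \<Delta> B"
  shows "i = j \<and> \<Gamma> = \<Delta> \<and> A = B"
proof -
  obtain h where h: "\<And>j k \<Delta> B. ty M k \<Delta> B \<Longrightarrow> h (extC M j \<Delta> B) \<longleftrightarrow> j = i \<and> \<Delta> = \<Gamma> \<and> B = A"
    by (rule extC_mark[OF iota A, of i]) blast
  have "h (extC M i \<Gamma> A)" using h[OF A, of i] by simp
  then have "h (extC M j \<Delta> B)" unfolding e .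
  with h[OF B, of j] show ?thesis by blast
qed

lemma extC_neq_extM:
  fixes \<iota> :: "'c \<Rightarrow> 'c"
  assumes iota: "inj \<iota>" "f \<notin> range \<iota>" and A: "ty M l \<Gamma> A"
  shows "\<Delta> \<in> CON M \<Longrightarrow> extC M i \<Gamma> A \<noteq> extM M \<Delta>" "extC M i \<Gamma> A \<noteq> emp M"
proof -
  obtain h where h: "\<not> h (emp M)" "\<And>j k \<Delta> B. ty M k \<Delta> B \<Longrightarrow> h (extC M j \<Delta> B) \<longleftrightarrow> j = i \<and> \<Delta> = \<Gamma> \<and> B = A"
    "\<And>\<Delta>. \<Delta> \<in> CON M \<Longrightarrow> \<not> h (extM M \<Delta>)"
    by (rule extC_mark[OF iota A, of i]) blast
  have "h (extC M i \<Gamma> A)" using h(2)[OF A] by simp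
  then show "\<Delta> \<in> CON M \<Longrightarrow> extC M i \<Gamma> A \<noteq> extM M \<Delta>" "extC M i \<Gamma> A \<noteq> emp M"
    using h(1,3) by metis+
qed

lemma extM_inj:
  fixes \<iota> :: "'c \<Rightarrow> 'c"
  assumes iota: "inj \<iota>" "f \<notin> range \<iota>" and G: "\<Gamma> \<in> CON M"
  shows "\<Delta> \<in> CON M \<Longrightarrow> extM M \<Gamma> = extM M \<Delta> \<Longrightarrow> \<Gamma> = \<Delta>" "extM M \<Gamma> \<noteq> emp M"
proof -
  have "\<exists>h. h (emp M) = False \<and> (\<forall>j k \<Delta> B. ty M k \<Delta> B \<longrightarrow> h (extC M j \<Delta> B) = False) \<and>
      (\<forall>\<Delta>\<in>CON M. h (extM M \<Delta>) = (\<Delta> = \<Gamma>))"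
    by (rule context_mark[OF iota extM_con[OF G]]) simp_all
  then obtain h where h: "\<not> h (emp M)" "\<And>\<Delta>. \<Delta> \<in> CON M \<Longrightarrow> h (extM M \<Delta>) = (\<Delta> = \<Gamma>)" by blast
  show "\<Delta> \<in> CON M \<Longrightarrow> extM M \<Gamma> = extM M \<Delta> \<Longrightarrow> \<Gamma> = \<Delta>" using h(2)[OF G] h(2)[of \<Delta>] by metis
  show "extM M \<Gamma> \<noteq> emp M" using h(1) h(2)[OF G] by metis
qed

section \<open>Recursion on contexts\<close>

inductive ctx_rec :: "'a \<Rightarrow> (mode \<Rightarrow> 'c \<Rightarrow> 't \<Rightarrow> 'a \<Rightarrow> 'a) \<Rightarrow> ('c \<Rightarrow> 'a \<Rightarrow> 'a) \<Rightarrow> 'c \<Rightarrow> 'a \<Rightarrow> bool" for z g k where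
  emp: "ctx_rec z g k (emp M) z"
| ext: "ctx_rec z g k \<Gamma> u \<Longrightarrow> ty M l \<Gamma> A \<Longrightarrow> ctx_rec z g k (extC M i \<Gamma> A) (g i \<Gamma> A u)"
| extM: "ctx_rec z g k \<Gamma> u \<Longrightarrow> \<Gamma> \<in> CON M \<Longrightarrow> ctx_rec z g k (extM M \<Gamma>) (k \<Gamma> u)"

text \<open>The values lie in an arbitrary type, beyond the reach of initiality. So the graph of the
  recursion is shown to be total by induction and single valued by the unique decomposition of
  contexts.\<close>

lemma context_recursion:
  fixes \<iota> :: "'c \<Rightarrow> 'c" and z :: 'a
  assumes iota: "inj \<iota>" "f \<notin> range \<iota>"
  obtains up where "up (emp M) = z" "\<And>i l \<Gamma> A. ty M l \<Gamma> A \<Longrightarrow> up (extC M i \<Gamma> A) = g i \<Gamma> A (up \<Gamma>)"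
    "\<And>\<Gamma>. \<Gamma> \<in> CON M \<Longrightarrow> up (extM M \<Gamma>) = k \<Gamma> (up \<Gamma>)"
proof -
  have unique: "ctx_rec z g k \<Gamma> u \<Longrightarrow> ctx_rec z g k \<Gamma> v \<Longrightarrow> u = v" for \<Gamma> u v
  proof (induction arbitrary: v rule: ctx_rec.induct)
    case emp
    then show ?case
    proof (cases rule: ctx_rec.cases)
      case (ext \<Gamma>' u' l' A' i')
      then show ?thesis using extC_neq_extM(2)[OF iota ext(4)] ext(1) by metis
    next
      case (extM \<Gamma>' u')
      then show ?thesis using extM_inj(2)[OF iota extM(4)] extM(1) by metis
    qed simp
  next
    case (ext \<Gamma> u l A i)
    note A = ext.hyps(2) and IH = ext.IH
    from ext.prems show ?case
    proof (cases rule: ctx_rec.cases)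
      case emp
      then show ?thesis using extC_neq_extM(2)[OF iota A] by metis
    next
      case (ext \<Gamma>' u' l' A' i')
      then show ?thesis using extC_inj[OF iota A ext(4,1)] IH by metis
    next
      case (extM \<Gamma>' u')
      then show ?thesis using extC_neq_extM(1)[OF iota A extM(4)] by metis
    qed
  next
    case (extM \<Gamma> u)
    note G = extM.hyps(2) and IH = extM.IH
    from extM.prems show ?case
    proof (cases rule: ctx_rec.cases)
      case emp
      then show ?thesis using extM_inj(2)[OF iota G] by metis
    next
      case (ext \<Gamma>' u' l' A' i')
      then show ?thesis using extC_neq_extM(1)[OF iota ext(4) G] by metis
    next
      case (extM \<Gamma>' u')
      then show ?thesis using extM_inj(1)[OF iota G extM(4,1)] IH by metis
    qed
  qed
  have ex: "\<exists>u. ctx_rec z g k \<Gamma> u" if "\<Gamma> \<in> CON M" for \<Gamma>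
    using that by (induction rule: context_induct) (blast intro: ctx_rec.intros)+
  define up where "up \<Gamma> = (THE u. ctx_rec z g k \<Gamma> u)" for \<Gamma>
  have up: "up \<Gamma> = u" if "ctx_rec z g k \<Gamma> u" for \<Gamma> u
    unfolding up_def using that unique by blast
  show thesis
  proof (rule that)
    show "up (emp M) = z" by (rule up[OF ctx_rec.emp])
    show "up (extC M i \<Gamma> A) = g i \<Gamma> A (up \<Gamma>)" if "ty M l \<Gamma> A" for i l \<Gamma> A
      using ex[OF ty_con[OF that]] up ctx_rec.ext[OF _ that] by metis
    show "up (extM M \<Gamma>) = k \<Gamma> (up \<Gamma>)" if "\<Gamma> \<in> CON M" for \<Gamma>
      using ex[OF that] up ctx_rec.extM[OF _ that] by metis
  qed
qed

end

section \<open>Initial models with finitely many contexts\<close>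

text \<open>With a single substitution, type and term, every law holds whatever the contexts do.
  Hence \<open>e\<close> and \<open>k\<close> are arbitrary, and a morphism into this model is a
  recursion on contexts with values in their carrier type.\<close>

definition triv_model :: "'c \<Rightarrow> ('c \<Rightarrow> 'c) \<Rightarrow> ('c,'s,'t,'m) tt0" where
  "triv_model e k = \<lparr>CON = UNIV, SUB = (\<lambda>_ _. {undefined}), sid = (\<lambda>_. undefined), scomp = (\<lambda>_ _. undefined),
     emp = e, epsS = (\<lambda>_. undefined), TY = (\<lambda>_ _. {undefined}), tsub = (\<lambda>_ _. undefined),
     TM = (\<lambda>_ _ _. {undefined}), msub = (\<lambda>_ _. undefined), MK = (\<lambda>_. True),
     extC = (\<lambda>_ \<Gamma> _. k \<Gamma>), pp = (\<lambda>_ _ _. undefined), qq = (\<lambda>_ _ _. undefined), spair = (\<lambda>_ _ _. undefined),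
     extM = k, pM = (\<lambda>_. undefined), spairM = (\<lambda>_. undefined), dn = (\<lambda>_. undefined), upc = (\<lambda>_. undefined),
     PI = (\<lambda>_ _ _ _. undefined), SG = (\<lambda>_ _ _ _. undefined), lam = (\<lambda>_ _ _ _ _. undefined),
     app = (\<lambda>_ _ _ _ _. undefined), tpair = (\<lambda>_ _ _ _ _ _. undefined), proj = (\<lambda>_ _ _ _ _. (undefined, undefined)),
     UU = (\<lambda>_ _. undefined), EL = (\<lambda>_. undefined), codeU = (\<lambda>_. undefined)\<rparr>"

lemma triv_model: "tt0_model (triv_model e k)"
  by unfold_locales (simp_all add: triv_model_def judgement_defs)

lemma finite_type_cycle:
  assumes "finite (UNIV :: 'a set)"
  obtains s :: "'a \<Rightarrow> 'a" and z where "inj s" "\<And>x. \<exists>k. x = (s ^^ k) z"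
proof -
  define n where "n = card (UNIV :: 'a set)"
  have n: "n > 0" using assms by (simp add: n_def finite_UNIV_card_ge_0)
  obtain h :: "nat \<Rightarrow> 'a" where h: "bij_betw h {0..<n} UNIV"
    using ex_bij_betw_nat_finite[OF assms] n_def by blast
  \<comment> \<open>The cyclic successor along an enumeration of the type. It is injective and has a
    single orbit; reduction modulo \<open>n\<close> gives the first element the last one as
    predecessor.\<close>
  define s where "s x = h (Suc (inv_into {0..<n} h x) mod n)" for x
  have s: "s (h i) = h (Suc i mod n)" if "i < n" for i
    using that h by (simp add: s_def bij_betw_inv_into_left)
  have it: "(s ^^ k) (h 0) = h k" if "k < n" for k
    using that by (induction k) (simp_all add: s)
  have reach: "\<exists>k. x = (s ^^ k) (h 0)" for x
  proof -
    obtain k where "k < n" "x = h k" using bij_betw_imp_surj_on[OF h] by (metis UNIV_I atLeastLessThan_iff imageE)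
    then show ?thesis using it by metis
  qed
  have "x \<in> range s" for x
  proof -
    obtain k where k: "k < n" "x = h k"
      using bij_betw_imp_surj_on[OF h] by (metis UNIV_I atLeastLessThan_iff imageE)
    have "x = s (h (if k = 0 then n - 1 else k - 1))"
      using k n by (subst s) auto
    then show ?thesis by blast
  qed
  then have "surj s" by auto
  then have "inj s" using finite_UNIV_surj_inj[OF assms] by blast
  with reach that show thesis by blast
qed

context initial_tt0_model
begin

text \<open>Two distinct elements would separate \<open>emp\<close> from every \<Gamma> |> #, by
  recursion with \<open>emp\<close> sent to \<open>x\<close> and every extension to
  \<open>y\<close>. Recursion along a cycle with one orbit, on the other hand, makes \<Gamma> |->
  \<Gamma> |> # injective on a finite set, hence surjective, so that \<open>emp\<close> is
  reached.\<close>

lemma finite_contexts_trivial: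
  assumes fin: "finite (UNIV :: 'c set)"
  shows "x = (y :: 'c)"
proof (rule ccontr)
  assume "x \<noteq> y"
  obtain F where "tt0_morph M (triv_model x (\<lambda>_. y)) F" by (rule morph_ex[OF triv_model])
  then interpret F: tt0_morph M "triv_model x (\<lambda>_. y)" F .
  have emp: "extM M \<Gamma> \<noteq> emp M" if "\<Gamma> \<in> CON M" for \<Gamma>
    using F.hC_emp F.hC_extM[OF that] \<open>x \<noteq> y\<close> by (auto simp: triv_model_def)
  obtain s :: "'c \<Rightarrow> 'c" and z where s: "inj s" "\<And>x. \<exists>k. x = (s ^^ k) z" using finite_type_cycle[OF fin] by blast
  obtain G where "tt0_morph M (triv_model z s) G" by (rule morph_ex[OF triv_model])
  then interpret G: tt0_morph M "triv_model z s" G .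
  have G: "hC G (emp M) = z" "\<And>\<Gamma>. \<Gamma> \<in> CON M \<Longrightarrow> hC G (extM M \<Gamma>) = s (hC G \<Gamma>)"
    using G.hC_emp G.hC_extM by (simp_all add: triv_model_def)
  have "(s ^^ k) z \<in> hC G ` CON M" for k
  proof (induction k)
    case 0
    then show ?case using G(1) emp_con by force
  next
    case (Suc k)
    then obtain \<Gamma> where "\<Gamma> \<in> CON M" "(s ^^ k) z = hC G \<Gamma>" by auto
    then have "(s ^^ Suc k) z = hC G (extM M \<Gamma>)" using G(2) by simp
    then show ?case using extM_con[OF \<open>\<Gamma> \<in> CON M\<close>] by blast
  qed
  \<comment> \<open>The map to the cycle is onto the whole type. Counting then shows that it is
    injective on contexts.\<close>
  then have "UNIV \<subseteq> hC G ` CON M" using s(2) by (metis subsetI)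
  then have "card (UNIV :: 'c set) \<le> card (hC G ` CON M)"
    by (intro card_mono finite_subset[OF subset_UNIV fin])
  moreover have "card (hC G ` CON M) \<le> card (CON M)" by (intro card_image_le finite_subset[OF subset_UNIV fin])
  moreover have "card (CON M) \<le> card (UNIV :: 'c set)" by (intro card_mono fin subset_UNIV)
  ultimately have "card (hC G ` CON M) = card (CON M)" by simp
  then have inj: "inj_on (hC G) (CON M)" by (rule eq_card_imp_inj_on[OF finite_subset[OF subset_UNIV fin]])
  have "inj_on (extM M) (CON M)"
  proof (rule inj_onI)
    fix \<Gamma> \<Delta> assume *: "\<Gamma> \<in> CON M" "\<Delta> \<in> CON M" "extM M \<Gamma> = extM M \<Delta>"
    then have "s (hC G \<Gamma>) = s (hC G \<Delta>)" using G(2) by metis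
    then have "hC G \<Gamma> = hC G \<Delta>" using s(1) by (simp add: inj_eq)
    then show "\<Gamma> = \<Delta>" using inj_onD[OF inj] * by blast
  qed
  then have "extM M ` CON M = CON M"
    by (intro endo_inj_surj finite_subset[OF subset_UNIV fin]) (use extM_con in auto)
  then show False using emp emp_con by force
qed

text \<open>Every context is the terminal one, so parallel substitutions agree. A term is recovered
  from the substitution (id, a) through the variable, and a type from its code.\<close>

lemma single_context:
  assumes "\<And>x y :: 'c. x = y"
  shows "sub M \<Gamma> \<Delta> \<sigma> \<Longrightarrow> sub M \<Gamma> \<Delta> \<tau> \<Longrightarrow> \<sigma> = \<tau>"
    and "tm M i l \<Gamma> A a \<Longrightarrow> tm M i l \<Gamma> A b \<Longrightarrow> a = b"
    and "ty M l \<Gamma> A \<Longrightarrow> ty M l \<Gamma> B \<Longrightarrow> A = B"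
proof -
  show sub: "\<sigma> = \<tau>" if "sub M \<Gamma> \<Delta> \<sigma>" "sub M \<Gamma> \<Delta> \<tau>" for \<Gamma> \<Delta> \<sigma> \<tau>
  proof -
    have "\<Delta> = emp M" by (rule assms)
    with that show ?thesis using eps_unique by blast
  qed
  show tm: "a = b" if a: "tm M i l \<Gamma> A a" and b: "tm M i l \<Gamma> A b" for i l \<Gamma> A a b
  proof -
    have e: "spair M i (sid M \<Gamma>) a = spair M i (sid M \<Gamma>) b" by (rule sub[OF sid_spair_sub[OF a] sid_spair_sub[OF b]])
    have "qq M i \<Gamma> A \<unlhd> spair M i (sid M \<Gamma>) c = c" if "tm M i l \<Gamma> A c" for c
      using qq_spair[OF tm_ty[OF that] sid_sub[OF tm_con[OF that]]] that ty_sid[OF tm_ty[OF that]] by simp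
    from this[OF a] this[OF b] e show ?thesis by metis
  qed
  show "A = B" if A: "ty M l \<Gamma> A" and B: "ty M l \<Gamma> B" for l \<Gamma> A B
    using tm[OF code_tm[OF A] code_tm[OF B]] EL_code[OF A] EL_code[OF B] by metis
qed

end

section \<open>The lifting substitution\<close>

text \<open>The equations for \<open>up\<close> are required only where their right-hand sides are
  well typed. In this conditional form they hold both for the recursion on contexts and for
  \<open>up = sid M\<close> when there is only one context.\<close>

locale zeroing = initial_tt0_model M + zero: tt0_morph M "zero_model M" F
  for M :: "('c,'s,'t,'m) tt0" (structure) and F :: "('c,'s,'t,'m) hom" +
  fixes up :: "'c \<Rightarrow> 's"
  assumes up_emp: "up (emp M) = sid M (emp M)"
    and up_ext: "ty M l \<Gamma> A \<Longrightarrow> sub M \<Gamma> (hC F \<Gamma>) (up \<Gamma>) \<Longrightarrow> hT F A \<lhd> up \<Gamma> = A \<Longrightarrow>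
      up (extC M i \<Gamma> A) = spair M Ze (up \<Gamma> \<cdot> pp M i \<Gamma> A) (downstar M i (extC M i \<Gamma> A) (qq M i \<Gamma> A))"
    and up_extM: "sub M \<Gamma> (hC F \<Gamma>) (up \<Gamma>) \<Longrightarrow> up (extM M \<Gamma>) = up \<Gamma> \<cdot> pM M \<Gamma>"
begin

text \<open>The laws of zeroing, read back in \<open>M\<close>. The images of app and proj are
  descriptions in the zeroed model; they are reached through the laws for \<open>lam\<close> and
  \<open>tpair\<close>.\<close>

lemmas z_con = zero.hC_con[unfolded zero_model_simps]
  and z_sub = zero.hS_sub[unfolded zero_model_simps]
  and z_ty = zero.hT_ty[unfolded zero_model_simps]
  and z_tm = zero.hM_tm[unfolded zero_model_simps]
  and zs_sid = zero.hS_sid[unfolded zero_model_simps]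
  and zs_comp = zero.hS_comp[unfolded zero_model_simps]
  and zc_emp = zero.hC_emp[unfolded zero_model_simps]
  and zt_sub = zero.hT_sub[unfolded zero_model_simps]
  and zm_sub = zero.hM_sub[unfolded zero_model_simps]
  and zc_ext = zero.hC_ext[unfolded zero_model_simps]
  and zs_pp = zero.hS_pp[unfolded zero_model_simps]
  and zm_qq = zero.hM_qq[unfolded zero_model_simps]
  and zs_spair = zero.hS_spair[unfolded zero_model_simps]
  and zc_extM = zero.hC_extM[unfolded zero_model_simps]
  and zs_pM = zero.hS_pM[unfolded zero_model_simps]
  and zs_spairM = zero.hS_spairM[unfolded zero_model_simps]
  and zm_dn = zero.hM_dn[unfolded zero_model_simps]
  and zm_upc = zero.hM_upc[unfolded zero_model_simps]
  and zt_PI = zero.hT_PI[unfolded zero_model_simps]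
  and zt_SG = zero.hT_SG[unfolded zero_model_simps]
  and zm_lam = zero.hM_lam[unfolded zero_model_simps]
  and zm_tpair = zero.hM_tpair[unfolded zero_model_simps]
  and zt_UU = zero.hT_UU[unfolded zero_model_simps]
  and zt_EL = zero.hT_EL[unfolded zero_model_simps]
  and zm_code = zero.hM_code[unfolded zero_model_simps]

abbreviation "zc \<equiv> hC F"
abbreviation "zs \<equiv> hS F"
abbreviation "zt \<equiv> hT F"
abbreviation "zm \<equiv> hM F"

text \<open>The last two conditions make \<open>zc \<Gamma>\<close> a fixed point of zeroing on
  which \<open>up\<close> is trivial. They are carried along because zeroing undoes substitution by
  \<open>up \<Gamma>\<close> only when goodness over \<open>zc \<Gamma>\<close> can be read with the
  identity.\<close>

definition goodC :: "'c \<Rightarrow> bool" where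
  "goodC \<Gamma> \<longleftrightarrow> sub M \<Gamma> (zc \<Gamma>) (up \<Gamma>) \<and> zs (up \<Gamma>) = sid M (zc \<Gamma>) \<and> zc (zc \<Gamma>) = zc \<Gamma> \<and> up (zc \<Gamma>) = sid M (zc \<Gamma>)"

definition goodS :: "'c \<Rightarrow> 'c \<Rightarrow> 's \<Rightarrow> bool" where
  "goodS \<Gamma> \<Delta> \<sigma> \<longleftrightarrow> goodC \<Gamma> \<and> goodC \<Delta> \<and> sub M \<Gamma> \<Delta> \<sigma> \<and> zs \<sigma> \<cdot> up \<Gamma> = up \<Delta> \<cdot> \<sigma>"

definition goodT :: "nat \<Rightarrow> 'c \<Rightarrow> 't \<Rightarrow> bool" where
  "goodT l \<Gamma> A \<longleftrightarrow> goodC \<Gamma> \<and> ty M l \<Gamma> A \<and> zt A \<lhd> up \<Gamma> = A"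

definition goodM :: "mode \<Rightarrow> nat \<Rightarrow> 'c \<Rightarrow> 't \<Rightarrow> 'm \<Rightarrow> bool" where
  "goodM i l \<Gamma> A a \<longleftrightarrow> goodT l \<Gamma> A \<and> tm M i l \<Gamma> A a \<and> zm a \<unlhd> up \<Gamma> = downstar M i \<Gamma> a"

lemma goodC_D: "goodC \<Gamma> \<Longrightarrow> con \<Gamma>" "goodC \<Gamma> \<Longrightarrow> sub M \<Gamma> (zc \<Gamma>) (up \<Gamma>)" "goodC \<Gamma> \<Longrightarrow> zs (up \<Gamma>) = sid M (zc \<Gamma>)"
    "goodC \<Gamma> \<Longrightarrow> zc (zc \<Gamma>) = zc \<Gamma>" "goodC \<Gamma> \<Longrightarrow> up (zc \<Gamma>) = sid M (zc \<Gamma>)"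
  and goodS_D: "goodS \<Gamma> \<Delta> \<sigma> \<Longrightarrow> goodC \<Gamma>" "goodS \<Gamma> \<Delta> \<sigma> \<Longrightarrow> goodC \<Delta>" "goodS \<Gamma> \<Delta> \<sigma> \<Longrightarrow> sub M \<Gamma> \<Delta> \<sigma>"
    "goodS \<Gamma> \<Delta> \<sigma> \<Longrightarrow> zs \<sigma> \<cdot> up \<Gamma> = up \<Delta> \<cdot> \<sigma>"
  and goodT_D: "goodT l \<Gamma> A \<Longrightarrow> goodC \<Gamma>" "goodT l \<Gamma> A \<Longrightarrow> ty M l \<Gamma> A" "goodT l \<Gamma> A \<Longrightarrow> zt A \<lhd> up \<Gamma> = A"
  and goodM_D: "goodM i l \<Gamma> A a \<Longrightarrow> goodT l \<Gamma> A" "goodM i l \<Gamma> A a \<Longrightarrow> tm M i l \<Gamma> A a"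
    "goodM i l \<Gamma> A a \<Longrightarrow> zm a \<unlhd> up \<Gamma> = downstar M i \<Gamma> a"
  by (auto simp: goodC_def goodS_def goodT_def goodM_def sub_def)

section \<open>Closure of the good data under the operations\<close>

lemma goodS_sid: "goodC \<Gamma> \<Longrightarrow> goodS \<Gamma> \<Gamma> (sid M \<Gamma>)"
  by (simp add: goodS_def goodC_D sid_sub zs_sid sid_comp[OF goodC_D(2)] comp_sid[OF goodC_D(2)])

lemma goodS_comp:
  assumes s: "goodS \<Delta> \<Theta> \<sigma>" and d: "goodS \<Gamma> \<Delta> \<delta>"
  shows "goodS \<Gamma> \<Theta> (\<sigma> \<cdot> \<delta>)"
proof -
  note S = goodS_D(3)[OF s] and D = goodS_D(3)[OF d]
  note uG = goodC_D(2)[OF goodS_D(1)[OF d]] and uD = goodC_D(2)[OF goodS_D(1)[OF s]] and uT = goodC_D(2)[OF goodS_D(2)[OF s]]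
  have "zs (\<sigma> \<cdot> \<delta>) \<cdot> up \<Gamma> = up \<Theta> \<cdot> (\<sigma> \<cdot> \<delta>)"
    unfolding zs_comp[OF S D] comp_assoc[OF z_sub[OF S] z_sub[OF D] uG] goodS_D(4)[OF d]
      comp_assoc[OF z_sub[OF S] uD D, symmetric] goodS_D(4)[OF s] by (rule comp_assoc[OF uT S D])
  then show ?thesis using goodS_D(1)[OF d] goodS_D(2)[OF s] comp_sub[OF S D] by (simp add: goodS_def)
qed

lemma goodC_emp: "goodC (emp M)"
  using sid_sub[OF emp_con] by (simp add: goodC_def zc_emp up_emp zs_sid emp_con)

lemma goodS_eps:
  assumes "goodC \<Gamma>"
  shows "goodS \<Gamma> (emp M) (epsS M \<Gamma>)"
proof -
  note G = goodC_D(1)[OF assms] and u = goodC_D(2)[OF assms]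
  note e = eps_sub[OF G]
  have "sub M \<Gamma> (emp M) (zs (epsS M \<Gamma>) \<cdot> up \<Gamma>)" using comp_sub[OF z_sub[OF e] u] by (simp add: zc_emp)
  moreover have "sub M \<Gamma> (emp M) (up (emp M) \<cdot> epsS M \<Gamma>)" using comp_sub[OF goodC_D(2)[OF goodC_emp] e] by (simp add: zc_emp)
  ultimately have "zs (epsS M \<Gamma>) \<cdot> up \<Gamma> = up (emp M) \<cdot> epsS M \<Gamma>" using eps_unique by metis
  then show ?thesis using assms goodC_emp e by (simp add: goodS_def)
qed

lemma goodT_sub:
  assumes s: "goodS \<Gamma> \<Delta> \<sigma>" and A: "goodT l \<Delta> A"
  shows "goodT l \<Gamma> (A \<lhd> \<sigma>)"
proof -
  note S = goodS_D(3)[OF s] and T = goodT_D(2)[OF A]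
  note uG = goodC_D(2)[OF goodS_D(1)[OF s]] and uD = goodC_D(2)[OF goodS_D(2)[OF s]]
  have "zt (A \<lhd> \<sigma>) \<lhd> up \<Gamma> = A \<lhd> \<sigma>"
    unfolding zt_sub[OF S T] ty_comp[OF z_sub[OF S] uG z_ty[OF T], symmetric] goodS_D(4)[OF s]
      ty_comp[OF uD S z_ty[OF T]] goodT_D(3)[OF A] ..
  then show ?thesis using goodS_D(1)[OF s] ty_sub[OF S T] by (simp add: goodT_def)
qed

lemma goodM_sub:
  assumes s: "goodS \<Gamma> \<Delta> \<sigma>" and a: "goodM i l \<Delta> A a"
  shows "goodM i l \<Gamma> (A \<lhd> \<sigma>) (a \<unlhd> \<sigma>)"
proof -
  note S = goodS_D(3)[OF s] and T = goodM_D(2)[OF a]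
  note uG = goodC_D(2)[OF goodS_D(1)[OF s]] and uD = goodC_D(2)[OF goodS_D(2)[OF s]]
  have "zm (a \<unlhd> \<sigma>) \<unlhd> up \<Gamma> = downstar M i \<Gamma> (a \<unlhd> \<sigma>)"
    unfolding zm_sub[OF S T] tm_comp[OF z_sub[OF S] uG z_tm[OF T], symmetric] goodS_D(4)[OF s]
      tm_comp[OF uD S z_tm[OF T]] goodM_D(3)[OF a] by (rule downstar_sub[OF S T])
  then show ?thesis using goodT_sub[OF s goodM_D(1)[OF a]] tm_sub[OF S T] by (simp add: goodM_def)
qed

text \<open>Zeroing is applied to the equation for \<open>A\<close>; it turns
  \<open>up \<Gamma>\<close> into the identity.\<close>

lemma zt_zt:
  assumes A: "goodT l \<Gamma> A"
  shows "zt (zt A) = zt A"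
proof -
  note C = goodT_D(1)[OF A] and T = goodT_D(2)[OF A]
  have "zt A = zt (zt A) \<lhd> sid M (zc \<Gamma>)"
    using zt_sub[OF goodC_D(2)[OF C] z_ty[OF T]] goodT_D(3)[OF A] goodC_D(3)[OF C] by simp
  also have "\<dots> = zt (zt A)" using ty_sid[OF z_ty[OF z_ty[OF T]]] goodC_D(4)[OF C] by simp
  finally show ?thesis by simp
qed

lemma up_ext_eq:
  assumes A: "goodT l \<Gamma> A"
  shows "up (extC M i \<Gamma> A) = spair M Ze (up \<Gamma> \<cdot> pp M i \<Gamma> A) (downstar M i (extC M i \<Gamma> A) (qq M i \<Gamma> A))"
  using up_ext goodT_D[OF A] goodC_D(2) by blast

text \<open>The factorisation \<open>up_ext_wS\<close> exhibits \<open>up\<close> at an extended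
  context through the lift of \<open>up \<Gamma>\<close>, the form in which substitution acts under
  binders.\<close>

lemma
  fixes i :: mode
  assumes A: "goodT l \<Gamma> A"
  shows up_ext_sub: "sub M (extC M i \<Gamma> A) (zc (extC M i \<Gamma> A)) (up (extC M i \<Gamma> A))"
    and pp_up_ext: "pp M Ze (zc \<Gamma>) (zt A) \<cdot> up (extC M i \<Gamma> A) = up \<Gamma> \<cdot> pp M i \<Gamma> A"
    and qq_up_ext: "qq M Ze (zc \<Gamma>) (zt A) \<unlhd> up (extC M i \<Gamma> A) = downstar M i (extC M i \<Gamma> A) (qq M i \<Gamma> A)"
    and up_ext_wS: "up (extC M i \<Gamma> A) = wS M i (zc \<Gamma>) (zt A) \<cdot> liftS M i \<Gamma> (zt A) (up \<Gamma>)"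
    and zs_up_ext: "zs (up (extC M i \<Gamma> A)) = sid M (zc (extC M i \<Gamma> A))"
proof -
  note C = goodT_D(1)[OF A] and T = goodT_D(2)[OF A] and e = goodT_D(3)[OF A]
  note u = goodC_D(2)[OF C] and p = pp_sub[OF T, of i] and q = qq_tm[OF T, of i] and zA = z_ty[OF T]
  note up = comp_sub[OF u p]
  have t: "tm M Ze l (extC M i \<Gamma> A) (zt A \<lhd> (up \<Gamma> \<cdot> pp M i \<Gamma> A)) (downstar M i (extC M i \<Gamma> A) (qq M i \<Gamma> A))"
    using downstar_tm[OF q] ty_comp[OF u p zA] e by simp
  show "sub M (extC M i \<Gamma> A) (zc (extC M i \<Gamma> A)) (up (extC M i \<Gamma> A))"
    unfolding up_ext_eq[OF A] zc_ext[OF T] by (rule spair_sub[OF zA up t])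
  show "pp M Ze (zc \<Gamma>) (zt A) \<cdot> up (extC M i \<Gamma> A) = up \<Gamma> \<cdot> pp M i \<Gamma> A"
    unfolding up_ext_eq[OF A] by (rule pp_spair[OF zA up t])
  show "qq M Ze (zc \<Gamma>) (zt A) \<unlhd> up (extC M i \<Gamma> A) = downstar M i (extC M i \<Gamma> A) (qq M i \<Gamma> A)"
    unfolding up_ext_eq[OF A] by (rule qq_spair[OF zA up t])
  show "up (extC M i \<Gamma> A) = wS M i (zc \<Gamma>) (zt A) \<cdot> liftS M i \<Gamma> (zt A) (up \<Gamma>)"
    unfolding up_ext_eq[OF A] wS_comp[OF zA lift_sub[OF u zA]] pp_lift[OF u zA] qq_lift[OF u zA] e ..
  have "zs (up \<Gamma> \<cdot> pp M i \<Gamma> A) = pp M Ze (zc \<Gamma>) (zt A)"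
    using zs_comp[OF u p] goodC_D(3)[OF C] zs_pp[OF T, of i] sid_comp[OF pp_sub[OF zA]] by simp
  \<comment> \<open>Zeroing interprets \<open>dn\<close> and p_# as identities, so it does not see
    the erasure of the variable.\<close>
  moreover have "zm (downstar M i (extC M i \<Gamma> A) (qq M i \<Gamma> A)) = qq M Ze (zc \<Gamma>) (zt A)"
  proof (cases i)
    case Ze
    then show ?thesis using zm_qq[OF T, of i] by (simp add: downstar_def)
  next
    case Om
    have E: "con (extC M Om \<Gamma> A)" using ext_con[OF T] .
    show ?thesis
      using zm_dn[OF tm_ty[OF q[unfolded Om]] tm_sub[OF pM_sub[OF E] q[unfolded Om]]] zm_sub[OF pM_sub[OF E] q[unfolded Om]]
        zs_pM[OF E] zc_ext[OF T] zm_qq[OF T, of Om] tm_sid[OF qq_tm[OF zA]]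
      by (simp add: Om downstar_def)
  qed
  ultimately show "zs (up (extC M i \<Gamma> A)) = sid M (zc (extC M i \<Gamma> A))"
    unfolding up_ext_eq[OF A] zc_ext[OF T] using zs_spair[OF zA up t] spair_pp_qq[OF zA, of Ze] by simp
qed

lemma up_ext_spair:
  assumes A: "goodT l \<Gamma> A" and s: "sub M \<Xi> \<Gamma> \<sigma>" and t: "tm M i l \<Xi> (A \<lhd> \<sigma>) t"
  shows "up (extC M i \<Gamma> A) \<cdot> spair M i \<sigma> t = spair M Ze (up \<Gamma> \<cdot> \<sigma>) (downstar M i \<Xi> t)"
proof -
  note C = goodT_D(1)[OF A] and T = goodT_D(2)[OF A] and e = goodT_D(3)[OF A]
  note u = goodC_D(2)[OF C] and zA = z_ty[OF T]
  have t1: "tm M i l \<Xi> (zt A \<lhd> up \<Gamma> \<lhd> \<sigma>) t" using t e by simp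
  have t2: "tm M i l \<Xi> (zt A \<lhd> (up \<Gamma> \<cdot> \<sigma>)) t" using t1 ty_comp[OF u s zA] by simp
  have sp: "sub M \<Xi> (extC M i \<Gamma> (zt A \<lhd> up \<Gamma>)) (spair M i \<sigma> t)" unfolding e by (rule spair_sub[OF T s t])
  show ?thesis
    unfolding up_ext_wS[OF A] comp_assoc[OF wS_sub[OF zA] lift_sub[OF u zA] sp] lift_spair[OF u zA s t1]
    by (rule wS_spair[OF zA comp_sub[OF u s] t2])
qed

lemma goodC_ext:
  assumes A: "goodT l \<Gamma> A"
  shows "goodC (extC M i \<Gamma> A)"
proof -
  note C = goodT_D(1)[OF A] and T = goodT_D(2)[OF A]
  note zA = z_ty[OF T] and id = sid_sub[OF ty_con[OF z_ty[OF T]]]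
  have zz: "zc (zc (extC M i \<Gamma> A)) = zc (extC M i \<Gamma> A)"
    by (simp add: zc_ext[OF T] zc_ext[OF zA] goodC_D(4)[OF C] zt_zt[OF A])
  \<comment> \<open>The zeroed context is itself an extension, of \<open>zc \<Gamma>\<close> by
    \<open>zt A\<close>. The condition in \<open>up_ext\<close> holds for it since \<open>up\<close>
    is trivial at \<open>zc \<Gamma>\<close> and \<open>zt A\<close> is fixed by zeroing.\<close>
  have "up (extC M Ze (zc \<Gamma>) (zt A)) = spair M Ze (sid M (zc \<Gamma>) \<cdot> pp M Ze (zc \<Gamma>) (zt A))
      (downstar M Ze (extC M Ze (zc \<Gamma>) (zt A)) (qq M Ze (zc \<Gamma>) (zt A)))"
    using up_ext[OF zA, of Ze] id ty_sid[OF zA] goodC_D(4,5)[OF C] zt_zt[OF A] by simp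
  also have "\<dots> = sid M (extC M Ze (zc \<Gamma>) (zt A))"
    using sid_comp[OF pp_sub[OF zA]] spair_pp_qq[OF zA, of Ze] by (simp add: downstar_def)
  finally have "up (zc (extC M i \<Gamma> A)) = sid M (zc (extC M i \<Gamma> A))" by (simp add: zc_ext[OF T])
  then show ?thesis using up_ext_sub[OF A, of i] zs_up_ext[OF A, of i] zz by (simp add: goodC_def)
qed

lemma goodS_pp: "goodT l \<Gamma> A \<Longrightarrow> goodS (extC M i \<Gamma> A) \<Gamma> (pp M i \<Gamma> A)"
  using pp_up_ext goodC_ext goodT_D(1) pp_sub[OF goodT_D(2)] zs_pp[OF goodT_D(2)] by (simp add: goodS_def)

lemma goodM_qq: "goodT l \<Gamma> A \<Longrightarrow> goodM i l (extC M i \<Gamma> A) (A \<lhd> pp M i \<Gamma> A) (qq M i \<Gamma> A)"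
  using qq_up_ext goodT_sub[OF goodS_pp] qq_tm[OF goodT_D(2)] zm_qq[OF goodT_D(2)] by (simp add: goodM_def)

lemma goodS_spair:
  assumes A: "goodT l \<Delta> A" and s: "goodS \<Gamma> \<Delta> \<sigma>" and t: "goodM i l \<Gamma> (A \<lhd> \<sigma>) t"
  shows "goodS \<Gamma> (extC M i \<Delta> A) (spair M i \<sigma> t)"
proof -
  note T = goodT_D(2)[OF A] and S = goodS_D(3)[OF s] and t' = goodM_D(2)[OF t]
  note uG = goodC_D(2)[OF goodS_D(1)[OF s]]
  have zt': "tm M Ze l (zc \<Gamma>) (zt A \<lhd> zs \<sigma>) (zm t)" using z_tm[OF t'] zt_sub[OF S T] by simp
  have "zs (spair M i \<sigma> t) \<cdot> up \<Gamma> = up (extC M i \<Delta> A) \<cdot> spair M i \<sigma> t"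
    unfolding zs_spair[OF T S t'] spair_comp[OF z_ty[OF T] z_sub[OF S] zt' uG] up_ext_spair[OF A S t']
      goodS_D(4)[OF s] goodM_D(3)[OF t] ..
  then show ?thesis using goodS_D(1)[OF s] goodC_ext[OF A] spair_sub[OF T S t'] by (simp add: goodS_def)
qed

lemma up_extM_eq: "goodC \<Gamma> \<Longrightarrow> up (extM M \<Gamma>) = up \<Gamma> \<cdot> pM M \<Gamma>"
  by (rule up_extM[OF goodC_D(2)])

lemma goodC_extM:
  assumes C: "goodC \<Gamma>"
  shows "goodC (extM M \<Gamma>)"
proof -
  note u = goodC_D(2)[OF C] and G = goodC_D(1)[OF C]
  note p = pM_sub[OF G]
  have "zs (up \<Gamma> \<cdot> pM M \<Gamma>) = sid M (zc \<Gamma>)"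
    using zs_comp[OF u p] goodC_D(3)[OF C] zs_pM[OF G] sid_comp[OF sid_sub[OF z_con[OF G]]] by simp
  then show ?thesis
    using comp_sub[OF u p] goodC_D(4,5)[OF C] by (simp add: goodC_def up_extM_eq[OF C] zc_extM[OF G])
qed

lemma goodS_pM:
  assumes C: "goodC \<Gamma>"
  shows "goodS (extM M \<Gamma>) \<Gamma> (pM M \<Gamma>)"
  using C goodC_extM[OF C] pM_sub[OF goodC_D(1)[OF C]] zs_pM[OF goodC_D(1)[OF C]]
    sid_comp[OF comp_sub[OF goodC_D(2)[OF C] pM_sub[OF goodC_D(1)[OF C]]]]
  by (simp add: goodS_def up_extM_eq[OF C])

lemma goodS_spairM:
  assumes s: "goodS \<Gamma> \<Delta> \<sigma>" and k: "MK M \<Gamma>"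
  shows "goodS \<Gamma> (extM M \<Delta>) (spairM M \<sigma>)"
proof -
  note S = goodS_D(3)[OF s] and D = goodS_D(2)[OF s]
  note sp = spairM_sub[OF S k] and p = pM_sub[OF goodC_D(1)[OF D]]
  have "zs (spairM M \<sigma>) \<cdot> up \<Gamma> = up (extM M \<Delta>) \<cdot> spairM M \<sigma>"
    unfolding zs_spairM[OF S k] up_extM_eq[OF D] comp_assoc[OF goodC_D(2)[OF D] p sp] pM_spairM[OF S k] goodS_D(4)[OF s] ..
  then show ?thesis using goodS_D(1)[OF s] goodC_extM[OF D] sp by (simp add: goodS_def)
qed

text \<open>Weakening by p_# is injective on erased terms, and after it the claim is the goodness of
  \<open>a\<close> itself.\<close>

lemma goodM_dn:
  assumes A: "goodT l \<Gamma> A" and a: "goodM Om l (extM M \<Gamma>) (A \<lhd> pM M \<Gamma>) a"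
  shows "goodM Ze l \<Gamma> A (dn M a)"
proof -
  note C = goodT_D(1)[OF A] and T = goodT_D(2)[OF A] and a' = goodM_D(2)[OF a]
  note G = goodC_D(1)[OF C] and u = goodC_D(2)[OF C]
  note p = pM_sub[OF G]
  have za: "tm M Ze l (zc \<Gamma>) (zt A) (zm a)"
    using z_tm[OF a'] zc_extM[OF G] zt_sub[OF p T] zs_pM[OF G] ty_sid[OF z_ty[OF T]] by simp
  have t: "tm M Ze l \<Gamma> A (zm a \<unlhd> up \<Gamma>)" using tm_sub[OF u za] goodT_D(3)[OF A] by simp
  have "zm a \<unlhd> up \<Gamma> \<unlhd> pM M \<Gamma> = downstar M Om (extM M \<Gamma>) a"
    using goodM_D(3)[OF a] tm_comp[OF u p za] up_extM_eq[OF C] by simp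
  also have "\<dots> = dn M a \<unlhd> pM M \<Gamma>"
    using dn_sub_hash[OF p T a'] hash_pM[OF G] by (simp add: downstar_def)
  finally have "zm a \<unlhd> up \<Gamma> = dn M a" by (rule tm_pM_inj[OF t dn_tm[OF T a']])
  then show ?thesis using A dn_tm[OF T a'] zm_dn[OF T a'] by (simp add: goodM_def downstar_def)
qed

lemma goodM_upc:
  assumes a: "goodM Ze l \<Gamma> A a"
  shows "goodM Om l (extM M \<Gamma>) (A \<lhd> pM M \<Gamma>) (upc M a)"
proof -
  note A = goodM_D(1)[OF a] and a' = goodM_D(2)[OF a]
  note C = goodT_D(1)[OF A]
  note u = goodC_D(2)[OF C] and p = pM_sub[OF goodC_D(1)[OF C]]
  have "zm (upc M a) \<unlhd> up (extM M \<Gamma>) = downstar M Om (extM M \<Gamma>) (upc M a)"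
    using tm_comp[OF u p z_tm[OF a']] zm_upc[OF a'] up_extM_eq[OF C] goodM_D(3)[OF a] downstar_liftT[OF a', of Om]
    by (simp add: downstar_def liftT_def)
  then show ?thesis using goodT_sub[OF goodS_pM[OF C] A] upc_tm[OF a'] by (simp add: goodM_def)
qed

text \<open>The codomain of a zeroed \<Pi>_i or \<Sigma>_i is moved along the comparison; by
  \<open>up_ext_wS\<close>, the lift of \<open>up \<Gamma>\<close> completes this to
  \<open>up\<close> at the extended context, where goodness of \<open>B\<close> applies.\<close>

lemma zt_wS_lift:
  assumes A: "goodT l \<Gamma> A" and B: "goodT k (extC M i \<Gamma> A) B"
  shows "zt B \<lhd> wS M i (zc \<Gamma>) (zt A) \<lhd> liftS M i \<Gamma> (zt A) (up \<Gamma>) = B"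
proof -
  note T = goodT_D(2)[OF A]
  have zB: "ty M k (extC M Ze (zc \<Gamma>) (zt A)) (zt B)" using z_ty[OF goodT_D(2)[OF B]] zc_ext[OF T] by simp
  note l = lift_sub[OF goodC_D(2)[OF goodT_D(1)[OF A]] z_ty[OF T]]
  show ?thesis
    using ty_comp[OF wS_sub[OF z_ty[OF T]] l zB] up_ext_wS[OF A] goodT_D(3)[OF B] by simp
qed

lemma zm_wS_lift:
  assumes A: "goodT l \<Gamma> A" and t: "tm M j k (extC M i \<Gamma> A) B t"
  shows "zm t \<unlhd> wS M i (zc \<Gamma>) (zt A) \<unlhd> liftS M i \<Gamma> (zt A) (up \<Gamma>) = zm t \<unlhd> up (extC M i \<Gamma> A)"
proof -
  note T = goodT_D(2)[OF A]
  have zt': "tm M Ze k (extC M Ze (zc \<Gamma>) (zt A)) (zt B) (zm t)" using z_tm[OF t] zc_ext[OF T] by simp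
  note l = lift_sub[OF goodC_D(2)[OF goodT_D(1)[OF A]] z_ty[OF T]]
  show ?thesis
    using tm_comp[OF wS_sub[OF z_ty[OF T]] l zt'] up_ext_wS[OF A] by simp
qed

lemma z_wS:
  assumes A: "ty M l \<Gamma> A" and B: "ty M k (extC M i \<Gamma> A) B"
  shows "ty M k (extC M i (zc \<Gamma>) (zt A)) (zt B \<lhd> wS M i (zc \<Gamma>) (zt A))"
  using ty_sub[OF wS_sub[OF z_ty[OF A]]] z_ty[OF B] zc_ext[OF A] by simp

lemma goodT_PI:
  assumes A: "goodT l \<Gamma> A" and B: "goodT l (extC M i \<Gamma> A) B"
  shows "goodT l \<Gamma> (PI M i \<Gamma> A B)" "goodT l \<Gamma> (SG M i \<Gamma> A B)"
proof -
  note C = goodT_D(1)[OF A] and T = goodT_D(2)[OF A] and TB = goodT_D(2)[OF B]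
  note u = goodC_D(2)[OF C]
  have "zt (PI M i \<Gamma> A B) \<lhd> up \<Gamma> = PI M i \<Gamma> A B"
    unfolding zt_PI[OF T TB] PI_sub[OF u z_ty[OF T] z_wS[OF T TB]] zt_wS_lift[OF A B] goodT_D(3)[OF A] ..
  then show "goodT l \<Gamma> (PI M i \<Gamma> A B)" using C PI_ty[OF T TB] by (simp add: goodT_def)
  have "zt (SG M i \<Gamma> A B) \<lhd> up \<Gamma> = SG M i \<Gamma> A B"
    unfolding zt_SG[OF T TB] SG_sub[OF u z_ty[OF T] z_wS[OF T TB]] zt_wS_lift[OF A B] goodT_D(3)[OF A] ..
  then show "goodT l \<Gamma> (SG M i \<Gamma> A B)" using C SG_ty[OF T TB] by (simp add: goodT_def)
qed

lemma zm_lam_up: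
  assumes A: "goodT l \<Gamma> A" and B: "goodT l (extC M i \<Gamma> A) B" and t: "tm M Om l (extC M i \<Gamma> A) B t"
  shows "zm (lam M i \<Gamma> A B t) \<unlhd> up \<Gamma> = lam0 M i \<Gamma> A B (zm t \<unlhd> up (extC M i \<Gamma> A))"
proof -
  note C = goodT_D(1)[OF A] and T = goodT_D(2)[OF A]
  have zt': "tm M Ze l (extC M Ze (zc \<Gamma>) (zt A)) (zt B) (zm t)" using z_tm[OF t] zc_ext[OF T] by simp
  show ?thesis
    unfolding zm_lam[OF T t] lam0_sub[OF goodC_D(2)[OF C] z_ty[OF T] tm_sub[OF wS_sub[OF z_ty[OF T]] zt']]
      zt_wS_lift[OF A B] zm_wS_lift[OF A t] goodT_D(3)[OF A] ..
qed

lemma goodM_lam: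
  assumes A: "goodT l \<Gamma> A" and t: "goodM Om l (extC M i \<Gamma> A) B t"
  shows "goodM Om l \<Gamma> (PI M i \<Gamma> A B) (lam M i \<Gamma> A B t)"
proof -
  note B = goodM_D(1)[OF t] and T = goodT_D(2)[OF A] and t' = goodM_D(2)[OF t]
  have "zm (lam M i \<Gamma> A B t) \<unlhd> up \<Gamma> = downstar M Om \<Gamma> (lam M i \<Gamma> A B t)"
    unfolding zm_lam_up[OF A B t'] goodM_D(3)[OF t] by (rule lam0_downstar[OF T t'])
  then show ?thesis using goodT_PI(1)[OF A B] lam_tm[OF T t'] by (simp add: goodM_def)
qed

lemma goodM_app:
  assumes A: "goodT l \<Gamma> A" and B: "goodT l (extC M i \<Gamma> A) B" and t: "goodM Om l \<Gamma> (PI M i \<Gamma> A B) t"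
  shows "goodM Om l (extC M i \<Gamma> A) B (app M i \<Gamma> A B t)"
proof -
  note T = goodT_D(2)[OF A] and TB = goodT_D(2)[OF B] and t' = goodM_D(2)[OF t]
  define s where "s = app M i \<Gamma> A B t"
  have s: "tm M Om l (extC M i \<Gamma> A) B s" unfolding s_def by (rule app_tm[OF T TB t'])
  have ls: "lam M i \<Gamma> A B s = t" unfolding s_def by (rule lam_app[OF T TB t'])
  have zs': "tm M Ze l (extC M i \<Gamma> A) B (zm s \<unlhd> up (extC M i \<Gamma> A))"
    using tm_sub[OF goodC_D(2)[OF goodT_D(1)[OF B]] z_tm[OF s]] goodT_D(3)[OF B] by simp
  \<comment> \<open>With t = lam s, both sides are the erasure of \<open>t\<close>: one by goodness
    of \<open>t\<close>, the other by \<open>lam0_downstar\<close>. Injectivity of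
    \<open>lam0\<close> then gives the claim for \<open>s\<close>.\<close>
  have "lam0 M i \<Gamma> A B (zm s \<unlhd> up (extC M i \<Gamma> A)) = lam0 M i \<Gamma> A B (downstar M Om (extC M i \<Gamma> A) s)"
    unfolding zm_lam_up[OF A B s, symmetric] lam0_downstar[OF T s] ls by (rule goodM_D(3)[OF t])
  then have "zm s \<unlhd> up (extC M i \<Gamma> A) = downstar M Om (extC M i \<Gamma> A) s"
    by (rule lam0_inj[OF T zs' downstar_tm[OF s]])
  then show ?thesis unfolding s_def[symmetric] using B s by (simp add: goodM_def)
qed

lemma zt_sid_spair:
  assumes x: "tm M i l \<Gamma> A x" and B: "ty M k (extC M i \<Gamma> A) B"
  shows "zt (B \<lhd> spair M i (sid M \<Gamma>) x) = zt B \<lhd> spair M Ze (sid M (zc \<Gamma>)) (zm x)"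
proof -
  note A = tm_ty[OF x] and G = tm_con[OF x]
  have x': "tm M i l \<Gamma> (A \<lhd> sid M \<Gamma>) x" using x ty_sid[OF A] by simp
  show ?thesis
    unfolding zt_sub[OF sid_spair_sub[OF x] B] zs_spair[OF A sid_sub[OF G] x'] zs_sid[OF G] ..
qed

lemma zm_tpair_up:
  assumes B: "goodT l (extC M i \<Gamma> A) B" and A: "goodT l \<Gamma> A" and x: "tm M i l \<Gamma> A x"
    and b: "tm M Om l \<Gamma> (B \<lhd> spair M i (sid M \<Gamma>) x) b"
  shows "zm (tpair M i \<Gamma> A B x b) \<unlhd> up \<Gamma> = pair0 M i \<Gamma> A B (zm x \<unlhd> up \<Gamma>) (zm b \<unlhd> up \<Gamma>)"
proof -
  note T = goodT_D(2)[OF A] and TB = goodT_D(2)[OF B]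
  have zB: "ty M l (extC M Ze (zc \<Gamma>) (zt A)) (zt B)" using z_ty[OF TB] zc_ext[OF T] by simp
  have zb: "tm M Ze l (zc \<Gamma>) (zt B \<lhd> spair M Ze (sid M (zc \<Gamma>)) (zm x)) (zm b)"
    using z_tm[OF b] zt_sid_spair[OF x TB] by simp
  show ?thesis
    unfolding zm_tpair[OF TB x b]
      pair0_sub[OF goodC_D(2)[OF goodT_D(1)[OF A]] z_tm[OF x] z_wS[OF T TB] zb ty_wS_pM_spair[OF z_tm[OF x] zB]]
      zt_wS_lift[OF A B] goodT_D(3)[OF A] ..
qed

lemma goodM_tpair:
  assumes B: "goodT l (extC M i \<Gamma> A) B" and x: "goodM i l \<Gamma> A x" and b: "goodM Om l \<Gamma> (B \<lhd> spair M i (sid M \<Gamma>) x) b"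
  shows "goodM Om l \<Gamma> (SG M i \<Gamma> A B) (tpair M i \<Gamma> A B x b)"
proof -
  note A = goodM_D(1)[OF x] and x' = goodM_D(2)[OF x] and b' = goodM_D(2)[OF b] and TB = goodT_D(2)[OF B]
  have "zm (tpair M i \<Gamma> A B x b) \<unlhd> up \<Gamma> = downstar M Om \<Gamma> (tpair M i \<Gamma> A B x b)"
    unfolding zm_tpair_up[OF B A x' b'] goodM_D(3)[OF x] goodM_D(3)[OF b] by (rule pair0_downstar[OF TB x' b'])
  then show ?thesis using goodT_PI(2)[OF A B] tpair_tm[OF TB x' b'] by (simp add: goodM_def)
qed

text \<open>In \<open>goodM_proj\<close> the goodness of the first projection is still to be proved,
  so the type of the zeroed second projection is expressed through \<open>zm x\<close> and not
  through the erasure of \<open>x\<close>. This is the type condition under which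
  \<open>pair0_inj\<close> applies.\<close>

lemma zt_spair_up_pM:
  assumes A: "goodT l \<Gamma> A" and B: "goodT k (extC M i \<Gamma> A) B" and x: "tm M i l \<Gamma> A x"
  shows "zt (B \<lhd> spair M i (sid M \<Gamma>) x) \<lhd> up \<Gamma> \<lhd> pM M \<Gamma> = B \<lhd> spair M i (pM M \<Gamma>) (liftT M i \<Gamma> (zm x \<unlhd> up \<Gamma>))"
proof -
  note C = goodT_D(1)[OF A] and T = goodT_D(2)[OF A] and TB = goodT_D(2)[OF B]
  note u = goodC_D(2)[OF C] and p = pM_sub[OF goodC_D(1)[OF C]] and zA = z_ty[OF T] and zx = z_tm[OF x]
  note id = sid_sub[OF ty_con[OF zA]]
  have zB: "ty M k (extC M Ze (zc \<Gamma>) (zt A)) (zt B)" using z_ty[OF TB] zc_ext[OF T] by simp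
  have y: "tm M Ze l \<Gamma> A (zm x \<unlhd> up \<Gamma>)" using tm_sub[OF u zx] goodT_D(3)[OF A] by simp
  have zx': "tm M Ze l (zc \<Gamma>) (zt A \<lhd> sid M (zc \<Gamma>)) (zm x)" using zx ty_sid[OF zA] by simp
  note up = comp_sub[OF u p]
  have E: "sub M (extC M i \<Gamma> A) (extC M Ze (zc \<Gamma>) (zt A)) (up (extC M i \<Gamma> A))" using up_ext_sub[OF A, of i] zc_ext[OF T] by simp
  have "zt (B \<lhd> spair M i (sid M \<Gamma>) x) \<lhd> up \<Gamma> \<lhd> pM M \<Gamma> = zt B \<lhd> spair M Ze (up \<Gamma> \<cdot> pM M \<Gamma>) (zm x \<unlhd> up \<Gamma> \<unlhd> pM M \<Gamma>)"
    unfolding zt_sid_spair[OF x TB] ty_comp[OF u p ty_sub[OF sid_spair_sub[OF zx] zB], symmetric]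
      ty_comp[OF sid_spair_sub[OF zx] up zB, symmetric] spair_comp[OF zA id zx' up] sid_comp[OF up] tm_comp[OF u p zx] ..
  also have "\<dots> = zt B \<lhd> up (extC M i \<Gamma> A) \<lhd> spair M i (pM M \<Gamma>) (liftT M i \<Gamma> (zm x \<unlhd> up \<Gamma>))"
    unfolding ty_comp[OF E pM_liftT_sub[OF y] zB, symmetric] up_ext_spair[OF A p liftT_tm[OF y]] downstar_liftT[OF y] ..
  finally show ?thesis unfolding goodT_D(3)[OF B] .
qed

lemma goodM_proj:
  assumes A: "goodT l \<Gamma> A" and B: "goodT l (extC M i \<Gamma> A) B" and t: "goodM Om l \<Gamma> (SG M i \<Gamma> A B) t"
  defines "x \<equiv> fst (proj M i \<Gamma> A B t)" and "b \<equiv> snd (proj M i \<Gamma> A B t)"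
  shows "goodM i l \<Gamma> A x" "goodM Om l \<Gamma> (B \<lhd> spair M i (sid M \<Gamma>) x) b"
proof -
  note T = goodT_D(2)[OF A] and TB = goodT_D(2)[OF B] and t' = goodM_D(2)[OF t]
  note u = goodC_D(2)[OF goodT_D(1)[OF A]]
  have x: "tm M i l \<Gamma> A x" unfolding x_def by (rule fst_proj_tm[OF T TB t'])
  have b: "tm M Om l \<Gamma> (B \<lhd> spair M i (sid M \<Gamma>) x) b" unfolding x_def b_def by (rule snd_proj_tm[OF T TB t'])
  have p: "tpair M i \<Gamma> A B x b = t" unfolding x_def b_def by (rule tpair_proj[OF T TB t'])
  have zx: "tm M Ze l \<Gamma> A (zm x \<unlhd> up \<Gamma>)" using tm_sub[OF u z_tm[OF x]] goodT_D(3)[OF A] by simp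
  have "pair0 M i \<Gamma> A B (zm x \<unlhd> up \<Gamma>) (zm b \<unlhd> up \<Gamma>) = pair0 M i \<Gamma> A B (downstar M i \<Gamma> x) (downstar M Om \<Gamma> b)"
    unfolding zm_tpair_up[OF B A x b, symmetric] pair0_downstar[OF TB x b] p by (rule goodM_D(3)[OF t])
  then have *: "zm x \<unlhd> up \<Gamma> = downstar M i \<Gamma> x \<and> zm b \<unlhd> up \<Gamma> = downstar M Om \<Gamma> b"
    by (rule pair0_inj[OF zx downstar_tm[OF x] TB tm_sub[OF u z_tm[OF b]] zt_spair_up_pM[OF A B x]
        downstar_tm[OF b] ty_pM_spair_downstar[OF x TB]])
  then show gx: "goodM i l \<Gamma> A x" using A x by (simp add: goodM_def)
  \<comment> \<open>Only now, with the first projection good, is (id, x) a good substitution, and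
    therefore the type of the second projection good.\<close>
  have gx': "goodM i l \<Gamma> (A \<lhd> sid M \<Gamma>) x" using gx ty_sid[OF T] by simp
  have "goodT l \<Gamma> (B \<lhd> spair M i (sid M \<Gamma>) x)"
    by (rule goodT_sub[OF goodS_spair[OF A goodS_sid[OF goodT_D(1)[OF A]] gx'] B])
  then show "goodM Om l \<Gamma> (B \<lhd> spair M i (sid M \<Gamma>) x) b" using b * by (simp add: goodM_def)
qed

lemma goodT_UU: "goodC \<Gamma> \<Longrightarrow> goodT (Suc l) \<Gamma> (UU M l \<Gamma>)"
  using UU_sub[OF goodC_D(2)] zt_UU[OF goodC_D(1)] UU_ty[OF goodC_D(1)] by (simp add: goodT_def)

lemma goodT_EL:
  assumes a: "goodM Ze (Suc l) \<Gamma> (UU M l \<Gamma>) a"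
  shows "goodT l \<Gamma> (EL M a)"
proof -
  note C = goodT_D(1)[OF goodM_D(1)[OF a]] and a' = goodM_D(2)[OF a]
  have za: "tm M Ze (Suc l) (zc \<Gamma>) (UU M l (zc \<Gamma>)) (zm a)" using z_tm[OF a'] zt_UU[OF goodC_D(1)[OF C]] by simp
  have "zt (EL M a) \<lhd> up \<Gamma> = EL M a"
    unfolding zt_EL[OF a'] EL_sub[OF goodC_D(2)[OF C] za] goodM_D(3)[OF a] by (simp add: downstar_def)
  then show ?thesis using C EL_ty[OF a'] by (simp add: goodT_def)
qed

lemma goodM_code:
  assumes A: "goodT l \<Gamma> A"
  shows "goodM Ze (Suc l) \<Gamma> (UU M l \<Gamma>) (codeU M A)"
proof -
  note C = goodT_D(1)[OF A] and T = goodT_D(2)[OF A]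
  have "zm (codeU M A) \<unlhd> up \<Gamma> = codeU M A"
    unfolding zm_code[OF T] code_sub[OF goodC_D(2)[OF C] z_ty[OF T]] goodT_D(3)[OF A] ..
  then show ?thesis using goodT_UU[OF C] code_tm[OF T] by (simp add: goodM_def downstar_def)
qed

end

section \<open>The submodel of liftable data\<close>

context zeroing
begin

text \<open>\<open>TM\<close> records only the condition on the term; the goodness of its type
  enters through \<open>TY\<close>, so that the term judgement of this model is exactly
  \<open>goodM\<close>.\<close>

definition good_model :: "('c,'s,'t,'m) tt0" where
  "good_model = M\<lparr>CON := {\<Gamma>. goodC \<Gamma>}, SUB := (\<lambda>\<Gamma> \<Delta>. {\<sigma>. goodS \<Gamma> \<Delta> \<sigma>}), TY := (\<lambda>l \<Gamma>. {A. goodT l \<Gamma> A}),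
     TM := (\<lambda>i \<Gamma> A. {a \<in> TM M i \<Gamma> A. zm a \<unlhd> up \<Gamma> = downstar M i \<Gamma> a})\<rparr>"

lemma good_model_sel:
  "\<Gamma> \<in> CON good_model \<longleftrightarrow> goodC \<Gamma>" "sid good_model = sid M" "scomp good_model = scomp M" "emp good_model = emp M"
  "epsS good_model = epsS M" "tsub good_model = tsub M" "msub good_model = msub M" "MK good_model = MK M"
  "extC good_model = extC M" "pp good_model = pp M" "qq good_model = qq M" "spair good_model = spair M"
  "extM good_model = extM M" "pM good_model = pM M" "spairM good_model = spairM M" "dn good_model = dn M"
  "upc good_model = upc M" "PI good_model = PI M" "SG good_model = SG M" "lam good_model = lam M" "app good_model = app M"
  "tpair good_model = tpair M" "proj good_model = proj M" "UU good_model = UU M" "EL good_model = EL M" "codeU good_model = codeU M"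
  by (simp_all add: good_model_def)

lemma good_model_judgements:
  "sub good_model = goodS" "ty good_model = goodT" "tm good_model = goodM"
  by (auto simp: good_model_def judgement_defs goodS_def goodT_def goodM_def fun_eq_iff)

lemma good_model_liftS: "liftS good_model = liftS M"
  by (simp add: liftS_def good_model_sel fun_eq_iff)

lemmas good_model_simps = good_model_sel good_model_judgements good_model_liftS

lemma good_model_tt0_model: "tt0_model good_model"
  by (unfold_locales, unfold good_model_simps)
    ((rule goodS_sid goodS_comp goodC_emp goodS_eps goodT_sub goodM_sub goodS_pp goodM_qq goodS_spair goodS_pM goodS_spairM
        goodM_dn goodM_upc goodT_PI goodM_lam goodM_app goodM_tpair goodM_proj goodT_UU goodT_EL goodM_code; assumption) |
     (rule sid_comp comp_sid comp_assoc eps_unique ty_sid ty_comp tm_sid tm_comp mk_sub pp_spair qq_spair spair_eta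
        extM_mk pM_spairM spairM_eta upc_dn dn_upc dn_sub app_lam lam_app proj_tpair tpair_proj PI_sub SG_sub lam_sub
        tpair_sub code_EL EL_code UU_sub EL_sub;
      (assumption | erule goodS_D(3) goodT_D(2) goodM_D(2) goodC_D(1))))+

lemma all_good:
  shows "\<Gamma> \<in> CON M \<Longrightarrow> goodC \<Gamma>" "sub M \<Gamma> \<Delta> \<sigma> \<Longrightarrow> goodS \<Gamma> \<Delta> \<sigma>" "ty M l \<Gamma> A \<Longrightarrow> goodT l \<Gamma> A"
    "tm M i l \<Gamma> A a \<Longrightarrow> goodM i l \<Gamma> A a"
proof -
  obtain G where "tt0_morph M good_model G" by (rule morph_ex[OF good_model_tt0_model])
  then interpret G: tt0_morph M good_model G .
  note eqs = G.hC_mk G.hS_sid G.hS_comp G.hC_emp G.hS_eps G.hT_sub G.hM_sub G.hC_ext G.hS_pp G.hM_qq G.hS_spair G.hC_extM G.hS_pM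
    G.hS_spairM G.hM_dn G.hM_upc G.hT_PI G.hT_SG G.hM_lam G.hM_app G.hM_tpair G.hM_proj G.hT_UU G.hT_EL G.hM_code
  \<comment> \<open>The submodel shares its operations with \<open>M\<close>, so the same components
    form an endomorphism of \<open>M\<close>. It is the identity, and thus every datum equals its
    image, which is good.\<close>
  have "tt0_morph M M G"
    by unfold_locales
      (rule goodC_D(1)[OF G.hC_con[unfolded good_model_sel]] goodS_D(3)[OF G.hS_sub[unfolded good_model_judgements]]
        goodT_D(2)[OF G.hT_ty[unfolded good_model_judgements]] goodM_D(2)[OF G.hM_tm[unfolded good_model_judgements]]
        eqs[unfolded good_model_sel]; assumption)+
  note id = endo_id[OF this]
  show C: "goodC \<Gamma>" if "\<Gamma> \<in> CON M" for \<Gamma>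
    using G.hC_con[OF that] id(1)[OF that] by (simp add: good_model_sel)
  show "goodS \<Gamma> \<Delta> \<sigma>" if "sub M \<Gamma> \<Delta> \<sigma>"
    using G.hS_sub[OF that] unfolding good_model_judgements id(1)[OF sub_con(1)[OF that]] id(1)[OF sub_con(2)[OF that]] id(2)[OF that] .
  show "goodT l \<Gamma> A" if "ty M l \<Gamma> A"
    using G.hT_ty[OF that] unfolding good_model_judgements id(1)[OF ty_con[OF that]] id(3)[OF that] .
  show "goodM i l \<Gamma> A a" if "tm M i l \<Gamma> A a"
    using G.hM_tm[OF that] unfolding good_model_judgements id(1)[OF tm_con[OF that]] id(3)[OF tm_ty[OF that]] id(4)[OF that] .
qed

text \<open>Zeroing \<open>A' \<lhd> up \<Gamma>\<close> leaves \<open>zt A'\<close>, since it turns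
  \<open>up \<Gamma>\<close> into the identity. Goodness of \<open>A'\<close> over
  \<open>zc \<Gamma>\<close>, where \<open>up\<close> is the identity, gives
  \<open>zt A' = A'\<close>; the argument for terms is the same.\<close>

lemma
  assumes G: "\<Gamma> \<in> CON M"
  shows ty_up: "ty M l (zc \<Gamma>) A' \<Longrightarrow> ty M l \<Gamma> (A' \<lhd> up \<Gamma>)"
    and zt_up: "ty M l (zc \<Gamma>) A' \<Longrightarrow> zt (A' \<lhd> up \<Gamma>) = A'"
    and tm_up: "ty M l \<Gamma> A \<Longrightarrow> tm M i l (zc \<Gamma>) (zt A) a' \<Longrightarrow> tm M i l \<Gamma> A (a' \<unlhd> up \<Gamma>)"
    and zm_up: "ty M l \<Gamma> A \<Longrightarrow> tm M Ze l (zc \<Gamma>) (zt A) a' \<Longrightarrow> zm (a' \<unlhd> up \<Gamma>) = a'"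
proof -
  note C = all_good(1)[OF G] and Cz = all_good(1)[OF z_con[OF G]]
  note u = goodC_D(2)[OF C]
  show "ty M l \<Gamma> (A' \<lhd> up \<Gamma>)" if "ty M l (zc \<Gamma>) A'" using ty_sub[OF u that] .
  show "zt (A' \<lhd> up \<Gamma>) = A'" if "ty M l (zc \<Gamma>) A'"
    using zt_sub[OF u that] goodT_D(3)[OF all_good(3)[OF that]] goodC_D(3,5)[OF C] by simp
  show "tm M i l \<Gamma> A (a' \<unlhd> up \<Gamma>)" if "ty M l \<Gamma> A" "tm M i l (zc \<Gamma>) (zt A) a'"
    using tm_sub[OF u that(2)] goodT_D(3)[OF all_good(3)[OF that(1)]] by simp
  show "zm (a' \<unlhd> up \<Gamma>) = a'" if "ty M l \<Gamma> A" "tm M Ze l (zc \<Gamma>) (zt A) a'"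
    using zm_sub[OF u that(2)] goodM_D(3)[OF all_good(4)[OF that(2)]] goodC_D(3,5)[OF C] by (simp add: downstar_def)
qed

lemma bij_zt:
  assumes G: "\<Gamma> \<in> CON M"
  shows "bij_betw zt (TY M l \<Gamma>) (TY M l (zc \<Gamma>))"
proof (rule bij_betw_byWitness[where f' = "\<lambda>A'. A' \<lhd> up \<Gamma>"])
  have T: "ty M l \<Gamma> A \<longleftrightarrow> A \<in> TY M l \<Gamma>" "ty M l (zc \<Gamma>) A \<longleftrightarrow> A \<in> TY M l (zc \<Gamma>)" for A
    using G z_con[OF G] by (auto simp: ty_def)
  show "\<forall>A\<in>TY M l \<Gamma>. zt A \<lhd> up \<Gamma> = A" using goodT_D(3)[OF all_good(3)] T by blast
  show "\<forall>A'\<in>TY M l (zc \<Gamma>). zt (A' \<lhd> up \<Gamma>) = A'" using zt_up[OF G] T by blast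
  show "zt ` TY M l \<Gamma> \<subseteq> TY M l (zc \<Gamma>)" using z_ty T by blast
  show "(\<lambda>A'. A' \<lhd> up \<Gamma>) ` TY M l (zc \<Gamma>) \<subseteq> TY M l \<Gamma>" using ty_up[OF G] T by blast
qed

lemma bij_zm:
  assumes A: "ty M l \<Gamma> A"
  shows "bij_betw zm (TM M Ze \<Gamma> A) (TM M Ze (zc \<Gamma>) (zt A))"
proof (rule bij_betw_byWitness[where f' = "\<lambda>a'. a' \<unlhd> up \<Gamma>"])
  note G = ty_con[OF A]
  have T: "tm M Ze l \<Gamma> A a \<longleftrightarrow> a \<in> TM M Ze \<Gamma> A" "tm M Ze l (zc \<Gamma>) (zt A) a \<longleftrightarrow> a \<in> TM M Ze (zc \<Gamma>) (zt A)" for a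
    using A z_ty[OF A] by (auto simp: judgement_defs)
  show "\<forall>a\<in>TM M Ze \<Gamma> A. zm a \<unlhd> up \<Gamma> = a" using goodM_D(3)[OF all_good(4)] T by (fastforce simp: downstar_def)
  show "\<forall>a'\<in>TM M Ze (zc \<Gamma>) (zt A). zm (a' \<unlhd> up \<Gamma>) = a'" using zm_up[OF G A] T by blast
  show "zm ` TM M Ze \<Gamma> A \<subseteq> TM M Ze (zc \<Gamma>) (zt A)" using z_tm T by blast
  show "(\<lambda>a'. a' \<unlhd> up \<Gamma>) ` TM M Ze (zc \<Gamma>) (zt A) \<subseteq> TM M Ze \<Gamma> A" using tm_up[OF G A] T by blast
qed

end

lemma (in initial_tt0_model) zeroing_ex:
  assumes F: "tt0_morph M (zero_model M) F"
  shows "\<exists>up. zeroing M F up"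
proof (cases "finite (UNIV :: 'c set)")
  case True
  have single: "x = y" for x y :: 'c by (rule finite_contexts_trivial[OF True])
  interpret F: tt0_morph M "zero_model M" F by (rule F)
  \<comment> \<open>All contexts coincide and parallel substitutions agree, so it is enough to type
    both sides between the same contexts. The premise \<open>e\<close> yields
    \<open>hT F A = A\<close>, which types the right-hand side.\<close>
  have 1: "sid M (extC M i \<Gamma> A) = spair M Ze (sid M \<Gamma> \<cdot> pp M i \<Gamma> A) (downstar M i (extC M i \<Gamma> A) (qq M i \<Gamma> A))"
    if A: "ty M l \<Gamma> A" and e: "hT F A \<lhd> sid M \<Gamma> = A" for i l \<Gamma> A
  proof -
    have zA: "ty M l \<Gamma> (hT F A)" using F.hT_ty[OF A] single[of \<Gamma> "hC F \<Gamma>"] by (simp add: zero_model_simps)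
    then have "hT F A = A" using ty_sid[OF zA] e by simp
    then have "sub M (extC M i \<Gamma> A) (extC M Ze \<Gamma> A) (spair M Ze (sid M \<Gamma> \<cdot> pp M i \<Gamma> A) (downstar M i (extC M i \<Gamma> A) (qq M i \<Gamma> A)))"
      using spair_sub[OF A pp_sub[OF A] downstar_tm[OF qq_tm[OF A]]] sid_comp[OF pp_sub[OF A]] by simp
    moreover have "sub M (extC M i \<Gamma> A) (extC M Ze \<Gamma> A) (sid M (extC M i \<Gamma> A))"
      using sid_sub[OF ext_con[OF A]] single[of "extC M i \<Gamma> A" "extC M Ze \<Gamma> A"] by metis
    ultimately show ?thesis using single_context(1)[OF single] by blast
  qed
  have 2: "sid M (extM M \<Gamma>) = sid M \<Gamma> \<cdot> pM M \<Gamma>" if "\<Gamma> \<in> CON M" for \<Gamma>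
  proof -
    have "sub M (extM M \<Gamma>) \<Gamma> (sid M (extM M \<Gamma>))"
      using sid_sub[OF extM_con[OF that]] single[of "extM M \<Gamma>" \<Gamma>] by metis
    then show ?thesis using single_context(1)[OF single _ pM_sub[OF that]] sid_comp[OF pM_sub[OF that]] by metis
  qed
  have "zeroing_axioms M F (sid M)"
    by (intro zeroing_axioms.intro 1 2 sub_con(1)) auto
  then show ?thesis using F initial_tt0_model_axioms zeroing.intro by blast
next
  case False
  define f :: 'c where "f = undefined"
  \<comment> \<open>An infinite type is in bijection with the complement of a point; that point is
    the spare label.\<close>
  obtain \<iota> :: "'c \<Rightarrow> 'c" where "bij_betw \<iota> UNIV (UNIV - {f})" using infinite_imp_bij_betw[OF False, of f] by blast
  then have iota: "inj \<iota>" "f \<notin> range \<iota>" by (auto simp: bij_betw_def)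
  obtain up where up: "up (emp M) = sid M (emp M)"
    "\<And>i l \<Gamma> A. ty M l \<Gamma> A \<Longrightarrow> up (extC M i \<Gamma> A) = spair M Ze (up \<Gamma> \<cdot> pp M i \<Gamma> A) (downstar M i (extC M i \<Gamma> A) (qq M i \<Gamma> A))"
    "\<And>\<Gamma>. \<Gamma> \<in> CON M \<Longrightarrow> up (extM M \<Gamma>) = up \<Gamma> \<cdot> pM M \<Gamma>"
    by (rule context_recursion[OF iota, of "sid M (emp M)"
          "\<lambda>i \<Gamma> A u. spair M Ze (u \<cdot> pp M i \<Gamma> A) (downstar M i (extC M i \<Gamma> A) (qq M i \<Gamma> A))" "\<lambda>\<Gamma> u. u \<cdot> pM M \<Gamma>"]) blast
  have "zeroing_axioms M F up" by (intro zeroing_axioms.intro up sub_con(1))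
  then show ?thesis using F initial_tt0_model_axioms zeroing.intro by blast
qed

theorem mainTheorem1:
  fixes M :: "('c,'s,'t,'m) tt0"
  assumes "is_initial M"
  shows "(\<exists>F. is_morph M (zero_model M) F) \<and>
    (\<forall>F. is_morph M (zero_model M) F \<longrightarrow>
      (\<exists>up :: 'c \<Rightarrow> 's. \<forall>\<Gamma>\<in>CON M.
         hC F (hC F \<Gamma>) = hC F \<Gamma> \<and>
         up \<Gamma> \<in> SUB M \<Gamma> (hC F \<Gamma>) \<and>
         hS F (up \<Gamma>) = sid M (hC F \<Gamma>) \<and>
         (\<forall>l. \<forall>A\<in>TY M l \<Gamma>. tsub M (hT F A) (up \<Gamma>) = A) \<and>
         (\<forall>i l. \<forall>A\<in>TY M l \<Gamma>. \<forall>a\<in>TM M i \<Gamma> A. msub M (hM F a) (up \<Gamma>) = downstar M i \<Gamma> a) \<and>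
         (\<forall>l. bij_betw (hT F) (TY M l \<Gamma>) (TY M l (hC F \<Gamma>)) \<and>
              (\<forall>A'\<in>TY M l (hC F \<Gamma>). hT F (tsub M A' (up \<Gamma>)) = A') \<and>
              (\<forall>\<Delta>\<in>CON M. \<forall>\<sigma>\<in>SUB M \<Gamma> \<Delta>. \<forall>A'\<in>TY M l (hC F \<Delta>).
                 tsub M (tsub M A' (hS F \<sigma>)) (up \<Gamma>) = tsub M (tsub M A' (up \<Delta>)) \<sigma>)) \<and>
         (\<forall>l. \<forall>A\<in>TY M l \<Gamma>.
              bij_betw (hM F) (TM M Ze \<Gamma> A) (TM M Ze (hC F \<Gamma>) (hT F A)) \<and>
              (\<forall>a'\<in>TM M Ze (hC F \<Gamma>) (hT F A). hM F (msub M a' (up \<Gamma>)) = a') \<and>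
              (\<forall>\<Delta>\<in>CON M. \<forall>\<sigma>\<in>SUB M \<Gamma> \<Delta>. \<forall>B\<in>TY M l \<Delta>. \<forall>b'\<in>TM M Ze (hC F \<Delta>) (hT F B).
                 msub M (msub M b' (hS F \<sigma>)) (up \<Gamma>) = msub M (msub M b' (up \<Delta>)) \<sigma>))))"
proof -
  interpret initial_tt0_model M by unfold_locales (rule assms)
  have "\<exists>F. is_morph M (zero_model M) F"
    using morph_ex[OF zero_model_tt0_model] tt0_morph_imp_is_morph by metis
  moreover have "\<exists>up. \<forall>\<Gamma>\<in>CON M.
         hC F (hC F \<Gamma>) = hC F \<Gamma> \<and>
         up \<Gamma> \<in> SUB M \<Gamma> (hC F \<Gamma>) \<and>
         hS F (up \<Gamma>) = sid M (hC F \<Gamma>) \<and>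
         (\<forall>l. \<forall>A\<in>TY M l \<Gamma>. tsub M (hT F A) (up \<Gamma>) = A) \<and>
         (\<forall>i l. \<forall>A\<in>TY M l \<Gamma>. \<forall>a\<in>TM M i \<Gamma> A. msub M (hM F a) (up \<Gamma>) = downstar M i \<Gamma> a) \<and>
         (\<forall>l. bij_betw (hT F) (TY M l \<Gamma>) (TY M l (hC F \<Gamma>)) \<and>
              (\<forall>A'\<in>TY M l (hC F \<Gamma>). hT F (tsub M A' (up \<Gamma>)) = A') \<and>
              (\<forall>\<Delta>\<in>CON M. \<forall>\<sigma>\<in>SUB M \<Gamma> \<Delta>. \<forall>A'\<in>TY M l (hC F \<Delta>).
                 tsub M (tsub M A' (hS F \<sigma>)) (up \<Gamma>) = tsub M (tsub M A' (up \<Delta>)) \<sigma>)) \<and>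
         (\<forall>l. \<forall>A\<in>TY M l \<Gamma>.
              bij_betw (hM F) (TM M Ze \<Gamma> A) (TM M Ze (hC F \<Gamma>) (hT F A)) \<and>
              (\<forall>a'\<in>TM M Ze (hC F \<Gamma>) (hT F A). hM F (msub M a' (up \<Gamma>)) = a') \<and>
              (\<forall>\<Delta>\<in>CON M. \<forall>\<sigma>\<in>SUB M \<Gamma> \<Delta>. \<forall>B\<in>TY M l \<Delta>. \<forall>b'\<in>TM M Ze (hC F \<Delta>) (hT F B).
                 msub M (msub M b' (hS F \<sigma>)) (up \<Gamma>) = msub M (msub M b' (up \<Delta>)) \<sigma>))"
    if F: "is_morph M (zero_model M) F" for F
  proof -
    obtain up where "zeroing M F up" using zeroing_ex is_morph_imp_tt0_morph[OF tt0_model_axioms F] by blast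
    then interpret zeroing M F up .
    show ?thesis
    proof (intro exI ballI conjI allI)
      fix \<Gamma> assume G: "\<Gamma> \<in> CON M"
      note C = all_good(1)[OF G]
      show "hC F (hC F \<Gamma>) = hC F \<Gamma>" "hS F (up \<Gamma>) = sid M (hC F \<Gamma>)" using goodC_D[OF C] by auto
      show "up \<Gamma> \<in> SUB M \<Gamma> (hC F \<Gamma>)" using goodC_D(2)[OF C] by (simp add: sub_def)
      show "bij_betw (hT F) (TY M l \<Gamma>) (TY M l (hC F \<Gamma>))" for l by (rule bij_zt[OF G])
      show "tsub M (hT F A) (up \<Gamma>) = A" if "A \<in> TY M l \<Gamma>" for l A
        using goodT_D(3)[OF all_good(3)] that G by (simp add: ty_def)
      show "msub M (hM F a) (up \<Gamma>) = downstar M i \<Gamma> a" if "A \<in> TY M l \<Gamma>" "a \<in> TM M i \<Gamma> A" for i l A a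
        using goodM_D(3)[OF all_good(4)] that G by (simp add: tm_def)
      show "hT F (tsub M A' (up \<Gamma>)) = A'" if "A' \<in> TY M l (hC F \<Gamma>)" for l A'
        using zt_up[OF G] that z_con[OF G] by (simp add: ty_def)
      show "bij_betw (hM F) (TM M Ze \<Gamma> A) (TM M Ze (hC F \<Gamma>) (hT F A))" if "A \<in> TY M l \<Gamma>" for l A
        using bij_zm that G by (simp add: ty_def)
      show "hM F (msub M a' (up \<Gamma>)) = a'" if "A \<in> TY M l \<Gamma>" "a' \<in> TM M Ze (hC F \<Gamma>) (hT F A)" for l A a'
      proof -
        have A: "ty M l \<Gamma> A" using that(1) G by (simp add: ty_def)
        show ?thesis using zm_up[OF G A] that(2) z_ty[OF A] by (simp add: judgement_defs)
      qed
      fix \<Delta> \<sigma> assume D: "\<Delta> \<in> CON M" and s: "\<sigma> \<in> SUB M \<Gamma> \<Delta>"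
      have S: "sub M \<Gamma> \<Delta> \<sigma>" using G D s by (simp add: sub_def)
      \<comment> \<open>Naturality of both isomorphisms comes from the square \<open>e\<close> of
        \<open>up\<close> with \<sigma>: the two sides substitute along its two composites.\<close>
      note uG = goodC_D(2)[OF C] and uD = goodC_D(2)[OF all_good(1)[OF D]] and e = goodS_D(4)[OF all_good(2)[OF S]]
      show "tsub M (tsub M A' (hS F \<sigma>)) (up \<Gamma>) = tsub M (tsub M A' (up \<Delta>)) \<sigma>" if "A' \<in> TY M l (hC F \<Delta>)" for l A'
      proof -
        have A': "ty M l (hC F \<Delta>) A'" using that z_con[OF D] by (simp add: ty_def)
        show ?thesis using ty_comp[OF z_sub[OF S] uG A'] ty_comp[OF uD S A'] e by simp
      qed
      show "msub M (msub M b' (hS F \<sigma>)) (up \<Gamma>) = msub M (msub M b' (up \<Delta>)) \<sigma>"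
        if "B \<in> TY M l \<Delta>" "b' \<in> TM M Ze (hC F \<Delta>) (hT F B)" for l B b'
      proof -
        have "ty M l \<Delta> B" using that(1) D by (simp add: ty_def)
        from z_ty[OF this] have b': "tm M Ze l (hC F \<Delta>) (hT F B) b'" using that(2) by (simp add: judgement_defs)
        show ?thesis using tm_comp[OF z_sub[OF S] uG b'] tm_comp[OF uD S b'] e by simp
      qed
    qed
  qed
  ultimately show ?thesis by blast
qed

end
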